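(* Fix rational numbers $\beta,\gamma$ such that $\beta\neq\gamma$ and $|\beta+\gamma|\geq 2$. There is a fully polynomial randomized approximation scheme (FPRAS) for $Z_G$, where $G$ is an input graph (of arbitrary degree).
   Context: Graphs are finite undirected multigraphs, possibly with self-loops and parallel edges. For fixed $\beta,\gamma$, let $A=\begin{bmatrix}\beta&1\\1&\gamma\end{bmatrix}$ and for a graph $G=(V,E)$ define $Z_G=\sum_{\sigma\in\{0,1\}^V}\prod_{\{u,v\}\in E}A_{\sigma(u),\sigma(v)}$. *)

theory Defs
  imports
    "HOL-Probability.Probability"
    "HOL-Library.Uprod"
    "HOL-Library.Log_Nat"
    "HOL-Computational_Algebra.Polynomial"
begin

section \<open>Multigraphs and the partition function\<close>

text \<open>A self-loop at \<open>v\<close> is the unordered pair \<open>Upair v v\<close>; parallel edges are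
  repeated elements of the edge multiset.\<close>

record mgraph =
  verts :: "nat set"
  edges :: "nat uprod multiset"

definition multigraph :: "mgraph \<Rightarrow> bool" where
  "multigraph G \<longleftrightarrow> finite (verts G) \<and> (\<forall>e \<in># edges G. set_uprod e \<subseteq> verts G)"

text \<open>The symmetric matrix with rows \<open>(\<beta>, 1)\<close> and \<open>(1, \<gamma>)\<close>, indexed by the spins 0 and 1.\<close>

lift_definition interaction :: "rat \<Rightarrow> rat \<Rightarrow> (nat, rat) commute" is
  "\<lambda>\<beta> \<gamma> i j. if i = 0 \<and> j = 0 then \<beta> else if i = 1 \<and> j = 1 then \<gamma> else 1"
  by auto

definition partition_function :: "rat \<Rightarrow> rat \<Rightarrow> mgraph \<Rightarrow> rat" where
  "partition_function \<beta> \<gamma> G =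
     (\<Sum>\<sigma> \<in> verts G \<rightarrow>\<^sub>E {0, 1}. \<Prod>e \<in># edges G. case_uprod (interaction \<beta> \<gamma>) (map_uprod \<sigma> e))"


section \<open>Randomized algorithms\<close>

text \<open>
  Randomized algorithms are programs of a while-language with fair coin flips, i.e. a
  structured random access machine with the logarithmic cost criterion. A state consists of
  named arrays of integers (a program mentions finitely many names; a scalar variable is a
  cell of an array). Every operation is charged the bit length of each integer involved,
  so that the cost of a run is polynomially related to the running time of a
  probabilistic Turing machine.
\<close>

type_synonym vname = string
type_synonym state = "vname \<Rightarrow> int \<Rightarrow> int"

datatype aexp =
    Num int
  | Read vname aexp
  | Plus aexp aexp
  | Minus aexp aexp
  | Times aexp aexp
  | Div aexp aexp
  | Mod aexp aexp

datatype bexp =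
    Less aexp aexp
  | Equal aexp aexp
  | Neg bexp
  | Conj bexp bexp

datatype com =
    Skip
  | Assign vname aexp aexp
  | Flip vname aexp
  | Seq com com
  | Cond bexp com com
  | While bexp com

definition int_size :: "int \<Rightarrow> nat" where
  "int_size k = 1 + floorlog 2 (nat \<bar>k\<bar>)"

primrec aval :: "aexp \<Rightarrow> state \<Rightarrow> int" where
  "aval (Num k) s = k"
| "aval (Read x a) s = s x (aval a s)"
| "aval (Plus a b) s = aval a s + aval b s"
| "aval (Minus a b) s = aval a s - aval b s"
| "aval (Times a b) s = aval a s * aval b s"
| "aval (Div a b) s = aval a s div aval b s"
| "aval (Mod a b) s = aval a s mod aval b s"

primrec acost :: "aexp \<Rightarrow> state \<Rightarrow> nat" where
  "acost (Num k) s = int_size k"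
| "acost (Read x a) s = acost a s + int_size (aval (Read x a) s)"
| "acost (Plus a b) s = acost a s + acost b s + int_size (aval (Plus a b) s)"
| "acost (Minus a b) s = acost a s + acost b s + int_size (aval (Minus a b) s)"
| "acost (Times a b) s = acost a s + acost b s + int_size (aval (Times a b) s)"
| "acost (Div a b) s = acost a s + acost b s + int_size (aval (Div a b) s)"
| "acost (Mod a b) s = acost a s + acost b s + int_size (aval (Mod a b) s)"

primrec bval :: "bexp \<Rightarrow> state \<Rightarrow> bool" where
  "bval (Less a b) s \<longleftrightarrow> aval a s < aval b s"
| "bval (Equal a b) s \<longleftrightarrow> aval a s = aval b s"
| "bval (Neg b) s \<longleftrightarrow> \<not> bval b s"
| "bval (Conj b c) s \<longleftrightarrow> bval b s \<and> bval c s"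

primrec bcost :: "bexp \<Rightarrow> state \<Rightarrow> nat" where
  "bcost (Less a b) s = 1 + acost a s + acost b s"
| "bcost (Equal a b) s = 1 + acost a s + acost b s"
| "bcost (Neg b) s = 1 + bcost b s"
| "bcost (Conj b c) s = 1 + bcost b s + bcost c s"

definition store :: "vname \<Rightarrow> int \<Rightarrow> int \<Rightarrow> state \<Rightarrow> state" where
  "store x i k s = s(x := (s x)(i := k))"

text \<open>The mass missing from the subprobability distributions below is the probability of
  divergence.\<close>

partial_function (spmf) while_loop ::
  "(state \<Rightarrow> bool) \<Rightarrow> (state \<Rightarrow> nat) \<Rightarrow> (state \<Rightarrow> (state \<times> nat) spmf) \<Rightarrow> state \<Rightarrow> (state \<times> nat) spmf"
where
  "while_loop test cost body s =
     (if test s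
      then bind_spmf (body s) (\<lambda>(s1, t1).
           bind_spmf (while_loop test cost body s1) (\<lambda>(s2, t2).
             return_spmf (s2, 1 + cost s + t1 + t2)))
      else return_spmf (s, 1 + cost s))"

text \<open>The joint distribution of the final state and the running time.\<close>

primrec exec :: "com \<Rightarrow> state \<Rightarrow> (state \<times> nat) spmf" where
  "exec Skip s = return_spmf (s, 1)"
| "exec (Assign x i a) s =
     return_spmf (store x (aval i s) (aval a s) s, 1 + acost i s + acost a s)"
| "exec (Flip x i) s =
     bind_spmf coin_spmf (\<lambda>b. return_spmf (store x (aval i s) (of_bool b) s, 1 + acost i s))"
| "exec (Seq c1 c2) s =
     bind_spmf (exec c1 s) (\<lambda>(s1, t1).
     bind_spmf (exec c2 s1) (\<lambda>(s2, t2). return_spmf (s2, t1 + t2)))"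
| "exec (Cond b c1 c2) s =
     bind_spmf (if bval b s then exec c1 s else exec c2 s) (\<lambda>(s1, t1).
       return_spmf (s1, 1 + bcost b s + t1))"
| "exec (While b c) s = while_loop (bval b) (bcost b) (exec c) s"


section \<open>Fully polynomial randomized approximation schemes\<close>

definition initial_state :: "int list \<Rightarrow> state" where
  "initial_state w = (\<lambda>x i. if x = ''in'' \<and> 0 \<le> i \<and> i < int (length w) then w ! nat i else 0)"

definition input_size :: "int list \<Rightarrow> nat" where
  "input_size w = (\<Sum>k\<leftarrow>w. int_size k)"

text \<open>The output is a fraction with numerator \<open>out[0]\<close> and positive denominator \<open>out[1]\<close>.
  Since \<open>z\<close> may be negative or zero, the relative error is measured against \<open>\<bar>z\<bar>\<close>.\<close>

definition approximates :: "rat \<Rightarrow> rat \<Rightarrow> state \<Rightarrow> bool" where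
  "approximates \<epsilon> z s \<longleftrightarrow>
     s ''out'' 1 > 0 \<and> \<bar>of_int (s ''out'' 0) / of_int (s ''out'' 1) - z\<bar> \<le> \<epsilon> * \<bar>z\<bar>"

text \<open>
  \<open>enc x w\<close> says that the list \<open>w\<close> is an encoding of the instance \<open>x\<close>. The input consists of
  the numerator and denominator of \<open>\<epsilon>\<close> followed by \<open>w\<close>; on every run the time is polynomial
  in the bit length of the input and in \<open>1/\<epsilon>\<close>.
\<close>

definition is_fpras :: "com \<Rightarrow> ('i \<Rightarrow> int list \<Rightarrow> bool) \<Rightarrow> ('i \<Rightarrow> rat) \<Rightarrow> bool" where
  "is_fpras P enc f \<longleftrightarrow>
     (\<exists>p :: real poly. \<forall>x w \<epsilon> a b. enc x w \<and> \<epsilon> > 0 \<and> quotient_of \<epsilon> = (a, b) \<longrightarrow>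
        (let input = a # b # w; D = exec P (initial_state input) in
           lossless_spmf D \<and>
           (\<forall>(s, t) \<in> set_spmf D. real t \<le> poly p (real (input_size input) + 1 / of_rat \<epsilon>)) \<and>
           measure (measure_spmf D) {(s, t). approximates \<epsilon> (f x) s} \<ge> 3 / 4))"

text \<open>A multigraph is presented by the numbers of its vertices and edges, a list of its
  vertices, and a list of its edges with the two endpoints in either order. Listing the
  vertices makes the input size at least the number of vertices, isolated ones included.\<close>

definition encodes_mgraph :: "mgraph \<Rightarrow> int list \<Rightarrow> bool" where
  "encodes_mgraph G w \<longleftrightarrow> multigraph G \<and>
     (\<exists>vs es. distinct vs \<and> set vs = verts G \<and>
        mset (map (\<lambda>(u, v). Upair u v) es) = edges G \<and>
        w = map int (length vs # length es # vs @ concat (map (\<lambda>(u, v). [u, v]) es)))"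

end

theory Submission
  imports Defs
begin

text \<open>
  In the Hadamard basis the interaction matrix becomes the symmetric table with entries
  \<open>a = (\<beta> + \<gamma> + 2) / 4\<close>, \<open>b = (\<beta> - \<gamma>) / 4\<close> and \<open>c = (\<beta> + \<gamma> - 2) / 4\<close>, and the partition function
  becomes \<open>2\<^bsup>|V|\<^esup>\<close> times a sum over the sets of half-edges that meet every vertex in an even number:
  each edge contributes \<open>a\<close>, \<open>b\<close> or \<open>c\<close> according to how many of its halves are chosen. Since
  \<open>|\<beta> + \<gamma>| \<ge> 2\<close>, the numbers \<open>a\<close> and \<open>c\<close> do not have opposite signs, and by parity the factor \<open>b\<close>
  occurs an even number of times, so all summands have the same sign. Because \<open>b \<noteq> 0\<close>, flipping two
  half-edges at a common vertex connects the even sets. The symmetric difference of two even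
  sets can be unwound by such flips so that at most two edges are ever half processed; this is a
  system of canonical paths with an injective encoding, and it yields a Poincare inequality with a
  polynomial constant. If \<open>a\<close> or \<open>c\<close> vanishes, it is replaced by a polynomially small weight; along
  trails in the graph a forbidden edge can be repaired at polynomial cost, so the sets without
  forbidden edges keep at least half of the mass unless there are none. The partition function is
  then a telescoping product of means, estimated by sampling and controlled by a second moment
  bound for the whole product.

  The chain proposes a flip with uniform bits and accepts it with a probability proportional to the
  weights of the touched edges in the new state. This is reversible and has dyadic transition
  probabilities, so fair coins simulate it exactly.
\<close>

section \<open>Even sets of half-edges\<close>

text \<open>The obstacle is that a zero weight may disconnect the even sets, and that the congestion
  bound is polynomial only if weights differ by polynomial factors. So every weight becomes an
  integer between 1 and a polynomial bound \<open>B\<close>: the true coefficients are scaled up,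
  and a vanishing one is replaced by 1. The means are ratios of partition sums in which only the
  first \<open>i\<close> edges carry weight. The sum for \<open>i = 0\<close> is the number of even
  sets and is computed exactly; the last mean is that of the indicator that no substitute weight is
  in use. Each walk starts where the previous one stopped, so the samples are dependent. The mixing
  bound holds from every starting state and hence controls conditional first and second moments;
  these multiply along the stages, and one use of Chebyshev's inequality for the whole product is
  enough. If every even set uses a substitute weight, the indicator vanishes identically and the
  output is exactly 0, as a relative error bound demands.\<close>

definition symd :: "'a set \<Rightarrow> 'a set \<Rightarrow> 'a set" (infixl "\<triangle>" 65) where
  "A \<triangle> B = (A - B) \<union> (B - A)"

lemma in_symd [simp]: "x \<in> A \<triangle> B \<longleftrightarrow> (x \<in> A) \<noteq> (x \<in> B)"
  by (auto simp: symd_def)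

lemma symd_commute: "A \<triangle> B = B \<triangle> A"
  by (auto simp: symd_def)

lemma symd_assoc: "(A \<triangle> B) \<triangle> C = A \<triangle> (B \<triangle> C)"
  by auto

lemma symd_cancel [simp]: "A \<triangle> B \<triangle> B = A"
  by auto

lemma symd_empty [simp]: "A \<triangle> {} = A" "{} \<triangle> A = A"
  by auto

lemma finite_symd [simp]: "finite A \<Longrightarrow> finite B \<Longrightarrow> finite (A \<triangle> B)"
  by (simp add: symd_def)

lemma even_card_symd:
  assumes "finite A" "finite B"
  shows "even (card (A \<triangle> B)) \<longleftrightarrow> (even (card A) \<longleftrightarrow> even (card B))"
proof -
  have "card (A \<triangle> B) = card (A - B) + card (B - A)"
    unfolding symd_def using assms by (intro card_Un_disjoint) auto
  moreover have "card A = card (A - B) + card (A \<inter> B)"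
    using assms by (metis card_Diff_subset_Int card_mono finite_Int inf_le1 le_add_diff_inverse2)
  moreover have "card B = card (B - A) + card (A \<inter> B)"
    using assms by (metis card_Diff_subset_Int card_mono finite_Int inf_le2 inf_commute le_add_diff_inverse2)
  ultimately show ?thesis by auto
qed

text \<open>The involution that exchanges the two halves of an edge.\<close>

definition mate :: "nat \<Rightarrow> nat" where
  "mate h = (if even h then h + 1 else h - 1)"

lemma mate_div [simp]: "mate h div 2 = h div 2"
  by (auto simp: mate_def elim!: oddE)

lemma mate_mate [simp]: "mate (mate h) = h"
  by (auto simp: mate_def elim!: oddE)

lemma mate_neq [simp]: "mate h \<noteq> h" "h \<noteq> mate h"
  by (auto simp: mate_def elim!: oddE)

lemma same_edge: "h div 2 = g div 2 \<longleftrightarrow> g = h \<or> g = mate h"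
  unfolding mate_def by (cases "even h"; cases "even g") (auto elim!: oddE evenE)

text \<open>The halves of edge \<open>j\<close> are \<open>2 * j\<close> and \<open>2 * j + 1\<close>.\<close>

definition pat :: "nat set \<Rightarrow> nat \<Rightarrow> nat" where
  "pat X j = of_bool (2 * j \<in> X) + of_bool (2 * j + 1 \<in> X)"

lemma pat_le_2: "pat X j \<le> 2"
  by (simp add: pat_def)

lemma pat_eqI:
  "(2 * j \<in> X \<longleftrightarrow> 2 * j \<in> Y) \<Longrightarrow> (2 * j + 1 \<in> X \<longleftrightarrow> 2 * j + 1 \<in> Y) \<Longrightarrow> pat X j = pat Y j"
  by (simp add: pat_def)

lemma pat_mate: "pat X (h div 2) = of_bool (h \<in> X) + of_bool (mate h \<in> X)"
  by (cases "even h") (auto simp: pat_def mate_def elim!: oddE evenE)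

text \<open>Only the attachment of half-edges to vertices is recorded, so self-loops and parallel
  edges need no separate treatment.\<close>

locale half_edge_graph =
  fixes m :: nat and vt :: "nat \<Rightarrow> 'v"
begin

definition even_at :: "nat set \<Rightarrow> bool" where
  "even_at X \<longleftrightarrow> (\<forall>v. even (card {h \<in> X. vt h = v}))"

definition even_sets :: "nat set set" where
  "even_sets = {X. X \<subseteq> {..<2 * m} \<and> even_at X}"

text \<open>Ordered pairs, because the chain draws the two half-edges independently; each flip is
  therefore proposed in two ways.\<close>

definition pairs :: "(nat \<times> nat) set" where
  "pairs = {(h, g). h < 2 * m \<and> g < 2 * m \<and> h \<noteq> g \<and> vt h = vt g}"

lemma finite_even_sets [simp]: "finite even_sets"
  by (rule finite_subset[of _ "Pow {..<2 * m}"]) (auto simp: even_sets_def)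

lemma finite_pairs [simp]: "finite pairs"
  by (rule finite_subset[of _ "{..<2 * m} \<times> {..<2 * m}"]) (auto simp: pairs_def)

lemma empty_even [simp]: "{} \<in> even_sets"
  by (simp add: even_sets_def even_at_def)

lemma even_setsD: "X \<in> even_sets \<Longrightarrow> finite X" "X \<in> even_sets \<Longrightarrow> h \<in> X \<Longrightarrow> h < 2 * m"
  by (auto simp: even_sets_def intro: finite_subset)

lemma even_at_symd:
  assumes "finite X" "finite Y" "even_at X" "even_at Y"
  shows "even_at (X \<triangle> Y)"
  unfolding even_at_def
proof
  fix v
  have "{h \<in> X \<triangle> Y. vt h = v} = {h \<in> X. vt h = v} \<triangle> {h \<in> Y. vt h = v}" by auto
  then show "even (card {h \<in> X \<triangle> Y. vt h = v})"
    using assms by (simp add: even_card_symd even_at_def)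
qed

lemma even_sets_symd: "X \<in> even_sets \<Longrightarrow> Y \<in> even_sets \<Longrightarrow> X \<triangle> Y \<in> even_sets"
  using even_at_symd[of X Y] even_setsD[of X] even_setsD[of Y] by (auto simp: even_sets_def)

lemma even_at_pair: "h \<noteq> g \<Longrightarrow> vt h = vt g \<Longrightarrow> even_at {h, g}"
proof -
  assume "h \<noteq> g" "vt h = vt g"
  then have "{k \<in> {h, g}. vt k = v} = (if v = vt h then {h, g} else {})" for v by auto
  then show ?thesis using \<open>h \<noteq> g\<close> by (simp add: even_at_def)
qed

lemma pair_even: "(h, g) \<in> pairs \<Longrightarrow> {h, g} \<in> even_sets"
  by (auto simp: even_sets_def pairs_def even_at_pair)

lemma even_sets_flip: "(h, g) \<in> pairs \<Longrightarrow> X \<in> even_sets \<Longrightarrow> X \<triangle> {h, g} \<in> even_sets"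
  using even_sets_symd pair_even by blast

lemma even_at_partner:
  assumes "finite X" "even_at X" "h \<in> X"
  obtains g where "g \<in> X" "g \<noteq> h" "vt g = vt h"
proof -
  let ?A = "{k \<in> X. vt k = vt h}"
  have "even (card ?A)" "h \<in> ?A" "finite ?A" using assms by (auto simp: even_at_def)
  moreover have "?A \<noteq> {h}" using calculation(1) by (metis card_1_singleton_iff One_nat_def odd_one)
  ultimately have "\<exists>g \<in> ?A. g \<noteq> h" by blast
  then show ?thesis using that by blast
qed

subsection \<open>Unwinding an even set two half-edges at a time\<close>

text \<open>With \<open>D = X \<triangle> Y\<close>, these mark the half processed edges. On any
  other edge \<open>U\<close> contains all or none of \<open>D\<close>, so
  \<open>X \<triangle> U\<close> looks there like \<open>Y\<close> or like \<open>X\<close>.\<close>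

definition cut :: "nat set \<Rightarrow> nat set \<Rightarrow> nat set" where
  "cut D U = {h \<in> U. mate h \<in> D - U}"

definition unwound :: "nat set \<Rightarrow> nat set \<Rightarrow> bool" where
  "unwound D U \<longleftrightarrow> U \<subseteq> D \<and> even_at U \<and> card (cut D U) \<le> 2"

definition unwind_step :: "nat set \<Rightarrow> nat set \<Rightarrow> nat set \<Rightarrow> bool" where
  "unwind_step D U U' \<longleftrightarrow> (\<exists>h g. h \<in> D - U \<and> g \<in> D - U \<and> h \<noteq> g \<and> vt h = vt g \<and>
     U' = U \<union> {h, g} \<and> unwound D U')"

text \<open>Continuing at the mate of a cut half-edge never increases the number of cut edges, and
  starting afresh when nothing is cut creates at most two.\<close>

lemma unwind_step_exists:
  assumes D: "finite D" "even_at D" and U: "unwound D U" "U \<noteq> D"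
  shows "\<exists>U'. unwind_step D U U'"
proof -
  have UD: "U \<subseteq> D" and fU: "finite U" using U D by (auto simp: unwound_def intro: finite_subset)
  have eDU: "even_at (D - U)"
  proof -
    have "D - U = D \<triangle> U" using UD by auto
    then show ?thesis using even_at_symd[of D U] D U fU by (auto simp: unwound_def)
  qed
  have fcut: "finite (cut D V)" if "V \<subseteq> D" for V
    using that D(1) by (auto simp: cut_def intro: finite_subset)
  obtain h where h: "h \<in> D - U" and hc: "cut D U \<noteq> {} \<Longrightarrow> mate h \<in> cut D U"
  proof (cases "cut D U = {}")
    case True
    then show ?thesis using that U(2) UD by blast
  next
    case False
    then obtain k where k: "k \<in> cut D U" by blast
    show ?thesis by (rule that[of "mate k"]) (use k in \<open>auto simp: cut_def\<close>)
  qed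
  obtain g where g: "g \<in> D - U" "g \<noteq> h" "vt g = vt h"
    using even_at_partner[OF _ eDU h] D(1) by auto
  let ?U' = "U \<union> {h, g}"
  \<comment> \<open>Adding \<open>h\<close> removes its mate from the cut. If that mate was cut, it
    lies in \<open>U\<close>, so \<open>h\<close> itself is not cut and only \<open>g\<close> can be
    new.\<close>
  have sub: "cut D ?U' \<subseteq> (cut D U - {mate h}) \<union> {g} \<union> (if mate h \<in> cut D U then {} else {h})"
    using h g by (auto simp: cut_def)
  have "card (cut D ?U') \<le> 2"
  proof (cases "cut D U = {}")
    case True
    then have "cut D ?U' \<subseteq> {g, h}" using sub by (auto split: if_splits)
    then have "card (cut D ?U') \<le> card {g, h}" by (intro card_mono) auto
    then show ?thesis using g(2) by simp
  next
    case False
    have mh: "mate h \<in> cut D U" by (rule hc[OF False])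
    have "card (cut D ?U') \<le> card ((cut D U - {mate h}) \<union> {g})"
      using sub mh fcut[OF UD] by (intro card_mono) auto
    also have "\<dots> \<le> card (cut D U - {mate h}) + 1"
      by (metis card_Un_le card_1_singleton_iff One_nat_def)
    also have "\<dots> = card (cut D U)" using mh fcut[OF UD]
      by (metis card_Suc_Diff1 Suc_eq_plus1)
    finally show ?thesis using U by (simp add: unwound_def)
  qed
  moreover have "even_at ?U'"
  proof -
    have "?U' = U \<triangle> {h, g}" using h g by auto
    then show ?thesis using even_at_symd[of U "{h, g}"] fU U g even_at_pair[of h g]
      by (simp add: unwound_def)
  qed
  ultimately have "unwind_step D U ?U'"
    using h g UD unfolding unwind_step_def unwound_def by (intro exI[of _ h] exI[of _ g]) auto
  then show ?thesis by blast
qed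

text \<open>The choice depends on \<open>D\<close> alone, so two pairs with the same difference
  follow the same unwinding; this makes the path encoding invertible. Once \<open>D\<close> is
  reached the sequence stays there, which gives all paths the same length.\<close>

primrec unwind :: "nat set \<Rightarrow> nat \<Rightarrow> nat set" where
  "unwind D 0 = {}"
| "unwind D (Suc j) = (if unwind D j = D then D else (SOME U. unwind_step D (unwind D j) U))"

lemma unwind_properties:
  assumes D: "D \<in> even_sets"
  shows "unwound D (unwind D j)"
    and "unwind D j \<noteq> D \<Longrightarrow> unwind_step D (unwind D j) (unwind D (Suc j))"
proof -
  note fD = even_setsD(1)[OF D]
  have eD: "even_at D" using D by (simp add: even_sets_def)
  have step: "unwind_step D U (SOME U'. unwind_step D U U')" if "unwound D U" "U \<noteq> D" for U
    using unwind_step_exists[OF fD eD that] by (rule someI_ex)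
  show inv: "unwound D (unwind D j)" for j
  proof (induction j)
    case 0
    then show ?case by (simp add: unwound_def even_at_def cut_def)
  next
    case (Suc j)
    show ?case
    proof (cases "unwind D j = D")
      case True
      then show ?thesis using Suc by simp
    next
      case False
      have "unwound D U'" if "unwind_step D U U'" for U U' using that by (auto simp: unwind_step_def)
      from this[OF step[OF Suc False]] show ?thesis using False by simp
    qed
  qed
  show "unwind_step D (unwind D j) (unwind D (Suc j))" if "unwind D j \<noteq> D"
    using step[OF inv that] that by simp
qed

lemma unwind_complete:
  assumes D: "D \<in> even_sets"
  shows "unwind D m = D"
proof (rule ccontr)
  assume ne: "unwind D m \<noteq> D"
  have neq: "unwind D j \<noteq> D" if "j \<le> m" for j
  proof
    assume "unwind D j = D"
    then have "unwind D (j + i) = D" for i by (induction i) auto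
    from this[of "m - j"] ne that show False by simp
  qed
  \<comment> \<open>Every step before completion adds two new half-edges, so \<open>m + 1\<close>
    such steps would exceed the \<open>2 * m\<close> that exist.\<close>
  have "finite (unwind D j) \<and> card (unwind D j) = 2 * j" if "j \<le> Suc m" for j
    using that
  proof (induction j)
    case (Suc j)
    from unwind_properties(2)[OF D neq] Suc.prems
    obtain h g where "h \<in> D - unwind D j" "g \<in> D - unwind D j" "h \<noteq> g"
      "unwind D (Suc j) = unwind D j \<union> {h, g}" unfolding unwind_step_def by (metis Suc_le_mono)
    then show ?case using Suc by simp
  qed simp
  from this[of "Suc m"] have "card (unwind D (Suc m)) = 2 * Suc m" by simp
  moreover have "card (unwind D (Suc m)) \<le> card {..<2 * m}"
    using unwind_properties(1)[OF D, of "Suc m"] D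
    by (intro card_mono) (auto simp: unwound_def even_sets_def simp del: unwind.simps)
  ultimately show False by simp
qed

section \<open>Canonical paths and the Poincare inequality\<close>

lemma unwind_even:
  assumes "D \<in> even_sets"
  shows "unwind D j \<in> even_sets"
  using unwind_properties(1)[OF assms, of j] assms by (auto simp: even_sets_def unwound_def)

lemma unwind_Suc_cases:
  assumes D: "D \<in> even_sets" and X: "X \<in> even_sets"
  obtains "X \<triangle> unwind D (Suc j) = X \<triangle> unwind D j"
  | h g where "(h, g) \<in> pairs" "X \<triangle> unwind D (Suc j) = X \<triangle> unwind D j \<triangle> {h, g}"
proof (cases "unwind D j = D")
  case True
  then show ?thesis using that(1) by simp
next
  case False
  from unwind_properties(2)[OF D this]
  obtain h g where hg: "h \<in> D - unwind D j" "g \<in> D - unwind D j" "h \<noteq> g" "vt h = vt g"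
    "unwind D (Suc j) = unwind D j \<union> {h, g}" unfolding unwind_step_def by auto
  have "(h, g) \<in> pairs" using hg even_setsD(2)[OF D] by (auto simp: pairs_def)
  moreover have "X \<triangle> unwind D (Suc j) = X \<triangle> unwind D j \<triangle> {h, g}"
    using hg by auto
  ultimately show ?thesis by (rule that(2))
qed

lemma pat_uncut:
  assumes "j \<notin> (\<lambda>h. h div 2) ` cut (X \<triangle> Y) U" "U \<subseteq> X \<triangle> Y"
  shows "(pat (X \<triangle> U) j = pat X j \<and> pat (Y \<triangle> U) j = pat Y j) \<or>
         (pat (X \<triangle> U) j = pat Y j \<and> pat (Y \<triangle> U) j = pat X j)"
proof -
  have m: "mate (2 * j) = 2 * j + 1" "mate (2 * j + 1) = 2 * j" by (auto simp: mate_def)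
  have "2 * j \<notin> cut (X \<triangle> Y) U" "2 * j + 1 \<notin> cut (X \<triangle> Y) U"
    using assms(1) by (force simp: image_iff)+
  then show ?thesis using assms(2) m
    unfolding cut_def pat_def by auto
qed

text \<open>Edges without a cut keep the unordered pair of their patterns, and a cut edge costs at
  most a factor \<open>B\<^sup>2\<close>.\<close>

lemma weight_exchange:
  fixes w :: "nat \<Rightarrow> nat \<Rightarrow> real"
  assumes w: "\<And>j p. 1 \<le> w j p" "\<And>j p. w j p \<le> B"
    and XY: "X \<in> even_sets" "Y \<in> even_sets" and U: "unwound (X \<triangle> Y) U"
  shows "(\<Prod>j<n. w j (pat X j)) * (\<Prod>j<n. w j (pat Y j)) \<le>
     B ^ 4 * ((\<Prod>j<n. w j (pat (X \<triangle> U) j)) * (\<Prod>j<n. w j (pat (Y \<triangle> U) j)))"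
proof -
  define C where "C = (\<lambda>h. h div 2) ` cut (X \<triangle> Y) U"
  have B1: "1 \<le> B" using w(1)[of 0 0] w(2)[of 0 0] by linarith
  have fin: "finite (cut (X \<triangle> Y) U)"
    using U even_setsD(1)[OF even_sets_symd[OF XY]] by (auto simp: unwound_def cut_def intro: finite_subset)
  have C2: "card C \<le> 2" "finite C" using card_image_le[OF fin, of "\<lambda>h. h div 2"] U fin
    by (auto simp: C_def unwound_def)
  let ?c = "\<lambda>j. if j \<in> C then B ^ 2 else 1"
  have "(\<Prod>j<n. w j (pat X j) * w j (pat Y j)) \<le>
    (\<Prod>j<n. ?c j * (w j (pat (X \<triangle> U) j) * w j (pat (Y \<triangle> U) j)))"
  proof (rule prod_mono, intro conjI)
    fix j
    show "0 \<le> w j (pat X j) * w j (pat Y j)"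
      using w(1)[of j] by (intro mult_nonneg_nonneg) (meson order_trans zero_le_one)+
    show "w j (pat X j) * w j (pat Y j) \<le> ?c j * (w j (pat (X \<triangle> U) j) * w j (pat (Y \<triangle> U) j))"
    proof (cases "j \<in> C")
      case True
      have "w j (pat X j) * w j (pat Y j) \<le> B * B"
        using w(1)[of j] w(2)[of j] B1 by (intro mult_mono) (meson order_trans zero_le_one | simp)+
      also have "\<dots> \<le> B ^ 2 * (w j (pat (X \<triangle> U) j) * w j (pat (Y \<triangle> U) j))"
        using mult_mono[OF w(1) w(1), of j "pat (X \<triangle> U) j" j "pat (Y \<triangle> U) j"] w(1)[of j "pat (X \<triangle> U) j"]
        by (simp add: power2_eq_square mult_le_cancel_left1)
      finally show ?thesis using True by simp
    next
      case False
      then show ?thesis using pat_uncut[of j X Y U] U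
        by (auto simp: C_def unwound_def mult.commute)
    qed
  qed
  also have "\<dots> = (\<Prod>j<n. ?c j) * ((\<Prod>j<n. w j (pat (X \<triangle> U) j)) * (\<Prod>j<n. w j (pat (Y \<triangle> U) j)))"
    by (simp add: prod.distrib)
  also have "\<dots> \<le> B ^ 4 * ((\<Prod>j<n. w j (pat (X \<triangle> U) j)) * (\<Prod>j<n. w j (pat (Y \<triangle> U) j)))"
  proof (rule mult_right_mono)
    have "(\<Prod>j<n. ?c j) = (B ^ 2) ^ card ({..<n} \<inter> C)"
      by (simp add: prod.If_cases Int_def)
    also have "\<dots> \<le> (B ^ 2) ^ 2"
    proof (rule power_increasing)
      have "card ({..<n} \<inter> C) \<le> card C" using C2 by (intro card_mono) auto
      then show "card ({..<n} \<inter> C) \<le> 2" using C2 by simp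
    qed (use B1 in simp)
    finally show "(\<Prod>j<n. ?c j) \<le> B ^ 4" by simp
    show "0 \<le> (\<Prod>j<n. w j (pat (X \<triangle> U) j)) * (\<Prod>j<n. w j (pat (Y \<triangle> U) j))"
      using w(1) by (intro mult_nonneg_nonneg prod_nonneg ballI) (meson order_trans zero_le_one)+
  qed
  finally show ?thesis by (simp add: prod.distrib)
qed

text \<open>Along the path through the sets \<open>X \<triangle> unwind (X \<triangle> Y) j\<close>,
  Cauchy-Schwarz costs one factor \<open>m\<close> and the number of steps another.
  \<open>weight_exchange\<close> moves the weights of the endpoints to the current set and its
  companion \<open>Y \<triangle> unwind (X \<triangle> Y) j\<close>; for fixed \<open>j\<close>
  these two again run over all pairs of even sets, and summing over the companion leaves the total
  weight.\<close>

theorem poincare_pairs: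
  fixes w :: "nat \<Rightarrow> nat \<Rightarrow> real" and f W :: "nat set \<Rightarrow> real" and n :: nat and B :: real
  assumes w: "\<And>j p. 1 \<le> w j p" "\<And>j p. w j p \<le> B"
  defines "W \<equiv> \<lambda>X. \<Prod>j<n. w j (pat X j)"
  shows "(\<Sum>X\<in>even_sets. \<Sum>Y\<in>even_sets. W X * W Y * (f X - f Y)\<^sup>2) \<le>
    (real m)\<^sup>2 * B ^ 4 * (\<Sum>X\<in>even_sets. W X) *
      (\<Sum>X\<in>even_sets. \<Sum>(h, g)\<in>pairs. W X * (f (X \<triangle> {h, g}) - f X)\<^sup>2)"
proof -
  let ?S = even_sets
  define U where "U X Y j = unwind (X \<triangle> Y) j" for X Y j
  define G where "G Z = (\<Sum>(h, g)\<in>pairs. (f (Z \<triangle> {h, g}) - f Z)\<^sup>2)" for Z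
  have W0: "0 \<le> W X" for X unfolding W_def
    by (intro prod_nonneg ballI) (meson order_trans zero_le_one w(1))
  have B0: "0 \<le> B" using w(1)[of 0 0] w(2)[of 0 0] by linarith
  have G0: "0 \<le> G Z" for Z unfolding G_def by (intro sum_nonneg) auto
  have one: "W X * W Y * (f X - f Y)\<^sup>2 \<le>
      m * (\<Sum>j<m. B ^ 4 * (W (X \<triangle> U X Y j) * W (Y \<triangle> U X Y j) * G (X \<triangle> U X Y j)))"
    if XY: "X \<in> ?S" "Y \<in> ?S" for X Y
  proof -
    define z where "z j = f (X \<triangle> U X Y j)" for j
    note D = even_sets_symd[OF XY]
    have "z 0 = f X" "z m = f Y"
      using unwind_complete[OF D] by (simp_all add: z_def U_def symd_assoc[symmetric] symd_commute[of X])
    then have "f X - f Y = (\<Sum>j<m. z j - z (Suc j))"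
      by (simp add: sum_lessThan_telescope')
    then have "(f X - f Y)\<^sup>2 \<le> m * (\<Sum>j<m. (z j - z (Suc j))\<^sup>2)"
      using sum_squared_le_sum_of_squares[of "\<lambda>j. z j - z (Suc j)" "{..<m}"] by (simp add: mult.commute)
    then have "W X * W Y * (f X - f Y)\<^sup>2 \<le> W X * W Y * (m * (\<Sum>j<m. (z j - z (Suc j))\<^sup>2))"
      using W0 by (intro mult_left_mono) auto
    also have "\<dots> = m * (\<Sum>j<m. W X * W Y * (z j - z (Suc j))\<^sup>2)"
      by (simp add: sum_distrib_left mult_ac)
    also have "\<dots> \<le> m * (\<Sum>j<m. B ^ 4 * (W (X \<triangle> U X Y j) * W (Y \<triangle> U X Y j) * G (X \<triangle> U X Y j)))"
    proof (intro mult_left_mono sum_mono)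
      fix j
      have 1: "(z j - z (Suc j))\<^sup>2 \<le> G (X \<triangle> U X Y j)"
      proof (rule unwind_Suc_cases[OF D XY(1), of j])
        assume "X \<triangle> unwind (X \<triangle> Y) (Suc j) = X \<triangle> unwind (X \<triangle> Y) j"
        then show ?thesis using G0 by (simp add: z_def U_def del: unwind.simps)
      next
        fix h g assume hg: "(h, g) \<in> pairs"
          "X \<triangle> unwind (X \<triangle> Y) (Suc j) = X \<triangle> unwind (X \<triangle> Y) j \<triangle> {h, g}"
        have "(case (h, g) of (h, g) \<Rightarrow> (f (X \<triangle> U X Y j \<triangle> {h, g}) - f (X \<triangle> U X Y j))\<^sup>2) \<le> G (X \<triangle> U X Y j)"
          unfolding G_def by (rule member_le_sum[OF hg(1)]) auto
        then show ?thesis using hg(2) by (simp add: z_def U_def power2_commute del: unwind.simps)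
      qed
      have "W X * W Y \<le> B ^ 4 * (W (X \<triangle> U X Y j) * W (Y \<triangle> U X Y j))"
        unfolding W_def U_def by (rule weight_exchange[OF w XY unwind_properties(1)[OF D]])
      then have "W X * W Y * (z j - z (Suc j))\<^sup>2 \<le>
          B ^ 4 * (W (X \<triangle> U X Y j) * W (Y \<triangle> U X Y j)) * G (X \<triangle> U X Y j)"
        by (rule mult_mono[OF _ 1]) (use W0 B0 in auto)
      then show "W X * W Y * (z j - z (Suc j))\<^sup>2 \<le>
          B ^ 4 * (W (X \<triangle> U X Y j) * W (Y \<triangle> U X Y j) * G (X \<triangle> U X Y j))"
        by (simp add: mult_ac)
    qed simp
    finally show ?thesis .
  qed
  \<comment> \<open>The current set and its companion have the same difference as \<open>X\<close>
    and \<open>Y\<close>, hence the same unwinding, so the map is an involution.\<close>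
  have swap: "(\<Sum>(X, Y)\<in>?S \<times> ?S. W (X \<triangle> U X Y j) * W (Y \<triangle> U X Y j) * G (X \<triangle> U X Y j)) =
      (\<Sum>(X, Y)\<in>?S \<times> ?S. W X * W Y * G X)" for j
  proof (rule sum.reindex_bij_witness[of _ "\<lambda>(X, Y). (X \<triangle> U X Y j, Y \<triangle> U X Y j)"
        "\<lambda>(X, Y). (X \<triangle> U X Y j, Y \<triangle> U X Y j)"])
    have inv: "X \<triangle> V \<triangle> (Y \<triangle> V) = X \<triangle> Y" for X Y V :: "nat set" by auto
    fix a assume a: "a \<in> ?S \<times> ?S"
    obtain X Y where [simp]: "a = (X, Y)" by force
    have e: "U X Y j \<in> ?S" using a unwind_even[OF even_sets_symd] by (auto simp: U_def)
    show "(case case a of (X, Y) \<Rightarrow> (X \<triangle> U X Y j, Y \<triangle> U X Y j) of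
          (X, Y) \<Rightarrow> (X \<triangle> U X Y j, Y \<triangle> U X Y j)) = a"
      by (simp add: U_def inv)
    then show "(case case a of (X, Y) \<Rightarrow> (X \<triangle> U X Y j, Y \<triangle> U X Y j) of
          (X, Y) \<Rightarrow> (X \<triangle> U X Y j, Y \<triangle> U X Y j)) = a" .
    show "(case a of (X, Y) \<Rightarrow> (X \<triangle> U X Y j, Y \<triangle> U X Y j)) \<in> ?S \<times> ?S"
      using a e by (auto intro: even_sets_symd)
    then show "(case a of (X, Y) \<Rightarrow> (X \<triangle> U X Y j, Y \<triangle> U X Y j)) \<in> ?S \<times> ?S" .
    show "(case case a of (X, Y) \<Rightarrow> (X \<triangle> U X Y j, Y \<triangle> U X Y j) of (X, Y) \<Rightarrow> W X * W Y * G X) =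
        (case a of (X, Y) \<Rightarrow> W (X \<triangle> U X Y j) * W (Y \<triangle> U X Y j) * G (X \<triangle> U X Y j))"
      by simp
  qed
  have "(\<Sum>X\<in>?S. \<Sum>Y\<in>?S. W X * W Y * (f X - f Y)\<^sup>2) \<le>
     (\<Sum>X\<in>?S. \<Sum>Y\<in>?S. m * (\<Sum>j<m. B ^ 4 * (W (X \<triangle> U X Y j) * W (Y \<triangle> U X Y j) * G (X \<triangle> U X Y j))))"
    by (intro sum_mono one)
  also have "\<dots> = m * (\<Sum>j<m. B ^ 4 *
     (\<Sum>(X, Y)\<in>?S \<times> ?S. W (X \<triangle> U X Y j) * W (Y \<triangle> U X Y j) * G (X \<triangle> U X Y j)))"
    unfolding sum_distrib_left[symmetric] sum.cartesian_product[symmetric]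
    by (subst (2) sum.swap, subst sum.swap) (simp add: sum_distrib_left[symmetric])
  also have "\<dots> = (real m)\<^sup>2 * B ^ 4 * (\<Sum>(X, Y)\<in>?S \<times> ?S. W X * W Y * G X)"
    unfolding swap by (simp add: power2_eq_square)
  also have "(\<Sum>(X, Y)\<in>?S \<times> ?S. W X * W Y * G X) = (\<Sum>X\<in>?S. W X) * (\<Sum>X\<in>?S. W X * G X)"
    unfolding sum.cartesian_product[symmetric] sum_product
    by (subst sum.swap) (simp add: mult_ac)
  also have "(\<Sum>X\<in>?S. W X * G X) = (\<Sum>X\<in>?S. \<Sum>(h, g)\<in>pairs. W X * (f (X \<triangle> {h, g}) - f X)\<^sup>2)"
    by (simp add: G_def sum_distrib_left case_prod_unfold)
  finally show ?thesis by (simp only: mult.assoc)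
qed

end

section \<open>Convergence of reversible lazy chains\<close>

text \<open>\<open>c p X\<close> is the probability of applying move \<open>p\<close> in state
  \<open>X\<close>. As moves are involutions, detailed balance is a condition on each move
  separately. Laziness replaces any discussion of negative eigenvalues.\<close>

locale reversible_moves =
  fixes S :: "'a set" and P :: "'p set" and W :: "'a \<Rightarrow> real"
    and c :: "'p \<Rightarrow> 'a \<Rightarrow> real" and act :: "'p \<Rightarrow> 'a \<Rightarrow> 'a"
  assumes finite_S: "finite S" and finite_P: "finite P"
    and W_pos: "\<And>X. X \<in> S \<Longrightarrow> 0 < W X"
    and c_nonneg: "\<And>p X. 0 \<le> c p X"
    and act_in: "\<And>p X. p \<in> P \<Longrightarrow> X \<in> S \<Longrightarrow> act p X \<in> S"
    and act_act: "\<And>p X. p \<in> P \<Longrightarrow> X \<in> S \<Longrightarrow> act p (act p X) = X"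
    and balance: "\<And>p X. p \<in> P \<Longrightarrow> X \<in> S \<Longrightarrow> W X * c p X = W (act p X) * c p (act p X)"
    and lazy: "\<And>X. X \<in> S \<Longrightarrow> (\<Sum>p\<in>P. c p X) \<le> 1 / 2"
begin

text \<open>The transition operator: the expectation of \<open>f\<close> after one step from
  \<open>X\<close>.\<close>

definition kern :: "('a \<Rightarrow> real) \<Rightarrow> 'a \<Rightarrow> real" where
  "kern f X = f X + (\<Sum>p\<in>P. c p X * (f (act p X) - f X))"

text \<open>Twice the usual Dirichlet form, with respect to the unnormalised weight.\<close>

definition energy :: "('a \<Rightarrow> real) \<Rightarrow> real" where
  "energy f = (\<Sum>X\<in>S. \<Sum>p\<in>P. W X * c p X * (f (act p X) - f X)\<^sup>2)"

text \<open>Each move permutes \<open>S\<close> and preserves the flow \<open>W X * c p X\<close>,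
  so the two ends of every transition may be exchanged.\<close>

lemma flow_swap:
  "(\<Sum>X\<in>S. \<Sum>p\<in>P. W X * c p X * F X (act p X)) = (\<Sum>X\<in>S. \<Sum>p\<in>P. W X * c p X * F (act p X) X)"
proof -
  have "(\<Sum>X\<in>S. W X * c p X * F X (act p X)) = (\<Sum>X\<in>S. W X * c p X * F (act p X) X)" if "p \<in> P" for p
    by (rule sum.reindex_bij_witness[of _ "act p" "act p"])
      (use that in \<open>auto simp: act_in act_act balance[symmetric]\<close>)
  then have "(\<Sum>p\<in>P. \<Sum>X\<in>S. W X * c p X * F X (act p X)) = (\<Sum>p\<in>P. \<Sum>X\<in>S. W X * c p X * F (act p X) X)"
    by (rule sum.cong[OF refl])
  then show ?thesis by (subst (1 2) sum.swap)
qed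

lemma kern_sum: "(\<Sum>X\<in>S. W X * kern f X) = (\<Sum>X\<in>S. W X * f X)"
proof -
  have "(\<Sum>X\<in>S. \<Sum>p\<in>P. W X * c p X * (f (act p X) - f X)) = 0"
    using flow_swap[of "\<lambda>a b. f b - f a"]
    by (simp add: sum_subtractf right_diff_distrib)
  then show ?thesis
    by (simp add: kern_def distrib_left sum.distrib sum_distrib_left mult.assoc)
qed

text \<open>Write \<open>kern f\<close> as \<open>f + L\<close>. By reversibility the cross term is
  minus the energy, and by Cauchy-Schwarz with laziness the square of \<open>L\<close> contributes
  at most half of it.\<close>

lemma kern_contract: "(\<Sum>X\<in>S. W X * (kern f X)\<^sup>2) \<le> (\<Sum>X\<in>S. W X * (f X)\<^sup>2) - energy f / 2"
proof -
  define L where "L X = (\<Sum>p\<in>P. c p X * (f (act p X) - f X))" for X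
  have cross: "2 * (\<Sum>X\<in>S. W X * (f X * L X)) = - energy f"
  proof -
    have "2 * (\<Sum>X\<in>S. W X * (f X * L X)) =
        2 * (\<Sum>X\<in>S. \<Sum>p\<in>P. W X * c p X * (f X * (f (act p X) - f X)))"
      by (simp add: L_def sum_distrib_left mult_ac)
    also have "\<dots> = (\<Sum>X\<in>S. \<Sum>p\<in>P. W X * c p X * (f X * (f (act p X) - f X))) +
        (\<Sum>X\<in>S. \<Sum>p\<in>P. W X * c p X * (f (act p X) * (f X - f (act p X))))"
      using flow_swap[of "\<lambda>a b. f a * (f b - f a)"] by simp
    also have "\<dots> = - energy f"
      unfolding energy_def sum.distrib[symmetric] sum_negf[symmetric]
      by (intro sum.cong refl) (simp add: power2_eq_square algebra_simps)
    finally show ?thesis .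
  qed
  have "(\<Sum>X\<in>S. W X * (L X)\<^sup>2) \<le> (\<Sum>X\<in>S. W X * (1 / 2 * (\<Sum>p\<in>P. c p X * (f (act p X) - f X)\<^sup>2)))"
  proof (intro sum_mono mult_left_mono)
    fix X assume X: "X \<in> S"
    let ?d = "\<lambda>p. f (act p X) - f X"
    have "(L X)\<^sup>2 = (\<Sum>p\<in>P. sqrt (c p X) * (sqrt (c p X) * ?d p))\<^sup>2"
      by (simp add: L_def mult.assoc[symmetric] c_nonneg)
    also have "\<dots> \<le> (\<Sum>p\<in>P. (sqrt (c p X))\<^sup>2) * (\<Sum>p\<in>P. (sqrt (c p X) * ?d p)\<^sup>2)"
      by (rule Cauchy_Schwarz_ineq_sum)
    also have "\<dots> = (\<Sum>p\<in>P. c p X) * (\<Sum>p\<in>P. c p X * (?d p)\<^sup>2)"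
      by (simp add: power_mult_distrib c_nonneg)
    also have "\<dots> \<le> 1 / 2 * (\<Sum>p\<in>P. c p X * (?d p)\<^sup>2)"
      using lazy[OF X] by (intro mult_right_mono sum_nonneg) (auto simp: c_nonneg)
    finally show "(L X)\<^sup>2 \<le> 1 / 2 * (\<Sum>p\<in>P. c p X * (?d p)\<^sup>2)" .
  qed (use W_pos in \<open>auto intro: less_imp_le\<close>)
  also have "\<dots> = energy f / 2"
    by (simp add: energy_def sum_distrib_left sum_divide_distrib mult.assoc)
  finally have sq: "(\<Sum>X\<in>S. W X * (L X)\<^sup>2) \<le> energy f / 2" .
  have kL: "kern f X = f X + L X" for X by (simp add: kern_def L_def)
  have "(\<Sum>X\<in>S. W X * (kern f X)\<^sup>2) = (\<Sum>X\<in>S. W X * (f X)\<^sup>2) + 2 * (\<Sum>X\<in>S. W X * (f X * L X)) + (\<Sum>X\<in>S. W X * (L X)\<^sup>2)"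
    unfolding sum_distrib_left sum.distrib[symmetric]
    by (intro sum.cong refl) (simp add: kL power2_eq_square algebra_simps)
  then show ?thesis using cross sq by simp
qed

lemma kern_add_const: "kern (\<lambda>X. f X - a) X = kern f X - a"
  by (simp add: kern_def)

lemma kern_pow_add_const: "(kern ^^ n) (\<lambda>X. f X - a) X = (kern ^^ n) f X - a"
proof (induction n arbitrary: X)
  case (Suc n)
  have "(kern ^^ n) (\<lambda>X. f X - a) = (\<lambda>X. (kern ^^ n) f X - a)" using Suc by auto
  then show ?case by (simp add: kern_add_const)
qed simp

text \<open>For a function of weighted mean zero the double sum in the Poincare inequality is
  \<open>2 * sum W S\<close> times the squared norm, so every application of \<open>kern\<close>
  shrinks the squared norm by \<open>1 - 1 / r\<close>. A single summand of the norm then gives a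
  bound from one given starting state.\<close>

theorem kern_pow_converges:
  fixes g :: "'a \<Rightarrow> real"
  assumes S0: "S \<noteq> {}" and r: "1 \<le> r"
    and poincare: "\<And>f. (\<Sum>X\<in>S. \<Sum>Y\<in>S. W X * W Y * (f X - f Y)\<^sup>2) \<le> r * sum W S * energy f"
    and X: "X \<in> S"
  defines "\<mu> \<equiv> (\<Sum>X\<in>S. W X * g X) / sum W S"
  shows "W X * ((kern ^^ n) g X - \<mu>)\<^sup>2 \<le> (1 - 1 / r) ^ n * (\<Sum>X\<in>S. W X * (g X - \<mu>)\<^sup>2)"
proof -
  have Z: "0 < sum W S" using S0 finite_S W_pos by (intro sum_pos) auto
  have gap: "(\<Sum>X\<in>S. W X * (kern f X)\<^sup>2) \<le> (1 - 1 / r) * (\<Sum>X\<in>S. W X * (f X)\<^sup>2)"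
    if f0: "(\<Sum>X\<in>S. W X * f X) = 0" for f
  proof -
    have "(\<Sum>X\<in>S. \<Sum>Y\<in>S. W X * W Y * (f X - f Y)\<^sup>2) =
        (\<Sum>X\<in>S. \<Sum>Y\<in>S. W X * (f X)\<^sup>2 * W Y) + (\<Sum>X\<in>S. \<Sum>Y\<in>S. W X * (W Y * (f Y)\<^sup>2))
        - 2 * (\<Sum>X\<in>S. \<Sum>Y\<in>S. (W X * f X) * (W Y * f Y))"
      unfolding sum_distrib_left sum.distrib[symmetric] sum_subtractf[symmetric]
      by (intro sum.cong refl) (simp add: power2_eq_square algebra_simps)
    also have "\<dots> = 2 * (sum W S * (\<Sum>X\<in>S. W X * (f X)\<^sup>2))"
      unfolding sum_product[symmetric] f0 by simp
    finally have "2 * (sum W S * (\<Sum>X\<in>S. W X * (f X)\<^sup>2)) \<le> r * sum W S * energy f"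
      using poincare[of f] by simp
    then have "sum W S * (2 * (\<Sum>X\<in>S. W X * (f X)\<^sup>2)) \<le> sum W S * (r * energy f)"
      by (simp add: mult_ac)
    then have "2 * (\<Sum>X\<in>S. W X * (f X)\<^sup>2) \<le> r * energy f" using Z by simp
    then have "(\<Sum>X\<in>S. W X * (f X)\<^sup>2) / r \<le> energy f / 2" using r by (simp add: field_simps)
    then show ?thesis using kern_contract[of f] by (simp add: algebra_simps)
  qed
  define f where "f = (\<lambda>X. g X - \<mu>)"
  have f0: "(\<Sum>X\<in>S. W X * (kern ^^ n) f X) = 0" for n
  proof (induction n)
    case 0
    have "(\<Sum>X\<in>S. W X * f X) = (\<Sum>X\<in>S. W X * g X) - sum W S * \<mu>"
      by (simp add: f_def right_diff_distrib sum_subtractf sum_distrib_right)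
    then show ?case using Z by (simp add: \<mu>_def)
  qed (simp add: kern_sum)
  have "(\<Sum>X\<in>S. W X * ((kern ^^ n) f X)\<^sup>2) \<le> (1 - 1 / r) ^ n * (\<Sum>X\<in>S. W X * (f X)\<^sup>2)"
  proof (induction n)
    case (Suc n)
    have "(\<Sum>X\<in>S. W X * ((kern ^^ Suc n) f X)\<^sup>2) \<le> (1 - 1 / r) * (\<Sum>X\<in>S. W X * ((kern ^^ n) f X)\<^sup>2)"
      using gap[OF f0[of n]] by simp
    also have "\<dots> \<le> (1 - 1 / r) * ((1 - 1 / r) ^ n * (\<Sum>X\<in>S. W X * (f X)\<^sup>2))"
      using Suc r by (intro mult_left_mono) auto
    finally show ?case by simp
  qed simp
  moreover have "W X * ((kern ^^ n) f X)\<^sup>2 \<le> (\<Sum>X\<in>S. W X * ((kern ^^ n) f X)\<^sup>2)"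
    using W_pos by (intro member_le_sum[OF X] finite_S) (simp add: less_imp_le)
  ultimately show ?thesis
    unfolding f_def kern_pow_add_const by linarith
qed

end

section \<open>The partition function as a sum over even sets\<close>

lemma sum_Pow_insert:
  fixes f :: "'a set \<Rightarrow> 'b::comm_monoid_add"
  assumes "finite A" "x \<notin> A"
  shows "(\<Sum>X\<in>Pow (insert x A). f X) = (\<Sum>X\<in>Pow A. f X + f (insert x X))"
proof -
  have "inj_on (insert x) (Pow A)" using assms by (auto simp: inj_on_def)
  moreover have "Pow A \<inter> insert x ` Pow A = {}" using assms by auto
  ultimately show ?thesis using assms
    by (simp add: Pow_insert sum.union_disjoint sum.reindex sum.distrib)
qed

text \<open>Each edge factor is a sum over the four subsets of its two halves; multiplying out gives
  one term for every set of half-edges.\<close>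

lemma prod_edges_expand:
  fixes w a :: "nat \<Rightarrow> 'b::comm_ring_1"
  shows "(\<Prod>j<n. w 0 + w 1 * (a (2 * j) + a (2 * j + 1)) + w 2 * (a (2 * j) * a (2 * j + 1))) =
    (\<Sum>X\<in>Pow {..<2 * n}. (\<Prod>j<n. w (pat X j)) * (\<Prod>h\<in>X. a h))"
proof (induction n)
  case (Suc n)
  let ?A = "{..<2 * n}"
  let ?F = "\<lambda>k X. (\<Prod>j<k. w (pat X j)) * (\<Prod>h\<in>X. a h)"
  let ?e = "w 0 + w 1 * (a (2 * n) + a (2 * n + 1)) + w 2 * (a (2 * n) * a (2 * n + 1))"
  have eq: "{..<2 * Suc n} = insert (2 * n + 1) (insert (2 * n) ?A)" by auto
  have "(\<Sum>X\<in>Pow {..<2 * Suc n}. ?F (Suc n) X) =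
    (\<Sum>X\<in>Pow ?A. (?F (Suc n) X + ?F (Suc n) (insert (2 * n + 1) X)) +
       (?F (Suc n) (insert (2 * n) X) + ?F (Suc n) (insert (2 * n + 1) (insert (2 * n) X))))"
    unfolding eq by (subst sum_Pow_insert, simp, simp, subst sum_Pow_insert, simp, simp, rule refl)
  also have "\<dots> = (\<Sum>X\<in>Pow ?A. ?F n X * ?e)"
  proof (rule sum.cong[OF refl])
    fix X assume "X \<in> Pow ?A"
    then have X: "X \<subseteq> ?A" "finite X" "2 * n \<notin> X" "Suc (2 * n) \<notin> X" by (auto intro: finite_subset)
    have p: "pat (insert (2 * n + 1) X) j = pat X j" "pat (insert (2 * n) X) j = pat X j"
      "pat (insert (2 * n + 1) (insert (2 * n) X)) j = pat X j" if "j < n" for j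
    proof -
      have "Suc (2 * j) \<noteq> 2 * n" "2 * j \<noteq> Suc (2 * n)" by presburger+
      then show "pat (insert (2 * n + 1) X) j = pat X j" "pat (insert (2 * n) X) j = pat X j"
        "pat (insert (2 * n + 1) (insert (2 * n) X)) j = pat X j" using that by (auto simp: pat_def)
    qed
    have "pat X n = 0" "pat (insert (2 * n + 1) X) n = 1" "pat (insert (2 * n) X) n = 1"
      "pat (insert (2 * n + 1) (insert (2 * n) X)) n = 2" using X by (auto simp: pat_def)
    moreover define Q where "Q = (\<Prod>j<n. w (pat X j))"
    moreover have "(\<Prod>j<n. w (pat (insert (2 * n + 1) X) j)) = Q" "(\<Prod>j<n. w (pat (insert (2 * n) X) j)) = Q"
      "(\<Prod>j<n. w (pat (insert (2 * n + 1) (insert (2 * n) X)) j)) = Q"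
      unfolding Q_def by (intro prod.cong refl; use p in auto)+
    moreover define P where "P = (\<Prod>h\<in>X. a h)"
    moreover have "(\<Prod>h\<in>insert (2 * n + 1) X. a h) = a (2 * n + 1) * P" "(\<Prod>h\<in>insert (2 * n) X. a h) = a (2 * n) * P"
      "(\<Prod>h\<in>insert (2 * n + 1) (insert (2 * n) X). a h) = a (2 * n + 1) * (a (2 * n) * P)"
      using X by (simp_all add: P_def)
    ultimately show "(?F (Suc n) X + ?F (Suc n) (insert (2 * n + 1) X)) +
       (?F (Suc n) (insert (2 * n) X) + ?F (Suc n) (insert (2 * n + 1) (insert (2 * n) X))) = ?F n X * ?e"
      unfolding prod.lessThan_Suc by (simp only:) (simp add: algebra_simps)
  qed
  also have "\<dots> = (\<Prod>j<Suc n. w 0 + w 1 * (a (2 * j) + a (2 * j + 1)) + w 2 * (a (2 * j) * a (2 * j + 1)))"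
    unfolding sum_distrib_right[symmetric] Suc.IH[symmetric] prod.lessThan_Suc by (rule refl)
  finally show ?case by simp
qed (simp add: pat_def)

lemma sum_pat: "X \<subseteq> {..<2 * n} \<Longrightarrow> (\<Sum>j<n. pat X j) = card X"
proof (induction n arbitrary: X)
  case (Suc n)
  let ?Y = "X \<inter> {..<2 * n}"
  have fin: "finite X" using Suc.prems by (rule finite_subset) simp
  have "(\<Sum>j<n. pat X j) = (\<Sum>j<n. pat ?Y j)" by (intro sum.cong) (auto simp: pat_def)
  also have "\<dots> = card ?Y" by (rule Suc.IH) simp
  finally have 1: "(\<Sum>j<n. pat X j) = card ?Y" .
  have "X = ?Y \<union> (X \<inter> {2 * n, 2 * n + 1})" using Suc.prems by (auto simp: subset_iff)
  moreover have "card (?Y \<union> (X \<inter> {2 * n, 2 * n + 1})) = card ?Y + card (X \<inter> {2 * n, 2 * n + 1})"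
    using fin by (intro card_Un_disjoint) auto
  ultimately have "card X = card ?Y + card (X \<inter> {2 * n, 2 * n + 1})" by metis
  also have "card (X \<inter> {2 * n, 2 * n + 1}) = pat X n" by (auto simp: pat_def)
  finally show ?case using 1 by simp
qed simp

section \<open>Expansion over even sets and their exact number\<close>

context half_edge_graph
begin

lemma even_at_card:
  assumes "finite X" "even_at X"
  shows "even (card X)"
proof -
  have "(\<Sum>v\<in>vt ` X. \<Sum>h\<in>{h \<in> X. vt h = v}. 1) = (\<Sum>h\<in>X. (1::nat))"
    using assms(1) by (intro sum.group) auto
  then have "card X = (\<Sum>v\<in>vt ` X. card {h \<in> X. vt h = v})" by simp
  then show ?thesis using assms by (auto simp: even_at_def intro!: dvd_sum)
qed

text \<open>The spin sum factorises over the vertices, and a vertex that meets \<open>X\<close> in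
  \<open>d\<close> half-edges contributes \<open>1 + (- 1) ^ d\<close>.\<close>

lemma character_sum:
  assumes V: "finite V" "vt ` X \<subseteq> V" and X: "finite X"
  shows "(\<Sum>\<sigma>\<in>V \<rightarrow>\<^sub>E {0, 1::nat}. \<Prod>h\<in>X. (- 1) ^ \<sigma> (vt h)) =
    (if even_at X then 2 ^ card V else (0::'b::comm_ring_1))"
proof -
  let ?d = "\<lambda>v. card {h \<in> X. vt h = v}"
  have "(\<Prod>h\<in>X. (- 1) ^ \<sigma> (vt h)) = (\<Prod>v\<in>V. (- 1 :: 'b) ^ (\<sigma> v * ?d v))" for \<sigma> :: "'v \<Rightarrow> nat"
  proof -
    have "(\<Prod>h\<in>X. (- 1 :: 'b) ^ \<sigma> (vt h)) = (\<Prod>v\<in>V. \<Prod>h\<in>{h \<in> X. vt h = v}. (- 1) ^ \<sigma> (vt h))"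
      using V X by (intro prod.group[symmetric]) auto
    also have "\<dots> = (\<Prod>v\<in>V. (- 1) ^ (\<sigma> v * ?d v))"
      by (intro prod.cong refl) (simp add: power_mult)
    finally show ?thesis .
  qed
  then have "(\<Sum>\<sigma>\<in>V \<rightarrow>\<^sub>E {0, 1::nat}. \<Prod>h\<in>X. (- 1) ^ \<sigma> (vt h)) =
      (\<Prod>v\<in>V. \<Sum>s\<in>{0, 1::nat}. (- 1 :: 'b) ^ (s * ?d v))"
    using prod_sum_PiE[of V "\<lambda>_. {0, 1::nat}" "\<lambda>v s. (- 1 :: 'b) ^ (s * ?d v)"] V(1) by simp
  also have "\<dots> = (\<Prod>v\<in>V. if even (?d v) then 2 else 0)"
    by (intro prod.cong refl) simp
  also have "\<dots> = (if even_at X then 2 ^ card V else 0)"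
  proof (cases "even_at X")
    case True
    then show ?thesis by (simp add: even_at_def)
  next
    case False
    then obtain v where v: "odd (?d v)" by (auto simp: even_at_def)
    then have "{h \<in> X. vt h = v} \<noteq> {}" by (metis card.empty dvd_0_right)
    then have "v \<in> V" using V by auto
    then show ?thesis using v V False by (auto intro!: prod_zero bexI[of _ v])
  qed
  finally show ?thesis .
qed

text \<open>After the sums over spins and over sets of half-edges are exchanged, orthogonality of
  characters removes each set that is odd at some vertex.\<close>

theorem spin_sum_even_sets:
  fixes w :: "nat \<Rightarrow> 'b::comm_ring_1"
  assumes V: "finite V" "vt ` {..<2 * m} \<subseteq> V"
    and A: "\<And>s t. s \<in> {0, 1} \<Longrightarrow> t \<in> {0, 1} \<Longrightarrow>
      A s t = w 0 + w 1 * ((- 1) ^ s + (- 1) ^ t) + w 2 * ((- 1) ^ s * (- 1) ^ t)"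
  shows "(\<Sum>\<sigma>\<in>V \<rightarrow>\<^sub>E {0, 1::nat}. \<Prod>j<m. A (\<sigma> (vt (2 * j))) (\<sigma> (vt (2 * j + 1)))) =
    2 ^ card V * (\<Sum>X\<in>even_sets. \<Prod>j<m. w (pat X j))"
proof -
  have "(\<Sum>\<sigma>\<in>V \<rightarrow>\<^sub>E {0, 1::nat}. \<Prod>j<m. A (\<sigma> (vt (2 * j))) (\<sigma> (vt (2 * j + 1)))) =
     (\<Sum>\<sigma>\<in>V \<rightarrow>\<^sub>E {0, 1::nat}. \<Sum>X\<in>Pow {..<2 * m}. (\<Prod>j<m. w (pat X j)) * (\<Prod>h\<in>X. (- 1) ^ \<sigma> (vt h)))"
  proof (rule sum.cong[OF refl])
    fix \<sigma> assume \<sigma>: "\<sigma> \<in> V \<rightarrow>\<^sub>E {0, 1::nat}"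
    have "(\<Prod>j<m. A (\<sigma> (vt (2 * j))) (\<sigma> (vt (2 * j + 1)))) =
      (\<Prod>j<m. w 0 + w 1 * ((- 1) ^ \<sigma> (vt (2 * j)) + (- 1) ^ \<sigma> (vt (2 * j + 1))) +
        w 2 * ((- 1) ^ \<sigma> (vt (2 * j)) * (- 1) ^ \<sigma> (vt (2 * j + 1))))"
      using \<sigma> V by (intro prod.cong refl A) (auto simp: PiE_iff subset_iff)
    then show "(\<Prod>j<m. A (\<sigma> (vt (2 * j))) (\<sigma> (vt (2 * j + 1)))) =
      (\<Sum>X\<in>Pow {..<2 * m}. (\<Prod>j<m. w (pat X j)) * (\<Prod>h\<in>X. (- 1) ^ \<sigma> (vt h)))"
      using prod_edges_expand[of w "\<lambda>h. (- 1) ^ \<sigma> (vt h)" m] by simp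
  qed
  also have "\<dots> = (\<Sum>X\<in>Pow {..<2 * m}. (\<Prod>j<m. w (pat X j)) * (if even_at X then 2 ^ card V else 0))"
  proof (subst sum.swap, rule sum.cong[OF refl])
    fix X assume "X \<in> Pow {..<2 * m}"
    then have X: "vt ` X \<subseteq> V" "finite X" using V by (auto intro: finite_subset)
    show "(\<Sum>\<sigma>\<in>V \<rightarrow>\<^sub>E {0, 1::nat}. (\<Prod>j<m. w (pat X j)) * (\<Prod>h\<in>X. (- 1) ^ \<sigma> (vt h))) =
      (\<Prod>j<m. w (pat X j)) * (if even_at X then 2 ^ card V else 0)"
      unfolding sum_distrib_left[symmetric] character_sum[OF V(1) X] ..
  qed
  also have "\<dots> = (\<Sum>X\<in>even_sets. (\<Prod>j<m. w (pat X j)) * 2 ^ card V)"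
    by (rule sum.mono_neutral_cong_right) (auto simp: even_sets_def)
  finally show ?thesis by (simp add: sum_distrib_left mult.commute)
qed

text \<open>The factor \<open>s\<close> occurs once per edge and \<open>t\<close> once per chosen
  half-edge. An even set has an even number of the latter, so the powers of \<open>t\<close>
  disappear.\<close>

lemma even_sets_sign:
  fixes w u :: "nat \<Rightarrow> 'b::comm_ring_1"
  assumes X: "X \<in> even_sets" and t: "t * t = 1"
    and w: "\<And>p. p \<le> 2 \<Longrightarrow> w p = s * t ^ p * u p"
  shows "(\<Prod>j<m. w (pat X j)) = s ^ m * (\<Prod>j<m. u (pat X j))"
proof -
  have "(\<Prod>j<m. w (pat X j)) = (\<Prod>j<m. s * t ^ pat X j * u (pat X j))"
    by (intro prod.cong refl w pat_le_2)
  also have "\<dots> = s ^ m * t ^ (\<Sum>j<m. pat X j) * (\<Prod>j<m. u (pat X j))"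
    by (simp add: prod.distrib power_sum)
  also have "(\<Sum>j<m. pat X j) = card X" using X by (intro sum_pat) (auto simp: even_sets_def)
  also have "t ^ card X = 1"
    using even_at_card[of X] X even_setsD(1)[OF X] t
    by (auto simp: even_sets_def elim!: evenE simp: power_mult power2_eq_square)
  finally show ?thesis by simp
qed

lemma card_even_sets: "card even_sets = (\<Prod>h<2 * m. if \<exists>g<h. vt g = vt h then 2 else 1)"
proof -
  define E where "E k = {X. X \<subseteq> {..<k} \<and> even_at X}" for k :: nat
  have fin: "finite (E k)" for k
    by (rule finite_subset[of _ "Pow {..<k}"]) (auto simp: E_def)
  have "card (E k) = (\<Prod>h<k. if \<exists>g<h. vt g = vt h then 2 else 1)" for k
  proof (induction k)
    case 0
    have "E 0 = {{}}" by (auto simp: E_def even_at_def)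
    then show ?case by simp
  next
    case (Suc k)
    let ?F = "{X \<in> E (Suc k). k \<in> X}"
    have split: "E (Suc k) = E k \<union> ?F" "E k \<inter> ?F = {}"
      by (auto simp: E_def lessThan_Suc)
    have c: "card (E (Suc k)) = card (E k) + card ?F"
      using split fin by (metis (no_types, lifting) card_Un_disjoint finite_Un)
    show ?case
    proof (cases "\<exists>g<k. vt g = vt k")
      case True
      then obtain g where g: "g < k" "vt g = vt k" by blast
      have e: "even_at (X \<triangle> {g, k})" if "even_at X" "finite X" for X
        using that g even_at_symd[of X "{g, k}"] even_at_pair[of g k] by auto
      have "bij_betw (\<lambda>X. X \<triangle> {g, k}) (E k) ?F"
      proof (rule bij_betw_byWitness[of _ "\<lambda>X. X \<triangle> {g, k}"])
        show "(\<lambda>X. X \<triangle> {g, k}) ` E k \<subseteq> ?F"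
        proof
          fix Y assume "Y \<in> (\<lambda>X. X \<triangle> {g, k}) ` E k"
          then obtain X where X: "X \<subseteq> {..<k}" "even_at X" "Y = X \<triangle> {g, k}" by (auto simp: E_def)
          have "finite X" using X(1) by (rule finite_subset) simp
          moreover have "Y \<subseteq> {..<Suc k}" "k \<in> Y" using X g by (auto simp: subset_iff less_Suc_eq)
          ultimately show "Y \<in> ?F" using e X by (auto simp: E_def)
        qed
        show "(\<lambda>X. X \<triangle> {g, k}) ` ?F \<subseteq> E k"
        proof
          fix Y assume "Y \<in> (\<lambda>X. X \<triangle> {g, k}) ` ?F"
          then obtain X where X: "X \<subseteq> {..<Suc k}" "even_at X" "k \<in> X" "Y = X \<triangle> {g, k}" by (auto simp: E_def)
          have "finite X" using X(1) by (rule finite_subset) simp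
          moreover have "Y \<subseteq> {..<k}" using X g by (auto simp: subset_iff less_Suc_eq)
          ultimately show "Y \<in> E k" using e X by (auto simp: E_def)
        qed
      qed auto
      then have "card ?F = card (E k)" by (simp add: bij_betw_same_card)
      then show ?thesis using c Suc True by simp
    next
      case False
      have "?F = {}"
      proof (rule ccontr)
        assume "?F \<noteq> {}"
        then obtain X where X: "X \<subseteq> {..<Suc k}" "even_at X" "k \<in> X" by (auto simp: E_def)
        have "finite X" using X(1) by (rule finite_subset) simp
        then obtain g where "g \<in> X" "g \<noteq> k" "vt g = vt k" using even_at_partner X by metis
        then show False using X False by (auto simp: subset_iff less_Suc_eq)
      qed
      then have "card ?F = 0" by (simp only: card.empty)
      then show ?thesis unfolding prod.lessThan_Suc using c Suc.IH False
        by (simp only: if_False add_0_right mult_1_right)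
    qed
  qed
  from this[of "2 * m"] show ?thesis by (simp add: E_def even_sets_def)
qed

end

section \<open>Repairing a forbidden edge pattern\<close>

lemma pat_symd_pair: "h div 2 \<noteq> j \<Longrightarrow> k div 2 \<noteq> j \<Longrightarrow> pat (X \<triangle> {h, k}) j = pat X j"
  by (rule pat_eqI) auto

lemma pat_symd_one:
  assumes "h div 2 \<noteq> k div 2"
  shows "pat (X \<triangle> {h, k}) (k div 2) = pat (X \<triangle> {k}) (k div 2)"
  using assms unfolding pat_mate by (auto simp: same_edge)

lemma pat_symd_self:
  assumes "pat X (h div 2) \<noteq> 1"
  shows "pat (X \<triangle> {h}) (h div 2) = 1" "pat (X \<triangle> {mate h}) (h div 2) = 1"
    "pat (X \<triangle> {h, mate h}) (h div 2) = 2 - pat X (h div 2)"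
  using assms unfolding pat_mate by (auto split: if_splits)

lemma pat_symd_self':
  assumes "pat (X \<triangle> {k}) (k div 2) \<noteq> 1"
  shows "pat X (k div 2) = 1"
  using assms unfolding pat_mate by (auto split: if_splits)

context half_edge_graph
begin

text \<open>A trail pairs \<open>h\<close> with another half-edge \<open>k\<close> at the same
  vertex, crosses the edge of \<open>k\<close> to its other half and continues there. The freshness
  conditions make the list repetition free, so flipping its elements one pair after another is a
  symmetric difference with its set.\<close>

inductive trail :: "nat \<Rightarrow> nat list \<Rightarrow> nat \<Rightarrow> bool" where
  trail_end: "(h, g) \<in> pairs \<Longrightarrow> trail h [h, g] g"
| trail_step: "(h, k) \<in> pairs \<Longrightarrow> trail (mate k) ks g \<Longrightarrow> h \<notin> set ks \<Longrightarrow> k \<notin> set ks \<Longrightarrow>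
    trail h (h # k # ks) g"

lemma trail_facts:
  "trail h ks g \<Longrightarrow> h \<in> set ks \<and> g \<in> set ks \<and> h \<noteq> g \<and> distinct ks \<and> set ks \<subseteq> {..<2 * m}"
  by (induction rule: trail.induct) (auto simp: pairs_def)

text \<open>One fixed trail per pair of endpoints. Trails may be exponentially many, but the
  prefixes of these are only cubically many, and they are the only repairs ever applied.\<close>

definition the_trail :: "nat \<Rightarrow> nat \<Rightarrow> nat list" where
  "the_trail h g = (SOME ks. trail h ks g)"

definition repairs :: "nat set set" where
  "repairs = (\<lambda>(h, g, i). set (take i (the_trail h g))) ` ({..<2 * m} \<times> {..<2 * m} \<times> {..2 * m})"

lemma finite_repairs [simp]: "finite repairs"
  by (simp add: repairs_def)

lemma card_repairs: "card repairs \<le> (2 * m + 1) ^ 3"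
proof -
  have "card repairs \<le> card ({..<2 * m} \<times> {..<2 * m} \<times> {..2 * m})"
    unfolding repairs_def by (rule card_image_le) auto
  also have "\<dots> = 2 * m * (2 * m) * (2 * m + 1)" by (simp add: card_cartesian_product algebra_simps)
  also have "\<dots> \<le> (2 * m + 1) * (2 * m + 1) * (2 * m + 1)"
    by (intro mult_mono) auto
  finally show ?thesis by (simp add: power3_eq_cube)
qed

end

text \<open>\<open>b\<close> stands for a pattern whose true weight vanishes: it has the substitute
  weight 1, all others at least \<open>R\<close>. Since \<open>b\<close> is 0 or 2, toggling one
  half of a forbidden edge always yields the allowed pattern 1.\<close>

locale forbidden_pattern = half_edge_graph m vt for m :: nat and vt :: "nat \<Rightarrow> 'v" +
  fixes w :: "nat \<Rightarrow> real" and b :: nat and R C :: real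
  assumes b: "b = 0 \<or> b = 2" and w_b: "w b = 1" and R1: "1 \<le> R" and C1: "1 \<le> C"
    and w_lower: "\<And>p. p \<le> 2 \<Longrightarrow> p \<noteq> b \<Longrightarrow> R \<le> w p"
    and w_upper: "\<And>p. p \<le> 2 \<Longrightarrow> w p \<le> C * R"
begin

abbreviation wgt :: "nat set \<Rightarrow> real" where
  "wgt X \<equiv> \<Prod>j<m. w (pat X j)"

lemma w_pos: "p \<le> 2 \<Longrightarrow> 0 < w p"
  using w_b w_lower[of p] R1 by (cases "p = b") auto

lemma wgt_pos: "0 < wgt X"
  by (intro prod_pos ballI w_pos pat_le_2)

text \<open>Flip \<open>h\<close> with a partner \<open>k\<close> from the difference to
  \<open>Y\<close>. If this makes the edge of \<open>k\<close> forbidden, its other half still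
  differs from \<open>Y\<close>, which has no forbidden edge, and the argument continues there with
  a smaller difference. The condition on \<open>g\<close> speaks of \<open>X\<close> before any
  flip, so that it does not depend on the trail.\<close>

lemma trail_exists:
  assumes "X \<in> even_sets" "Y \<in> even_sets" "\<And>j. j < m \<Longrightarrow> pat Y j \<noteq> b"
    and "pat X (h div 2) = b" "h \<in> X \<triangle> Y"
  shows "\<exists>ks g. trail h ks g \<and> set ks \<subseteq> X \<triangle> Y \<and> pat (X \<triangle> {g}) (g div 2) \<noteq> b"
  using assms
proof (induction "card (X \<triangle> Y)" arbitrary: X h rule: less_induct)
  case less
  let ?D = "X \<triangle> Y"
  have D: "?D \<in> even_sets" by (rule even_sets_symd) (use less in auto)
  have fD: "finite ?D" using D by (rule even_setsD)
  obtain k where k: "k \<in> ?D" "k \<noteq> h" "vt k = vt h"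
    using even_at_partner[OF fD _ less.prems(5)] D by (auto simp: even_sets_def)
  have hk: "(h, k) \<in> pairs" using k less.prems(5) even_setsD(2)[OF D] unfolding pairs_def by auto
  show ?case
  proof (cases "pat (X \<triangle> {k}) (k div 2) = b")
    case False
    then show ?thesis using trail_end[OF hk] k less.prems(5) by (intro exI[of _ "[h, k]"] exI[of _ k]) auto
  next
    case True
    have b1: "b \<noteq> 1" using b by auto
    have kh: "k div 2 \<noteq> h div 2"
    proof
      assume "k div 2 = h div 2"
      then have "k = mate h" using same_edge[of h k] k by auto
      then show False using True pat_symd_self(2)[of X h] less.prems(4) b1 by simp
    qed
    let ?X = "X \<triangle> {h, k}"
    have X1: "?X \<in> even_sets" using even_sets_flip[OF hk less.prems(1)] .
    have p1: "pat ?X (k div 2) = b" using True pat_symd_one[of h k X] kh by simp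
    have D1: "?X \<triangle> Y = ?D - {h, k}" using k less.prems(5) by auto
    have card: "card (?X \<triangle> Y) < card ?D" unfolding D1
      by (intro psubset_card_mono fD) (use k(1) in blast)
    \<comment> \<open>Otherwise both halves of that edge agree with \<open>Y\<close>, which would
      then have the forbidden pattern there.\<close>
    have mk: "mate k \<in> ?X \<triangle> Y"
    proof (rule ccontr)
      assume n: "mate k \<notin> ?X \<triangle> Y"
      have "k \<notin> ?X \<triangle> Y" using D1 by simp
      then have "pat Y (k div 2) = pat ?X (k div 2)" unfolding pat_mate using n by auto
      moreover have "k div 2 < m" using hk by (auto simp: pairs_def)
      ultimately show False using p1 less.prems(3)[of "k div 2"] by simp
    qed
    have pm: "pat ?X (mate k div 2) = b" using p1 by simp
    from less.hyps[OF card X1 less.prems(2) less.prems(3) pm mk]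
    obtain ks g where g: "trail (mate k) ks g" "set ks \<subseteq> ?X \<triangle> Y" "pat (?X \<triangle> {g}) (g div 2) \<noteq> b"
      by blast
    have "h \<notin> set ks" "k \<notin> set ks" using g(2) D1 by auto
    then have t: "trail h (h # k # ks) g" by (intro trail_step hk g)
    have gk: "g \<noteq> k" "g \<noteq> h" "g \<noteq> mate k" using trail_facts[OF g(1)] g(2) D1 by auto
    \<comment> \<open>The induction hypothesis speaks of \<open>?X\<close>. The edge of
      \<open>g\<close> is not that of \<open>k\<close>; if it is that of \<open>h\<close>, then
      \<open>g = mate h\<close>, and toggling one half of a forbidden edge gives 1.\<close>
    have "pat (X \<triangle> {g}) (g div 2) \<noteq> b"
    proof (cases "g div 2 = h div 2")
      case True
      then have "g = mate h" using same_edge[of h g] gk by auto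
      then show ?thesis using pat_symd_self(2)[of X h] less.prems(4) b1 by simp
    next
      case False
      have "g div 2 \<noteq> k div 2" using same_edge[of k g] gk by auto
      then have "pat (?X \<triangle> {g}) (g div 2) = pat (X \<triangle> {g}) (g div 2)"
        using False by (intro pat_eqI) auto
      then show ?thesis using g by simp
    qed
    then show ?thesis using t g(2) D1 k less.prems(5)
      by (intro exI[of _ "h # k # ks"] exI[of _ g]) auto
  qed
qed

lemma wgt_remove1:
  assumes "e < m"
  shows "wgt X = w (pat X e) * (\<Prod>j\<in>{..<m} - {e}. w (pat X j))"
  by (rule prod.remove) (use assms in auto)

lemma wgt_remove2:
  assumes "e < m" "f < m" "e \<noteq> f"
  shows "wgt X = w (pat X e) * (w (pat X f) * (\<Prod>j\<in>{..<m} - {e, f}. w (pat X j)))"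
proof -
  have "(\<Prod>j\<in>{..<m} - {e}. w (pat X j)) = w (pat X f) * (\<Prod>j\<in>{..<m} - {e} - {f}. w (pat X j))"
    by (rule prod.remove) (use assms in auto)
  moreover have "{..<m} - {e} - {f} = {..<m} - {e, f}" by auto
  ultimately show ?thesis unfolding wgt_remove1[OF assms(1)] by simp
qed

text \<open>Any trail with suitable ends works, whether or not it points towards some
  \<open>Y\<close>. A flip turns the current forbidden edge into pattern 1. If the next edge thereby
  goes from 1 to \<open>b\<close>, the weight is unchanged and the defect has moved on; at the first
  flip where this fails, the weight grows by a factor of at least \<open>R / C\<close>. Stopping
  there is the reason for taking a prefix.\<close>

lemma trail_flip:
  assumes "trail h ks g" "X \<in> even_sets" "pat X (h div 2) = b" "pat (X \<triangle> {g}) (g div 2) \<noteq> b"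
  shows "\<exists>i \<le> length ks. X \<triangle> set (take i ks) \<in> even_sets \<and> R * wgt X \<le> C * wgt (X \<triangle> set (take i ks))"
  using assms
proof (induction arbitrary: X rule: trail.induct)
  have b1: "b \<noteq> 1" using b by auto
  have b2: "2 - b \<noteq> b" "b \<le> 2" using b by auto
  \<comment> \<open>Either both halves of the forbidden edge are flipped and \<open>b\<close>
    becomes \<open>2 - b\<close>, or it becomes 1 and the edge of \<open>k\<close> gets an allowed
    pattern. In the second case weights of at most \<open>1 * (C * R)\<close> are traded for at
    least \<open>R * R\<close>.\<close>
  have stop: "R * wgt X \<le> C * wgt (X \<triangle> {h, k})"
    if hk: "(h, k) \<in> pairs" and pX: "pat X (h div 2) = b"
      and halt: "k = mate h \<or> pat (X \<triangle> {k}) (k div 2) \<noteq> b" for X h k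
  proof (cases "k = mate h")
    case True
    have e: "h div 2 < m" using hk by (auto simp: pairs_def)
    let ?r = "\<lambda>X. \<Prod>j\<in>{..<m} - {h div 2}. w (pat X j)"
    have r: "?r (X \<triangle> {h, k}) = ?r X"
      by (intro prod.cong refl arg_cong[where f = w] pat_symd_pair) (use True in auto)
    have r0: "0 \<le> ?r X" by (intro prod_nonneg ballI less_imp_le w_pos pat_le_2)
    have "R * wgt X = R * ?r X" unfolding wgt_remove1[OF e] pX w_b by simp
    also have "\<dots> \<le> w (2 - b) * ?r X" using b2 r0 by (intro mult_right_mono w_lower) auto
    also have "\<dots> = wgt (X \<triangle> {h, k})"
      unfolding wgt_remove1[OF e] r using pat_symd_self(3)[of X h] pX b1 True by simp
    also have "\<dots> \<le> C * wgt (X \<triangle> {h, k})" using C1 wgt_pos[of "X \<triangle> {h, k}"] by simp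
    finally show ?thesis .
  next
    case False
    then have ef: "h div 2 \<noteq> k div 2" using hk same_edge[of h k] by (auto simp: pairs_def)
    have e: "h div 2 < m" "k div 2 < m" using hk by (auto simp: pairs_def)
    let ?r = "\<lambda>X. \<Prod>j\<in>{..<m} - {h div 2, k div 2}. w (pat X j)"
    have r: "?r (X \<triangle> {h, k}) = ?r X"
      by (intro prod.cong refl arg_cong[where f = w] pat_symd_pair) auto
    have r0: "0 \<le> ?r X" by (intro prod_nonneg ballI less_imp_le w_pos pat_le_2)
    have ph: "pat (X \<triangle> {h, k}) (h div 2) = 1"
      using pat_symd_one[of k h X] ef pat_symd_self(1)[of X h] pX b1 by (simp add: insert_commute)
    have pk: "pat (X \<triangle> {h, k}) (k div 2) \<noteq> b" using pat_symd_one[OF ef] halt False by auto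
    have w1: "R \<le> w 1" using b1 by (intro w_lower) auto
    have wk: "R \<le> w (pat (X \<triangle> {h, k}) (k div 2))" by (intro w_lower pat_le_2 pk)
    have "R * w (pat X (k div 2)) \<le> R * (C * R)" using R1 by (intro mult_left_mono w_upper pat_le_2) auto
    also have "\<dots> = C * (R * R)" by simp
    also have "\<dots> \<le> C * (w 1 * w (pat (X \<triangle> {h, k}) (k div 2)))"
      using w1 wk R1 C1 by (intro mult_left_mono mult_mono) auto
    finally have "R * w (pat X (k div 2)) * ?r X \<le> C * (w 1 * w (pat (X \<triangle> {h, k}) (k div 2))) * ?r X"
      using r0 by (rule mult_right_mono)
    then show ?thesis unfolding wgt_remove2[OF e ef] pX w_b ph r by (simp add: mult.assoc)
  qed
  {
    case (trail_end h g)
    have "R * wgt X \<le> C * wgt (X \<triangle> {h, g})" using trail_end by (intro stop) auto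
    then show ?case using even_sets_flip[OF trail_end(1,2)] by (intro exI[of _ 2]) (simp add: numeral_2_eq_2)
  next
    case (trail_step h k ks g)
    let ?X = "X \<triangle> {h, k}"
    have X1: "?X \<in> even_sets" using trail_step by (intro even_sets_flip) auto
    show ?case
    proof (cases "k = mate h \<or> pat (X \<triangle> {k}) (k div 2) \<noteq> b")
      case True
      then have "R * wgt X \<le> C * wgt ?X" using trail_step by (intro stop) auto
      then show ?thesis using X1 by (intro exI[of _ 2]) (simp add: numeral_2_eq_2)
    next
      case False
      then have ef: "h div 2 \<noteq> k div 2" using trail_step same_edge[of h k] by (auto simp: pairs_def)
      have e: "h div 2 < m" "k div 2 < m" using trail_step by (auto simp: pairs_def)
      have pk: "pat ?X (k div 2) = b" using pat_symd_one[OF ef] False by auto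
      have pXk: "pat X (k div 2) = 1" using pat_symd_self'[of X k] False b1 by auto
      have ph: "pat ?X (h div 2) = 1"
        using pat_symd_one[of k h X] ef pat_symd_self(1)[of X h] trail_step b1 by (simp add: insert_commute)
      have "(\<Prod>j\<in>{..<m} - {h div 2, k div 2}. w (pat ?X j)) = (\<Prod>j\<in>{..<m} - {h div 2, k div 2}. w (pat X j))"
        by (intro prod.cong refl arg_cong[where f = w] pat_symd_pair) auto
      then have same: "wgt ?X = wgt X"
        unfolding wgt_remove2[OF e ef] pk pXk ph using trail_step by (simp add: mult_ac)
      note tf = trail_facts[OF trail_step(2)]
      have gk: "g \<noteq> k" "g \<noteq> h" "g \<noteq> mate k" using tf trail_step by auto
      \<comment> \<open>The end condition must survive the flip. It could change only on the edge of
        \<open>h\<close>, where \<open>g = mate h\<close> means that both halves are toggled and the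
        pattern becomes \<open>2 - b\<close>.\<close>
      have "pat (?X \<triangle> {g}) (g div 2) \<noteq> b"
      proof (cases "g div 2 = h div 2")
        case True
        then have "g = mate h" using same_edge[of h g] gk by auto
        moreover have "pat (?X \<triangle> {mate h}) (h div 2) = pat (X \<triangle> {h, mate h}) (h div 2)"
          using ef unfolding pat_mate by (auto simp: same_edge)
        ultimately show ?thesis using pat_symd_self(3)[of X h] trail_step b1 b2 by simp
      next
        case False
        have "g div 2 \<noteq> k div 2" using same_edge[of k g] gk by auto
        then have "pat (?X \<triangle> {g}) (g div 2) = pat (X \<triangle> {g}) (g div 2)"
          using False by (intro pat_eqI) auto
        then show ?thesis using trail_step by simp
      qed
      with trail_step.IH[OF X1] pk obtain i where i: "i \<le> length ks"
        "?X \<triangle> set (take i ks) \<in> even_sets" "R * wgt ?X \<le> C * wgt (?X \<triangle> set (take i ks))"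
        by auto
      have "X \<triangle> set (take (i + 2) (h # k # ks)) = ?X \<triangle> set (take i ks)"
        using trail_step.hyps set_take_subset[of i ks] by (auto simp: numeral_2_eq_2)
      then show ?thesis using i same by (intro exI[of _ "i + 2"]) simp
    qed
  }
qed

text \<open>Every set with a forbidden edge reaches, by one of the repairs, an even set heavier by
  \<open>R / C\<close>. For a fixed repair the map is injective, so each repair accounts for at most
  \<open>C\<close> times the total weight. The witness \<open>Y\<close> guarantees the existence of
  trails.\<close>

theorem forbidden_mass:
  assumes Y: "Y \<in> even_sets" "\<And>j. j < m \<Longrightarrow> pat Y j \<noteq> b"
  shows "R * (\<Sum>X | X \<in> even_sets \<and> (\<exists>j<m. pat X j = b). wgt X) \<le>
    C * (2 * m + 1) ^ 3 * (\<Sum>X\<in>even_sets. wgt X)"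
proof -
  let ?B = "{X \<in> even_sets. \<exists>j<m. pat X j = b}"
  have one: "R * wgt X \<le> (\<Sum>S\<in>repairs. if X \<triangle> S \<in> even_sets then C * wgt (X \<triangle> S) else 0)"
    if X: "X \<in> ?B" for X
  proof -
    obtain j where j: "j < m" "pat X j = b" using X by auto
    then have "pat X j \<noteq> pat Y j" using Y(2)[of j] by simp
    then have "2 * j \<in> X \<triangle> Y \<or> 2 * j + 1 \<in> X \<triangle> Y" by (auto simp: pat_def split: if_splits)
    then obtain h where h: "h \<in> X \<triangle> Y" "h div 2 = j" by fastforce
    obtain ks g where g: "trail h ks g" "pat (X \<triangle> {g}) (g div 2) \<noteq> b"
      using trail_exists[OF _ Y, of X h] X h j by auto
    \<comment> \<open>The trail found depends on \<open>X\<close> and \<open>Y\<close>; only its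
      endpoints matter for \<open>trail_flip\<close>, so it is exchanged for the fixed one.\<close>
    have t: "trail h (the_trail h g) g" unfolding the_trail_def by (rule someI[of "\<lambda>ks. trail h ks g"]) (rule g(1))
    from trail_flip[OF t _ _ g(2)] X h j obtain i where i: "i \<le> length (the_trail h g)"
      "X \<triangle> set (take i (the_trail h g)) \<in> even_sets"
      "R * wgt X \<le> C * wgt (X \<triangle> set (take i (the_trail h g)))" by auto
    note tf = trail_facts[OF t]
    have "length (the_trail h g) = card (set (the_trail h g))" using tf by (simp add: distinct_card)
    also have "\<dots> \<le> card {..<2 * m}" using tf by (intro card_mono) auto
    finally have "i \<le> 2 * m" using i by simp
    then have mem: "set (take i (the_trail h g)) \<in> repairs"
      unfolding repairs_def using tf by (intro image_eqI[of _ _ "(h, g, i)"]) auto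
    have "(\<lambda>S. if X \<triangle> S \<in> even_sets then C * wgt (X \<triangle> S) else 0) (set (take i (the_trail h g))) \<le>
      (\<Sum>S\<in>repairs. if X \<triangle> S \<in> even_sets then C * wgt (X \<triangle> S) else 0)"
      by (rule member_le_sum[OF mem]) (use C1 wgt_pos in \<open>auto intro!: mult_nonneg_nonneg intro: less_imp_le\<close>)
    then show ?thesis using i by simp
  qed
  have "R * (\<Sum>X\<in>?B. wgt X) \<le> (\<Sum>X\<in>?B. \<Sum>S\<in>repairs. if X \<triangle> S \<in> even_sets then C * wgt (X \<triangle> S) else 0)"
    unfolding sum_distrib_left by (rule sum_mono[OF one])
  also have "\<dots> \<le> (\<Sum>S\<in>repairs. C * (\<Sum>X\<in>even_sets. wgt X))"
  proof (subst sum.swap, rule sum_mono)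
    fix S
    have "(\<Sum>X\<in>?B. if X \<triangle> S \<in> even_sets then C * wgt (X \<triangle> S) else 0) =
        (\<Sum>X\<in>{X \<in> ?B. X \<triangle> S \<in> even_sets}. C * wgt (X \<triangle> S))"
      by (rule sum.inter_filter[symmetric]) auto
    also have "\<dots> = (\<Sum>X\<in>(\<lambda>X. X \<triangle> S) ` {X \<in> ?B. X \<triangle> S \<in> even_sets}. C * wgt X)"
      by (subst sum.reindex) (auto intro!: inj_on_inverseI[of _ "\<lambda>X. X \<triangle> S"])
    also have "\<dots> \<le> (\<Sum>X\<in>even_sets. C * wgt X)"
      using C1 wgt_pos by (intro sum_mono2) (auto intro!: mult_nonneg_nonneg intro: less_imp_le)
    finally show "(\<Sum>X\<in>?B. if X \<triangle> S \<in> even_sets then C * wgt (X \<triangle> S) else 0) \<le> C * (\<Sum>X\<in>even_sets. wgt X)"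
      by (simp add: sum_distrib_left)
  qed
  also have "\<dots> = real (card repairs) * (C * (\<Sum>X\<in>even_sets. wgt X))" by simp
  also have "\<dots> \<le> real ((2 * m + 1) ^ 3) * (C * (\<Sum>X\<in>even_sets. wgt X))"
    using C1 wgt_pos by (intro mult_right_mono of_nat_mono card_repairs mult_nonneg_nonneg sum_nonneg)
      (auto intro: less_imp_le)
  finally show ?thesis by (simp add: mult_ac)
qed

end

section \<open>The sampling algorithm as a probabilistic program\<close>

lemma expectation_bind_finite:
  fixes h :: "'b \<Rightarrow> real"
  assumes "finite (set_pmf p)" "\<And>x. x \<in> set_pmf p \<Longrightarrow> finite (set_pmf (f x))"
  shows "measure_pmf.expectation (bind_pmf p f) h = measure_pmf.expectation p (\<lambda>x. measure_pmf.expectation (f x) h)"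
  using pmf_expectation_bind[of "set_pmf p" f p h] integral_measure_pmf[of "set_pmf p" p "\<lambda>x. measure_pmf.expectation (f x) h"] assms
  by auto

lemma expectation_mono_finite:
  fixes f g :: "'b \<Rightarrow> real"
  assumes "finite (set_pmf p)" "\<And>x. x \<in> set_pmf p \<Longrightarrow> f x \<le> g x"
  shows "measure_pmf.expectation p f \<le> measure_pmf.expectation p g"
  using assms by (intro integral_mono_AE) (auto simp: integrable_measure_pmf_finite AE_measure_pmf_iff)

text \<open>The index is handed to the body so that stages can differ; the rule
  \<open>spec_while\<close> couples program loops with this shape.\<close>

primrec iter_pmf :: "(nat \<Rightarrow> 'b \<Rightarrow> 'b pmf) \<Rightarrow> nat \<Rightarrow> nat \<Rightarrow> 'b \<Rightarrow> 'b pmf" where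
  "iter_pmf f k 0 b = return_pmf b"
| "iter_pmf f k (Suc n) b = bind_pmf (f k b) (iter_pmf f (Suc k) n)"

lemma iter_pmf_invariant:
  assumes "\<And>k b. b \<in> I \<Longrightarrow> set_pmf (f k b) \<subseteq> I" "b \<in> I"
  shows "set_pmf (iter_pmf f k n b) \<subseteq> I"
  using assms(2)
proof (induction n arbitrary: k b)
  case (Suc n)
  have "set_pmf (iter_pmf f (Suc k) n x) \<subseteq> I" if "x \<in> set_pmf (f k b)" for x
    using Suc that assms(1) by blast
  then show ?case by (simp add: UN_subset_iff)
qed simp

lemma iter_pmf_finite:
  assumes "\<And>k b. finite (set_pmf (f k b))"
  shows "finite (set_pmf (iter_pmf f k n b))"
  by (induction n arbitrary: k b) (simp_all add: assms)

section \<open>Uniform draws by coin flips and the chain built from them\<close>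

definition draw :: "nat \<Rightarrow> nat pmf" where
  "draw k = iter_pmf (\<lambda>_ u. map_pmf (\<lambda>c. 2 * u + of_bool c) (pmf_of_set UNIV)) 0 k 0"

lemma draw_finite [simp]: "finite (set_pmf (draw k))"
  unfolding draw_def by (rule iter_pmf_finite) simp

lemma draw_expectation:
  fixes f :: "nat \<Rightarrow> real"
  shows "measure_pmf.expectation (draw k) f = (\<Sum>v<2 ^ k. f v) / 2 ^ k"
proof -
  let ?s = "\<lambda>_ u. map_pmf (\<lambda>c. 2 * u + of_bool c) (pmf_of_set (UNIV :: bool set))"
  have split: "(\<Sum>v<n + l. g v) = (\<Sum>v<n. g v) + (\<Sum>v<l. g (n + v))" for g :: "nat \<Rightarrow> real" and n l
    by (induction l) auto
  have "measure_pmf.expectation (iter_pmf ?s i k u) f = (\<Sum>v<2 ^ k. f (2 ^ k * u + v)) / 2 ^ k" for i u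
  proof (induction k arbitrary: i u)
    case (Suc k)
    have "measure_pmf.expectation (iter_pmf ?s i (Suc k) u) f =
        measure_pmf.expectation (?s i u) (\<lambda>x. (\<Sum>v<2 ^ k. f (2 ^ k * x + v)) / 2 ^ k)"
      unfolding iter_pmf.simps by (subst expectation_bind_finite) (auto simp: Suc intro!: iter_pmf_finite)
    also have "\<dots> = ((\<Sum>v<2 ^ k. f (2 ^ k * (2 * u + 1) + v)) / 2 ^ k + (\<Sum>v<2 ^ k. f (2 ^ k * (2 * u) + v)) / 2 ^ k) / 2"
      by (simp add: integral_pmf_of_set UNIV_bool add.commute) (simp add: field_simps)
    also have "\<dots> = ((\<Sum>v<2 ^ k. f (2 ^ k * (2 * u) + v)) + (\<Sum>v<2 ^ k. f (2 ^ k * (2 * u + 1) + v))) / 2 ^ Suc k"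
      by (simp add: add_divide_distrib)
    also have "(\<Sum>v<2 ^ k. f (2 ^ k * (2 * u) + v)) + (\<Sum>v<2 ^ k. f (2 ^ k * (2 * u + 1) + v)) =
        (\<Sum>v<2 ^ Suc k. f (2 ^ Suc k * u + v))"
      using split[of "\<lambda>v. f (2 ^ Suc k * u + v)" "2 ^ k" "2 ^ k"]
      by (simp add: mult_2[symmetric] algebra_simps)
    finally show ?case .
  qed simp
  from this[of 0 0] show ?thesis by (simp add: draw_def)
qed

text \<open>\<open>B\<close> bounds the weights, \<open>k\<close> is the number of coins per draw,
  \<open>T\<close> the steps per sample, \<open>N\<close> the samples per stage, \<open>J\<close>
  the precision. The condition \<open>bits\<close> lets a draw reach every half-edge and keeps the
  chain lazy; \<open>N_eq\<close> brings the relative variance of a stage to order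
  \<open>1 / J\<close>; \<open>T_ge\<close> multiplies the relaxation bound by an exponent that
  outweighs the worst starting state.\<close>

locale sampler = half_edge_graph m vt for m :: nat and vt :: "nat \<Rightarrow> 'v" +
  fixes w :: "nat \<Rightarrow> nat" and B k T N J :: nat and meas :: "nat \<Rightarrow> nat set \<Rightarrow> nat"
  assumes w_ge: "\<And>p. 1 \<le> w p" and w_le: "\<And>p. w p \<le> B"
    and bits: "2 * B ^ 2 \<le> 2 ^ k" "2 * m \<le> 2 ^ k"
    and J1: "1 \<le> J"
    and N_eq: "N = 4 * B * J"
    and T_ge: "(m + 1) ^ 2 * B ^ 4 * (2 ^ k) ^ 3 * (4 * B * (m + 2) + 2 * J + 2) \<le> T"
    and meas_le: "\<And>i X. meas i X \<le> B"
begin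

lemma B1: "1 \<le> B" using w_ge[of 0] w_le[of 0] by simp

text \<open>The factors of \<open>W i Z\<close> that flipping \<open>h\<close> and \<open>g\<close>
  can change. An edge containing both halves is counted once.\<close>

definition loc :: "nat \<Rightarrow> nat \<Rightarrow> nat \<Rightarrow> nat set \<Rightarrow> nat" where
  "loc i h g Z = (if h div 2 < i then w (pat Z (h div 2)) else 1) *
     (if g div 2 < i \<and> g div 2 \<noteq> h div 2 then w (pat Z (g div 2)) else 1)"

definition move :: "nat \<Rightarrow> nat set \<Rightarrow> nat \<Rightarrow> nat \<Rightarrow> nat \<Rightarrow> nat set" where
  "move i X h g r = (if (h, g) \<in> pairs \<and> r < loc i h g (X \<triangle> {h, g}) then X \<triangle> {h, g} else X)"

definition step :: "nat \<Rightarrow> nat set \<Rightarrow> nat set pmf" where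
  "step i X = bind_pmf (draw k) (\<lambda>h. bind_pmf (draw k) (\<lambda>g. bind_pmf (draw k) (\<lambda>r.
     return_pmf (move i X h g r))))"

text \<open>Interpolates between the uniform weight at \<open>i = 0\<close> and the full weight at
  \<open>i = m\<close>.\<close>

definition W :: "nat \<Rightarrow> nat set \<Rightarrow> real" where
  "W i X = (\<Prod>j<i. real (w (pat X j)))"

definition rate :: "nat \<Rightarrow> nat \<times> nat \<Rightarrow> nat set \<Rightarrow> real" where
  "rate i = (\<lambda>(h, g) X. loc i h g (X \<triangle> {h, g}) / (2 ^ k) ^ 3)"

abbreviation flip :: "nat \<times> nat \<Rightarrow> nat set \<Rightarrow> nat set" where
  "flip \<equiv> \<lambda>(h, g) X. X \<triangle> {h, g}"

lemma loc_bounds: "1 \<le> loc i h g Z" "loc i h g Z \<le> B ^ 2"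
proof -
  have "1 * 1 \<le> loc i h g Z" unfolding loc_def using w_ge by (intro mult_mono) auto
  then show "1 \<le> loc i h g Z" by simp
  show "loc i h g Z \<le> B ^ 2" unfolding loc_def power2_eq_square using w_le B1 by (intro mult_mono) auto
qed

lemma W_split:
  "W i X = loc i h g X * (\<Prod>j\<in>{..<i} - {h div 2, g div 2}. real (w (pat X j)))"
proof -
  let ?f = "\<lambda>j. real (w (pat X j))"
  let ?E = "{h div 2, g div 2} \<inter> {..<i}"
  have "W i X = prod ?f ({..<i} - ?E) * prod ?f ?E"
    unfolding W_def by (rule prod.subset_diff) auto
  moreover have "{..<i} - ?E = {..<i} - {h div 2, g div 2}" by auto
  moreover have "prod ?f ?E = loc i h g X"
    unfolding loc_def by (cases "h div 2 < i"; cases "g div 2 < i"; cases "g div 2 = h div 2") auto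
  ultimately show ?thesis by (simp add: mult.commute)
qed

lemma W_ge: "1 \<le> W i X"
  unfolding W_def by (rule prod_ge_1) (use w_ge in auto)

lemma W_le: "W i X \<le> real B ^ i"
proof -
  have "W i X \<le> (\<Prod>j<i. real B)" unfolding W_def by (intro prod_mono) (auto simp: w_le)
  then show ?thesis by simp
qed

text \<open>Both sides equal the weight of the untouched edges times the local weights before and
  after the flip, an expression symmetric in the two states.\<close>

lemma W_balance:
  "W i X * rate i (h, g) X = W i (X \<triangle> {h, g}) * rate i (h, g) (X \<triangle> {h, g})"
proof -
  have "(\<Prod>j\<in>{..<i} - {h div 2, g div 2}. real (w (pat (X \<triangle> {h, g}) j))) =
      (\<Prod>j\<in>{..<i} - {h div 2, g div 2}. real (w (pat X j)))"
    by (intro prod.cong refl) (auto simp: pat_symd_pair)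
  then show ?thesis by (simp add: rate_def W_split[of i _ h g])
qed

lemma pairs_subset: "pairs \<subseteq> {..<2 ^ k} \<times> {..<2 ^ k}"
  using bits by (auto simp: pairs_def)

lemma card_pairs: "card pairs \<le> (2 ^ k) ^ 2"
  using card_mono[OF _ pairs_subset] by (simp add: power2_eq_square card_cartesian_product)

sublocale rev: reversible_moves even_sets pairs "W i" "rate i" flip for i
proof
  show "0 < W i X" for X using W_ge[of i X] by linarith
  show "0 \<le> rate i p X" for p X by (auto simp: rate_def split: prod.split)
  show "flip p X \<in> even_sets" if "p \<in> pairs" "X \<in> even_sets" for p X
    using that by (cases p) (auto intro: even_sets_flip)
  show "W i X * rate i p X = W i (flip p X) * rate i p (flip p X)" if "p \<in> pairs" for p X
    by (cases p) (use W_balance in auto)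
  show "(\<Sum>p\<in>pairs. rate i p X) \<le> 1 / 2" for X
  proof -
    have "(\<Sum>p\<in>pairs. rate i p X) \<le> (\<Sum>p\<in>pairs. real (B ^ 2) / (2 ^ k) ^ 3)"
      by (intro sum_mono) (auto simp: rate_def intro!: divide_right_mono of_nat_mono loc_bounds simp del: of_nat_power)
    also have "\<dots> = real (card pairs) * real (B ^ 2) / (2 ^ k) ^ 3" by simp
    also have "\<dots> \<le> real ((2 ^ k) ^ 2) * real (B ^ 2) / (2 ^ k) ^ 3"
      by (intro divide_right_mono mult_right_mono of_nat_mono card_pairs) auto
    also have "\<dots> = real (B ^ 2) / 2 ^ k" by (simp add: power2_eq_square power3_eq_cube)
    also have "\<dots> \<le> 1 / 2"
    proof -
      have "real (2 * B ^ 2) \<le> real (2 ^ k)" using bits(1) by (rule of_nat_mono)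
      then show ?thesis by (simp add: divide_simps)
    qed
    finally show ?thesis .
  qed
qed auto

lemma step_finite [simp]: "finite (set_pmf (step i X))"
  by (simp add: step_def)

lemma step_even: "X \<in> even_sets \<Longrightarrow> set_pmf (step i X) \<subseteq> even_sets"
  by (auto simp: step_def move_def even_sets_flip)

text \<open>Since \<open>loc\<close> never exceeds \<open>2 ^ k\<close>, averaging over
  \<open>r\<close> turns the acceptance test into the exact probability
  \<open>loc / 2 ^ k\<close>.\<close>

lemma step_expectation: "measure_pmf.expectation (step i X) f = rev.kern i f X"
proof -
  let ?n = "2 ^ k :: nat"
  define d where "d h g = (if (h, g) \<in> pairs then real (loc i h g (X \<triangle> {h, g})) * (f (X \<triangle> {h, g}) - f X) else 0)" for h g
  have r: "(\<Sum>r<?n. f (move i X h g r)) = 2 ^ k * f X + d h g" for h g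
  proof (cases "(h, g) \<in> pairs")
    case True
    let ?l = "loc i h g (X \<triangle> {h, g})"
    have l: "?l \<le> ?n" using loc_bounds(2)[of i h g "X \<triangle> {h, g}"] bits(1) by linarith
    have "(\<Sum>r<?n. f (move i X h g r)) = (\<Sum>r<?n. f X + (if r < ?l then f (X \<triangle> {h, g}) - f X else 0))"
      by (intro sum.cong refl) (simp add: move_def True)
    also have "\<dots> = 2 ^ k * f X + (\<Sum>r\<in>{..<?n} \<inter> {r. r < ?l}. f (X \<triangle> {h, g}) - f X)"
      by (simp add: sum.distrib sum.If_cases)
    also have "{..<?n} \<inter> {r. r < ?l} = {..<?l}" using l by auto
    finally show ?thesis using True by (simp add: d_def)
  qed (simp add: move_def d_def)
  have "measure_pmf.expectation (step i X) f =
      (\<Sum>h<?n. (\<Sum>g<?n. (\<Sum>r<?n. f (move i X h g r)) / 2 ^ k) / 2 ^ k) / 2 ^ k"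
    unfolding step_def by (simp add: expectation_bind_finite draw_expectation sum_divide_distrib)
  also have "\<dots> = f X + (\<Sum>h<?n. \<Sum>g<?n. d h g) / (2 ^ k) ^ 3"
  proof -
    have 1: "(\<Sum>g<?n. (2 ^ k * f X + d h g) / 2 ^ k) = 2 ^ k * f X + (\<Sum>g<?n. d h g) / 2 ^ k" for h
      by (simp add: add_divide_distrib sum.distrib sum_divide_distrib)
    have 2: "(\<Sum>h<?n. (2 ^ k * f X + (\<Sum>g<?n. d h g) / 2 ^ k) / 2 ^ k) =
        2 ^ k * f X + (\<Sum>h<?n. \<Sum>g<?n. d h g) / 2 ^ k / 2 ^ k"
      by (simp add: add_divide_distrib sum.distrib sum_divide_distrib)
    show ?thesis unfolding r 1 2 by (simp add: add_divide_distrib power3_eq_cube)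
  qed
  also have "(\<Sum>h<?n. \<Sum>g<?n. d h g) = (\<Sum>(h, g)\<in>pairs. d h g)"
    unfolding sum.cartesian_product by (rule sum.mono_neutral_right) (use pairs_subset in \<open>auto simp: d_def\<close>)
  also have "f X + (\<Sum>(h, g)\<in>pairs. d h g) / (2 ^ k) ^ 3 = rev.kern i f X"
    unfolding rev.kern_def sum_divide_distrib
    by (intro arg_cong[where f = "\<lambda>a. f X + a"] sum.cong refl) (auto simp: d_def rate_def)
  finally show ?thesis .
qed

section \<open>Bias of a single sample\<close>

definition walk :: "nat \<Rightarrow> nat set \<Rightarrow> nat set pmf" where
  "walk i X = iter_pmf (\<lambda>_. step i) 0 T X"

lemma walk_finite [simp]: "finite (set_pmf (walk i X))"
  unfolding walk_def by (rule iter_pmf_finite) simp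

lemma walk_even: "X \<in> even_sets \<Longrightarrow> set_pmf (walk i X) \<subseteq> even_sets"
  unfolding walk_def by (rule iter_pmf_invariant) (auto dest: step_even)

lemma walk_expectation: "measure_pmf.expectation (walk i X) f = (rev.kern i ^^ T) f X"
proof -
  have "measure_pmf.expectation (iter_pmf (\<lambda>_. step i) l n X) f = (rev.kern i ^^ n) f X" for l n
  proof (induction n arbitrary: l X)
    case (Suc n)
    have "measure_pmf.expectation (iter_pmf (\<lambda>_. step i) l (Suc n) X) f =
       measure_pmf.expectation (step i X) (\<lambda>x. (rev.kern i ^^ n) f x)"
      unfolding iter_pmf.simps by (subst expectation_bind_finite) (auto simp: Suc intro!: iter_pmf_finite)
    then show ?case by (simp add: step_expectation)
  qed simp
  then show ?thesis by (simp add: walk_def)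
qed

definition mean :: "nat \<Rightarrow> real" where
  "mean i = (\<Sum>X\<in>even_sets. W i X * meas i X) / (\<Sum>X\<in>even_sets. W i X)"

text \<open>An upper bound for the relaxation time, that is, for the inverse of the spectral
  gap.\<close>

definition gap :: nat where "gap = (m + 1) ^ 2 * B ^ 4 * (2 ^ k) ^ 3"

text \<open>Local weights are at least 1, so each pair is flipped at rate at least
  \<open>1 / (2 ^ k) ^ 3\<close>, and \<open>poincare_pairs\<close> transfers to the energy of the
  chain.\<close>

lemma poincare_rate:
  "(\<Sum>X\<in>even_sets. \<Sum>Y\<in>even_sets. W i X * W i Y * (f X - f Y)\<^sup>2) \<le> real gap * sum (W i) even_sets * rev.energy i f"
proof -
  let ?D = "\<Sum>X\<in>even_sets. \<Sum>(h, g)\<in>pairs. W i X * (f (X \<triangle> {h, g}) - f X)\<^sup>2"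
  have W0: "0 \<le> W i X" for X using W_ge[of i X] by linarith
  have S0: "0 \<le> sum (W i) even_sets" using W0 by (intro sum_nonneg) auto
  have "?D \<le> (\<Sum>X\<in>even_sets. \<Sum>p\<in>pairs. (2 ^ k) ^ 3 * (W i X * rate i p X * (f (flip p X) - f X)\<^sup>2))"
  proof (intro sum_mono)
    fix X :: "nat set" and p :: "nat \<times> nat"
    obtain h g where p: "p = (h, g)" by (cases p)
    have "W i X * 1 * (f (X \<triangle> {h, g}) - f X)\<^sup>2 \<le> W i X * loc i h g (X \<triangle> {h, g}) * (f (X \<triangle> {h, g}) - f X)\<^sup>2"
      using W0 loc_bounds(1)[of i h g "X \<triangle> {h, g}"] by (intro mult_right_mono mult_left_mono) auto
    then show "(case p of (h, g) \<Rightarrow> W i X * (f (X \<triangle> {h, g}) - f X)\<^sup>2) \<le>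
        (2 ^ k) ^ 3 * (W i X * rate i p X * (f (flip p X) - f X)\<^sup>2)"
      by (simp add: rate_def p)
  qed
  also have "\<dots> = (2 ^ k) ^ 3 * rev.energy i f" by (simp add: rev.energy_def sum_distrib_left)
  finally have D: "?D \<le> (2 ^ k) ^ 3 * rev.energy i f" .
  have D0: "0 \<le> ?D" using W0 by (intro sum_nonneg) auto
  have "(\<Sum>X\<in>even_sets. \<Sum>Y\<in>even_sets. W i X * W i Y * (f X - f Y)\<^sup>2) \<le>
      (real m)\<^sup>2 * real B ^ 4 * sum (W i) even_sets * ?D"
    unfolding W_def by (rule poincare_pairs) (use w_ge w_le in auto)
  also have "\<dots> \<le> (real (m + 1))\<^sup>2 * real B ^ 4 * sum (W i) even_sets * ((2 ^ k) ^ 3 * rev.energy i f)"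
    by (rule mult_mono[OF _ D]) (use S0 D0 in \<open>auto intro!: mult_right_mono mult_nonneg_nonneg power_mono\<close>)
  finally show ?thesis by (simp add: gap_def mult_ac)
qed

text \<open>The bound is uniform in the starting state, so it applies again to every walk that
  resumes at an earlier sample.\<close>

lemma walk_bias:
  assumes X: "X \<in> even_sets" and i: "i \<le> m"
  shows "\<bar>measure_pmf.expectation (walk i X) (\<lambda>X. meas i X) - mean i\<bar> \<le> 1 / (2 * real J)"
proof -
  \<comment> \<open>In the exponent, \<open>4 * B * (m + 2)\<close> cancels the crude initial
    variance \<open>(4 * B) ^ (m + 2)\<close>, and \<open>2 * J + 2\<close> leaves the square of
    \<open>1 / 2 ^ (J + 1)\<close>.\<close>
  define t where "t = 4 * B * (m + 2) + 2 * J + 2"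
  let ?E = "measure_pmf.expectation (walk i X) (\<lambda>X. meas i X) - mean i"
  have gap1: "1 \<le> gap" using B1 by (simp add: gap_def)
  have W0: "0 < W i Y" for Y using W_ge[of i Y] by linarith
  have Z0: "0 < sum (W i) even_sets" using W0 empty_even by (intro sum_pos) (simp, use empty_even in blast, simp)
  have mean_bounds: "0 \<le> mean i" "mean i \<le> B"
  proof -
    show "0 \<le> mean i" unfolding mean_def using W0 by (intro divide_nonneg_nonneg sum_nonneg mult_nonneg_nonneg) (auto intro: less_imp_le)
    have "(\<Sum>X\<in>even_sets. W i X * meas i X) \<le> (\<Sum>X\<in>even_sets. W i X * B)"
      using W0 meas_le by (intro sum_mono mult_left_mono) (auto intro: less_imp_le)
    then show "mean i \<le> B" unfolding mean_def using Z0 by (simp add: divide_simps sum_distrib_left mult.commute)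
  qed
  \<comment> \<open>Weights of at least 1 remove the factor \<open>W i X\<close> from the bound at a
    single state.\<close>
  have "1 * ?E\<^sup>2 \<le> W i X * ?E\<^sup>2" by (intro mult_right_mono W_ge) auto
  also have "\<dots> \<le> (1 - 1 / gap) ^ T * (\<Sum>X\<in>even_sets. W i X * (meas i X - mean i)\<^sup>2)"
    unfolding walk_expectation mean_def
    by (rule rev.kern_pow_converges) (use gap1 X poincare_rate in auto)
  also have "\<dots> \<le> (1 - 1 / gap) ^ T * (\<Sum>X\<in>even_sets. real B ^ m * (real B)\<^sup>2)"
  proof (intro mult_left_mono sum_mono mult_mono)
    fix Y
    have "W i Y \<le> real B ^ i" by (rule W_le)
    also have "\<dots> \<le> real B ^ m" using B1 i by (intro power_increasing) auto
    finally show "W i Y \<le> real B ^ m" .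
    have "\<bar>real (meas i Y) - mean i\<bar> \<le> B" using mean_bounds meas_le[of i Y] by (auto simp: abs_le_iff)
    then show "(real (meas i Y) - mean i)\<^sup>2 \<le> (real B)\<^sup>2" by (simp add: abs_le_square_iff[symmetric])
  qed (use gap1 in auto)
  also have "\<dots> \<le> (1 - 1 / gap) ^ T * (4 ^ m * (real B ^ m * (real B)\<^sup>2))"
  proof (intro mult_left_mono)
    have "card even_sets \<le> card (Pow {..<2 * m})" by (intro card_mono) (auto simp: even_sets_def)
    also have "\<dots> = 4 ^ m" by (simp add: card_Pow power_mult)
    finally have "card even_sets \<le> 4 ^ m" .
    then have "real (card even_sets) \<le> real (4 ^ m)" by (rule of_nat_mono)
    then show "(\<Sum>X\<in>even_sets. real B ^ m * (real B)\<^sup>2) \<le> 4 ^ m * (real B ^ m * (real B)\<^sup>2)"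
      by (simp add: mult_right_mono)
  qed (use gap1 in auto)
  also have "\<dots> \<le> (1 - 1 / gap) ^ T * (4 * real B) ^ (m + 2)"
  proof (intro mult_left_mono)
    have "4 ^ m * (real B ^ m * (real B)\<^sup>2) * 1 \<le> 4 ^ m * (real B ^ m * (real B)\<^sup>2) * 16"
      by (intro mult_left_mono) auto
    also have "\<dots> = (4 * real B) ^ (m + 2)"
      by (simp add: power_mult_distrib power_add power2_eq_square)
    finally show "4 ^ m * (real B ^ m * (real B)\<^sup>2) \<le> (4 * real B) ^ (m + 2)" by simp
  qed (use gap1 in auto)
  also have "\<dots> \<le> (1 / 2) ^ t * (4 * real B) ^ (m + 2)"
  proof (intro mult_right_mono)
    have "gap * t \<le> T" using T_ge by (simp only: gap_def t_def)
    then have "(1 - 1 / gap) ^ T \<le> (1 - 1 / gap) ^ (gap * t)"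
      using gap1 by (intro power_decreasing) auto
    also have "\<dots> = ((1 - 1 / gap) ^ gap) ^ t" by (simp add: power_mult)
    also have "\<dots> \<le> (1 / 2) ^ t"
    proof (intro power_mono)
      have "(1 - 1 / gap) ^ gap \<le> exp (- (1 / gap)) ^ gap"
        using gap1 exp_ge_add_one_self[of "- (1 / gap)"] by (intro power_mono) auto
      also have "\<dots> = exp (- 1)" using gap1 by (simp flip: exp_of_nat_mult)
      also have "\<dots> \<le> 1 / 2" using exp_ge_add_one_self[of 1] by (simp add: exp_minus divide_simps)
      finally show "(1 - 1 / gap) ^ gap \<le> 1 / 2" .
    qed (use gap1 in auto)
    finally show "(1 - 1 / gap) ^ T \<le> (1 / 2) ^ t" .
  qed auto
  also have "\<dots> \<le> (1 / 2) ^ t * 2 ^ (4 * B * (m + 2))"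
  proof (intro mult_left_mono)
    have "real (4 * B) \<le> real (2 ^ (4 * B))" by (intro of_nat_mono less_imp_le less_exp)
    then have "(4 * real B) ^ (m + 2) \<le> (2 ^ (4 * B)) ^ (m + 2)" by (intro power_mono) auto
    then show "(4 * real B) ^ (m + 2) \<le> 2 ^ (4 * B * (m + 2))" by (simp only: power_mult)
  qed auto
  also have "\<dots> = ((1 / 2) ^ (J + 1))\<^sup>2"
  proof -
    have t: "t = 4 * B * (m + 2) + (J + 1) * 2" by (simp add: t_def)
    show ?thesis unfolding t power_add power_mult[of _ "J + 1" 2]
      by (simp add: power_one_over)
  qed
  also have "\<dots> \<le> (1 / (2 * real J))\<^sup>2"
  proof (intro power_mono)
    have "2 * J \<le> 2 * 2 ^ J" by (simp add: less_imp_le less_exp)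
    then have "real (2 * J) \<le> real (2 ^ (J + 1))" by (intro of_nat_mono) simp
    then show "(1 / 2) ^ (J + 1) \<le> 1 / (2 * real J)" using J1
      by (simp add: power_one_over divide_simps)
  qed auto
  finally have "?E\<^sup>2 \<le> (1 / (2 * real J))\<^sup>2" by simp
  then have "\<bar>?E\<bar> \<le> \<bar>1 / (2 * real J)\<bar>" by (simp only: abs_le_square_iff)
  then show ?thesis by simp
qed

end

section \<open>Moments of the product estimator\<close>

lemma expectation_affine:
  fixes f g :: "'b \<Rightarrow> real"
  assumes "finite (set_pmf p)"
  shows "measure_pmf.expectation p (\<lambda>x. a + b * f x + c * g x) =
    a + b * measure_pmf.expectation p f + c * measure_pmf.expectation p g"
  by (simp add: integrable_measure_pmf_finite[OF assms])

context sampler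
begin

text \<open>The walk resumes at the last sampled set, so successive samples are not
  independent.\<close>

definition sample :: "nat \<Rightarrow> nat set \<times> nat \<Rightarrow> (nat set \<times> nat) pmf" where
  "sample i = (\<lambda>(X, S). bind_pmf (walk i X) (\<lambda>Y. return_pmf (Y, S + meas i Y)))"

text \<open>The sum of the samples is multiplied into the product; the division by \<open>N\<close>
  is left to the denominator, so everything stays a natural number.\<close>

definition stage :: "nat \<Rightarrow> nat set \<times> nat \<Rightarrow> (nat set \<times> nat) pmf" where
  "stage i = (\<lambda>(X, P). bind_pmf (iter_pmf (\<lambda>_. sample i) 0 N (X, 0)) (\<lambda>(Y, S). return_pmf (Y, P * S)))"

definition alg :: "(nat set \<times> nat) pmf" where
  "alg = iter_pmf stage 0 (m + 1) ({}, 1)"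

lemma sample_finite [simp]: "finite (set_pmf (sample i z))"
  by (auto simp: sample_def split: prod.split)

lemma stage_finite [simp]: "finite (set_pmf (stage i z))"
  by (auto simp: stage_def iter_pmf_finite split: prod.split)

lemma alg_finite [simp]: "finite (set_pmf alg)"
  unfolding alg_def by (rule iter_pmf_finite) simp

lemma sample_even: "z \<in> even_sets \<times> UNIV \<Longrightarrow> set_pmf (sample i z) \<subseteq> even_sets \<times> UNIV"
  using walk_even by (fastforce simp: sample_def)

lemma samples_even: "z \<in> even_sets \<times> UNIV \<Longrightarrow> set_pmf (iter_pmf (\<lambda>_. sample i) l n z) \<subseteq> even_sets \<times> UNIV"
  by (rule iter_pmf_invariant) (use sample_even in auto)

lemma stage_even: "z \<in> even_sets \<times> UNIV \<Longrightarrow> set_pmf (stage i z) \<subseteq> even_sets \<times> UNIV"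
  using samples_even[of "(fst z, 0)" i 0 N] by (fastforce simp: stage_def)

definition lo :: "nat \<Rightarrow> real" where "lo i = (1 - 1 / J) * mean i"
definition up :: "nat \<Rightarrow> real" where "up i = (1 + 1 / J) * mean i"
text \<open>Bounds a second moment through \<open>meas \<le> B\<close>. The factor
  \<open>2 * mean i\<close>, at least 1 when it is used, makes the bound quadratic in the mean like
  the main term it is compared with.\<close>

definition vr :: "nat \<Rightarrow> real" where "vr i = 2 * B * mean i * up i"

context
  assumes mean_ge: "\<And>i. i \<le> m \<Longrightarrow> 1 / 2 \<le> mean i"
begin

text \<open>A mean of at least 1/2 turns the absolute bias \<open>1 / (2 * J)\<close> into the
  relative bias \<open>1 / J\<close>.\<close>

lemma walk_moments:
  assumes X: "X \<in> even_sets" and i: "i \<le> m"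
  shows "lo i \<le> measure_pmf.expectation (walk i X) (\<lambda>X. meas i X)"
    and "measure_pmf.expectation (walk i X) (\<lambda>X. meas i X) \<le> up i"
    and "measure_pmf.expectation (walk i X) (\<lambda>X. (real (meas i X))\<^sup>2) \<le> vr i"
proof -
  let ?E = "measure_pmf.expectation (walk i X) (\<lambda>X. real (meas i X))"
  have "1 / (2 * real J) = 1 / J * (1 / 2)" by simp
  also have "\<dots> \<le> 1 / J * mean i" by (intro mult_left_mono mean_ge i) auto
  finally have "\<bar>?E - mean i\<bar> \<le> 1 / J * mean i" using walk_bias[OF X i] by linarith
  then show 1: "lo i \<le> ?E" and 2: "?E \<le> up i" by (auto simp: lo_def up_def abs_le_iff algebra_simps)
  have "measure_pmf.expectation (walk i X) (\<lambda>X. (real (meas i X))\<^sup>2) \<le>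
      measure_pmf.expectation (walk i X) (\<lambda>X. B * real (meas i X))"
    by (rule expectation_mono_finite) (auto simp: power2_eq_square meas_le intro!: mult_right_mono)
  also have "\<dots> = B * ?E" by simp
  also have "\<dots> \<le> B * up i" using 2 by (intro mult_left_mono) auto
  also have "\<dots> \<le> vr i"
  proof -
    have m0: "1 / 2 \<le> mean i" by (rule mean_ge[OF i])
    then have u0: "0 \<le> up i" by (simp add: up_def)
    have "B * up i * 1 \<le> B * up i * (2 * mean i)" using m0 u0 by (intro mult_left_mono) auto
    then show ?thesis by (simp add: vr_def mult_ac)
  qed
  finally show "measure_pmf.expectation (walk i X) (\<lambda>X. (real (meas i X))\<^sup>2) \<le> vr i" .
qed

lemma sample_expectation:
  fixes f :: "nat set \<times> nat \<Rightarrow> real"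
  shows "measure_pmf.expectation (sample i (X, S)) f = measure_pmf.expectation (walk i X) (\<lambda>Y. f (Y, S + meas i Y))"
  unfolding sample_def by (simp add: expectation_bind_finite)

text \<open>The bounds are those for independent summands with mean at most \<open>up i\<close> and
  second moment at most \<open>vr i\<close>. Dependence does no harm, because conditionally on the
  current set each new sample obeys the same bounds.\<close>

lemma samples_moments:
  assumes X: "X \<in> even_sets" and i: "i \<le> m"
  shows "real S + n * lo i \<le> measure_pmf.expectation (iter_pmf (\<lambda>_. sample i) l n (X, S)) (\<lambda>z. real (snd z))"
    and "measure_pmf.expectation (iter_pmf (\<lambda>_. sample i) l n (X, S)) (\<lambda>z. (real (snd z))\<^sup>2) \<le>
      (real S)\<^sup>2 + 2 * real S * real n * up i + (real n)\<^sup>2 * (up i)\<^sup>2 + n * vr i"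
proof -
  have rec: "measure_pmf.expectation (iter_pmf (\<lambda>_. sample i) l (Suc n) (X, S)) f =
      measure_pmf.expectation (walk i X) (\<lambda>Y. measure_pmf.expectation (iter_pmf (\<lambda>_. sample i) (Suc l) n (Y, S + meas i Y)) f)"
    for l n X S and f :: "nat set \<times> nat \<Rightarrow> real"
    unfolding iter_pmf.simps
    by (subst expectation_bind_finite) (auto simp: sample_expectation intro!: iter_pmf_finite)
  have u0: "0 \<le> up i" using mean_ge[OF i] by (simp add: up_def)
  show "real S + n * lo i \<le> measure_pmf.expectation (iter_pmf (\<lambda>_. sample i) l n (X, S)) (\<lambda>z. real (snd z))"
    using X
  proof (induction n arbitrary: l X S)
    case (Suc n)
    have "real S + Suc n * lo i = (S + n * lo i) + lo i" by (simp add: algebra_simps)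
    also have "\<dots> \<le> (S + n * lo i) + measure_pmf.expectation (walk i X) (\<lambda>X. meas i X)"
      using walk_moments(1)[OF Suc.prems i] by simp
    \<comment> \<open>The summand \<open>0 * 0\<close> only brings the integrand into the shape of
      \<open>expectation_affine\<close>.\<close>
    also have "\<dots> = measure_pmf.expectation (walk i X) (\<lambda>Y. (S + n * lo i) + 1 * real (meas i Y) + 0 * 0)"
      by (subst expectation_affine) auto
    also have "\<dots> \<le> measure_pmf.expectation (iter_pmf (\<lambda>_. sample i) l (Suc n) (X, S)) (\<lambda>z. real (snd z))"
      unfolding rec
    proof (rule expectation_mono_finite)
      fix Y assume "Y \<in> set_pmf (walk i X)"
      then have "Y \<in> even_sets" using walk_even[OF Suc.prems] by blast
      from Suc.IH[OF this, of "S + meas i Y" "Suc l"]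
      show "(S + n * lo i) + 1 * real (meas i Y) + 0 * 0 \<le>
        measure_pmf.expectation (iter_pmf (\<lambda>_. sample i) (Suc l) n (Y, S + meas i Y)) (\<lambda>z. real (snd z))"
        by (simp add: algebra_simps)
    qed simp
    finally show ?case .
  qed simp
  show "measure_pmf.expectation (iter_pmf (\<lambda>_. sample i) l n (X, S)) (\<lambda>z. (real (snd z))\<^sup>2) \<le>
      (real S)\<^sup>2 + 2 * real S * real n * up i + (real n)\<^sup>2 * (up i)\<^sup>2 + n * vr i"
    using X
  proof (induction n arbitrary: l X S)
    case (Suc n)
    let ?c = "(real S)\<^sup>2 + 2 * real S * real n * up i + (real n)\<^sup>2 * (up i)\<^sup>2 + n * vr i"
    let ?b = "2 * S + 2 * n * up i"
    have "measure_pmf.expectation (iter_pmf (\<lambda>_. sample i) l (Suc n) (X, S)) (\<lambda>z. (real (snd z))\<^sup>2) \<le>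
       measure_pmf.expectation (walk i X) (\<lambda>Y. ?c + ?b * real (meas i Y) + 1 * (real (meas i Y))\<^sup>2)"
      unfolding rec
    proof (rule expectation_mono_finite)
      fix Y assume "Y \<in> set_pmf (walk i X)"
      then have "Y \<in> even_sets" using walk_even[OF Suc.prems] by blast
      from Suc.IH[OF this, of "Suc l" "S + meas i Y"]
      show "measure_pmf.expectation (iter_pmf (\<lambda>_. sample i) (Suc l) n (Y, S + meas i Y)) (\<lambda>z. (real (snd z))\<^sup>2)
        \<le> ?c + ?b * real (meas i Y) + 1 * (real (meas i Y))\<^sup>2"
        by (simp add: algebra_simps power2_eq_square)
    qed simp
    also have "\<dots> = ?c + ?b * measure_pmf.expectation (walk i X) (\<lambda>X. meas i X) +
        1 * measure_pmf.expectation (walk i X) (\<lambda>X. (real (meas i X))\<^sup>2)"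
      by (rule expectation_affine) simp
    also have "\<dots> \<le> ?c + ?b * up i + 1 * vr i"
      using u0 by (intro add_mono mult_left_mono walk_moments Suc.prems i) auto
    also have "\<dots> \<le> (real S)\<^sup>2 + 2 * real S * real (Suc n) * up i + (real (Suc n))\<^sup>2 * (up i)\<^sup>2 + real (Suc n) * vr i"
      by (simp add: algebra_simps power2_eq_square)
    finally show ?case .
  qed simp
qed

lemma stage_moments:
  assumes X: "X \<in> even_sets" and i: "i \<le> m"
  shows "P * (N * lo i) \<le> measure_pmf.expectation (stage i (X, P)) (\<lambda>z. real (snd z))"
    and "measure_pmf.expectation (stage i (X, P)) (\<lambda>z. (real (snd z))\<^sup>2) \<le>
      (real P)\<^sup>2 * ((real N)\<^sup>2 * (up i)\<^sup>2 + N * vr i)"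
proof -
  have E: "measure_pmf.expectation (stage i (X, P)) f =
      measure_pmf.expectation (iter_pmf (\<lambda>_. sample i) 0 N (X, 0)) (\<lambda>z. f (fst z, P * snd z))"
    for f :: "nat set \<times> nat \<Rightarrow> real"
    unfolding stage_def
    by (simp add: case_prod_unfold expectation_bind_finite iter_pmf_finite)
  show "P * (N * lo i) \<le> measure_pmf.expectation (stage i (X, P)) (\<lambda>z. real (snd z))"
    unfolding E using mult_left_mono[OF samples_moments(1)[OF X i, of 0 N 0], of "real P"] by simp
  show "measure_pmf.expectation (stage i (X, P)) (\<lambda>z. (real (snd z))\<^sup>2) \<le>
      (real P)\<^sup>2 * ((real N)\<^sup>2 * (up i)\<^sup>2 + N * vr i)"
    unfolding E using mult_left_mono[OF samples_moments(2)[OF X i, of 0 N 0], of "(real P)\<^sup>2"]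
    by (simp add: power_mult_distrib)
qed

text \<open>The conditional bounds of a stage do not depend on the even set it starts from, so they
  multiply.\<close>

lemma stages_moments:
  assumes X: "X \<in> even_sets" and l: "l + n \<le> m + 1"
  shows "P * (\<Prod>i\<in>{l..<l + n}. N * lo i) \<le> measure_pmf.expectation (iter_pmf stage l n (X, P)) (\<lambda>z. real (snd z))"
    and "measure_pmf.expectation (iter_pmf stage l n (X, P)) (\<lambda>z. (real (snd z))\<^sup>2) \<le>
      (real P)\<^sup>2 * (\<Prod>i\<in>{l..<l + n}. (real N)\<^sup>2 * (up i)\<^sup>2 + N * vr i)"
proof -
  have rec: "measure_pmf.expectation (iter_pmf stage l (Suc n) z) f =
      measure_pmf.expectation (stage l z) (\<lambda>y. measure_pmf.expectation (iter_pmf stage (Suc l) n y) f)"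
    for l n z and f :: "nat set \<times> nat \<Rightarrow> real"
    unfolding iter_pmf.simps by (subst expectation_bind_finite) (auto intro!: iter_pmf_finite)
  have ivl: "{l..<l + Suc n} = insert l {Suc l..<Suc l + n}" for l n :: nat by auto
  have J0: "0 \<le> 1 - 1 / real J" using J1 by simp
  have m0: "0 \<le> mean i" if "i \<le> m" for i using mean_ge[OF that] by linarith
  show "P * (\<Prod>i\<in>{l..<l + n}. N * lo i) \<le> measure_pmf.expectation (iter_pmf stage l n (X, P)) (\<lambda>z. real (snd z))"
    using X l
  proof (induction n arbitrary: l X P)
    case (Suc n)
    let ?p = "\<Prod>i\<in>{Suc l..<Suc l + n}. N * lo i"
    have p0: "0 \<le> ?p" using J0 m0 Suc.prems(2) by (intro prod_nonneg) (auto simp: lo_def)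
    have "P * (\<Prod>i\<in>{l..<l + Suc n}. N * lo i) = P * (N * lo l) * ?p" unfolding ivl by simp
    also have "\<dots> \<le> measure_pmf.expectation (stage l (X, P)) (\<lambda>z. real (snd z)) * ?p"
      using Suc.prems p0 by (intro mult_right_mono stage_moments) auto
    also have "\<dots> = measure_pmf.expectation (stage l (X, P)) (\<lambda>z. real (snd z) * ?p)" by simp
    also have "\<dots> \<le> measure_pmf.expectation (iter_pmf stage l (Suc n) (X, P)) (\<lambda>z. real (snd z))"
      unfolding rec
    proof (rule expectation_mono_finite)
      fix y assume "y \<in> set_pmf (stage l (X, P))"
      then have "fst y \<in> even_sets" using stage_even[of "(X, P)" l] Suc.prems by auto
      from Suc.IH[OF this, of "Suc l" "snd y"] Suc.prems(2)
      show "real (snd y) * ?p \<le> measure_pmf.expectation (iter_pmf stage (Suc l) n y) (\<lambda>z. real (snd z))"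
        by simp
    qed simp
    finally show ?case .
  qed simp
  show "measure_pmf.expectation (iter_pmf stage l n (X, P)) (\<lambda>z. (real (snd z))\<^sup>2) \<le>
      (real P)\<^sup>2 * (\<Prod>i\<in>{l..<l + n}. (real N)\<^sup>2 * (up i)\<^sup>2 + N * vr i)"
    using X l
  proof (induction n arbitrary: l X P)
    case (Suc n)
    let ?p = "\<Prod>i\<in>{Suc l..<Suc l + n}. (real N)\<^sup>2 * (up i)\<^sup>2 + N * vr i"
    have p0: "0 \<le> ?p" using m0 Suc.prems(2) by (intro prod_nonneg ballI add_nonneg_nonneg) (auto simp: vr_def up_def)
    have "measure_pmf.expectation (iter_pmf stage l (Suc n) (X, P)) (\<lambda>z. (real (snd z))\<^sup>2) \<le>
        measure_pmf.expectation (stage l (X, P)) (\<lambda>z. (real (snd z))\<^sup>2 * ?p)"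
      unfolding rec
    proof (rule expectation_mono_finite)
      fix y assume "y \<in> set_pmf (stage l (X, P))"
      then have "fst y \<in> even_sets" using stage_even[of "(X, P)" l] Suc.prems by auto
      from Suc.IH[OF this, of "Suc l" "snd y"] Suc.prems(2)
      show "measure_pmf.expectation (iter_pmf stage (Suc l) n y) (\<lambda>z. (real (snd z))\<^sup>2) \<le> (real (snd y))\<^sup>2 * ?p"
        by simp
    qed simp
    also have "\<dots> = measure_pmf.expectation (stage l (X, P)) (\<lambda>z. (real (snd z))\<^sup>2) * ?p" by simp
    also have "\<dots> \<le> (real P)\<^sup>2 * ((real N)\<^sup>2 * (up l)\<^sup>2 + N * vr l) * ?p"
      using Suc.prems p0 by (intro mult_right_mono stage_moments) auto
    also have "\<dots> = (real P)\<^sup>2 * (\<Prod>i\<in>{l..<l + Suc n}. (real N)\<^sup>2 * (up i)\<^sup>2 + N * vr i)"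
      unfolding ivl by simp
    finally show ?case .
  qed simp
qed

text \<open>Chebyshev's inequality around \<open>M\<close>. Relative to \<open>M\<close>, the mean
  loses at most \<open>(m + 1) / J\<close>; relative to \<open>M ^ 2\<close>, the second moment
  gains at most \<open>8 * (m + 1) / J\<close>. The mean square deviation is thus at most
  \<open>10 * (m + 1) / J\<close>, and the factor 40 makes this \<open>e ^ 2 / 4\<close>.\<close>

theorem alg_accurate:
  fixes e :: real
  assumes e: "0 < e" and J: "40 * (m + 1) \<le> J * e\<^sup>2" and J40: "40 * (m + 1) \<le> J"
  defines "M \<equiv> \<Prod>i<m + 1. N * mean i"
  shows "3 / 4 \<le> measure_pmf.prob alg {z. \<bar>real (snd z) - M\<bar> \<le> e * M}" (is "_ \<le> measure_pmf.prob _ ?G")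
proof -
  let ?\<eta> = "1 / real J" and ?n = "m + 1"
  have J0: "0 < real J" "?\<eta> \<le> 1" using J1 by auto
  have N0: "0 < real N" using N_eq J1 B1 by simp
  have mp: "0 < mean i" if "i \<le> m" for i using mean_ge[OF that] by linarith
  have M0: "0 < M" unfolding M_def using N0 mp by (intro prod_pos ballI mult_pos_pos) auto
  let ?E = "measure_pmf.expectation alg"
  have E1: "M * (1 - ?n * ?\<eta>) \<le> ?E (\<lambda>z. real (snd z))"
  proof -
    have "M * (1 - ?n * ?\<eta>) \<le> M * (1 - ?\<eta>) ^ ?n"
      using Bernoulli_inequality[of "- ?\<eta>" ?n] J0 M0 by (intro mult_left_mono) auto
    also have "\<dots> = (\<Prod>i<m + 1. N * lo i)"
      unfolding M_def lo_def by (simp add: prod.distrib mult_ac)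
    also have "\<dots> \<le> ?E (\<lambda>z. real (snd z))"
      using stages_moments(1)[of "{}" 0 "m + 1" 1] unfolding alg_def by (simp add: lessThan_atLeast0)
    finally show ?thesis .
  qed
  have E2: "?E (\<lambda>z. (real (snd z))\<^sup>2) \<le> M\<^sup>2 * (1 + 4 * ?\<eta>) ^ ?n"
  proof -
    have "?E (\<lambda>z. (real (snd z))\<^sup>2) \<le> (\<Prod>i<m + 1. (real N)\<^sup>2 * (up i)\<^sup>2 + N * vr i)"
      using stages_moments(2)[of "{}" 0 "m + 1" 1] unfolding alg_def by (simp add: lessThan_atLeast0)
    also have "\<dots> \<le> (\<Prod>i<m + 1. (N * mean i)\<^sup>2 * (1 + 4 * ?\<eta>))"
    proof (intro prod_mono conjI)
      fix i assume "i \<in> {..<m + 1}"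
      then have i: "0 \<le> mean i" using mp[of i] by simp
      show "0 \<le> (real N)\<^sup>2 * (up i)\<^sup>2 + N * vr i" using i by (auto simp: vr_def up_def)
      \<comment> \<open>This uses \<open>N = 4 * B * J\<close>, which turns \<open>2 * B * N\<close>
        into \<open>N ^ 2 / (2 * J)\<close>.\<close>
      have "N * vr i = (N * mean i)\<^sup>2 * ((1 + ?\<eta>) * ?\<eta> / 2)"
        using J0 B1 unfolding vr_def up_def N_eq by (simp add: field_simps power2_eq_square)
      moreover have "(real N)\<^sup>2 * (up i)\<^sup>2 = (N * mean i)\<^sup>2 * (1 + ?\<eta>)\<^sup>2"
        by (simp add: up_def power_mult_distrib mult_ac)
      moreover have "(1 + ?\<eta>)\<^sup>2 + (1 + ?\<eta>) * ?\<eta> / 2 \<le> 1 + 4 * ?\<eta>"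
      proof -
        have "?\<eta> * ?\<eta> \<le> ?\<eta> * 1" using J0 by (intro mult_left_mono) auto
        then have "?\<eta>\<^sup>2 \<le> ?\<eta>" by (simp add: power2_eq_square)
        moreover have "(1 + y)\<^sup>2 + (1 + y) * y / 2 = 1 + 5 / 2 * y + 3 / 2 * y\<^sup>2" for y :: real
          by (simp add: power2_eq_square field_simps)
        ultimately show ?thesis using J0 by (simp only:)
      qed
      ultimately show "(real N)\<^sup>2 * (up i)\<^sup>2 + N * vr i \<le> (N * mean i)\<^sup>2 * (1 + 4 * ?\<eta>)"
        by (simp only: distrib_left[symmetric]) (rule mult_left_mono, auto)
    qed
    also have "\<dots> = M\<^sup>2 * (1 + 4 * ?\<eta>) ^ ?n"
      unfolding M_def prod_power_distrib by (simp only: prod.distrib[of "\<lambda>i. (real N * mean i)\<^sup>2"] prod_constant card_lessThan)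
    finally show ?thesis .
  qed
  show "3 / 4 \<le> measure_pmf.prob alg ?G"
  proof -
    have x: "4 * (?n * ?\<eta>) \<le> 1"
    proof -
      have "real (40 * ?n) \<le> real J" using J40 by (rule of_nat_mono)
      then show ?thesis using J0 by (simp add: field_simps)
    qed
    have "(1 + 4 * ?\<eta>) ^ ?n \<le> exp (4 * ?\<eta>) ^ ?n" using J0 by (intro power_mono) auto
    also have "\<dots> = exp (4 * (?n * ?\<eta>))" by (simp only: exp_of_nat_mult[symmetric] mult.left_commute)
    also have "\<dots> \<le> 1 + 4 * (?n * ?\<eta>) + (4 * (?n * ?\<eta>))\<^sup>2" using x by (intro exp_bound) auto
    also have "(4 * (?n * ?\<eta>))\<^sup>2 \<le> 4 * (?n * ?\<eta>)"
      using x mult_left_mono[OF x, of "4 * (?n * ?\<eta>)"] by (simp add: power2_eq_square)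
    finally have p: "(1 + 4 * ?\<eta>) ^ ?n \<le> 1 + 8 * (?n * ?\<eta>)" by simp
    have "?E (\<lambda>z. (real (snd z) - M)\<^sup>2) = ?E (\<lambda>z. M\<^sup>2 + (- 2 * M) * real (snd z) + 1 * (real (snd z))\<^sup>2)"
      by (intro arg_cong[where f = ?E] ext) (simp add: power2_eq_square algebra_simps)
    also have "\<dots> = M\<^sup>2 + (- 2 * M) * ?E (\<lambda>z. real (snd z)) + 1 * ?E (\<lambda>z. (real (snd z))\<^sup>2)"
      by (rule expectation_affine) simp
    also have "\<dots> \<le> M\<^sup>2 + (- 2 * M) * (M * (1 - ?n * ?\<eta>)) + 1 * (M\<^sup>2 * (1 + 8 * (?n * ?\<eta>)))"
      using E1 E2 p M0 by (intro add_mono mult_left_mono_neg mult_left_mono order_trans[OF E2]) auto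
    also have "\<dots> = M\<^sup>2 * (10 * (?n * ?\<eta>))"
    proof -
      have "M\<^sup>2 + (- 2 * M) * (M * (1 - y)) + 1 * (M\<^sup>2 * (1 + 8 * y)) = M\<^sup>2 * (10 * y)" for y
        by (simp add: algebra_simps power2_eq_square)
      then show ?thesis .
    qed
    also have "\<dots> \<le> M\<^sup>2 * (e\<^sup>2 / 4)"
      using J J0 by (intro mult_left_mono) (auto simp: field_simps)
    finally have v: "?E (\<lambda>z. (real (snd z) - M)\<^sup>2) \<le> M\<^sup>2 * (e\<^sup>2 / 4)" .
    have "measure_pmf.prob alg (- ?G) = ?E (indicator (- ?G))" by simp
    also have "\<dots> \<le> ?E (\<lambda>z. 1 / (e * M)\<^sup>2 * (real (snd z) - M)\<^sup>2)"
    proof (rule expectation_mono_finite)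
      fix z
      show "indicator (- ?G) z \<le> 1 / (e * M)\<^sup>2 * (real (snd z) - M)\<^sup>2"
      proof (cases "z \<in> ?G")
        case False
        then have "\<bar>e * M\<bar> \<le> \<bar>real (snd z) - M\<bar>" using e M0 by simp
        then have "(e * M)\<^sup>2 \<le> (real (snd z) - M)\<^sup>2" by (simp only: abs_le_square_iff)
        then show ?thesis using False e M0 by (simp add: divide_simps)
      qed simp
    qed simp
    also have "\<dots> = 1 / (e * M)\<^sup>2 * ?E (\<lambda>z. (real (snd z) - M)\<^sup>2)" by simp
    also have "\<dots> \<le> 1 / (e * M)\<^sup>2 * (M\<^sup>2 * (e\<^sup>2 / 4))" by (intro mult_left_mono v) auto
    also have "\<dots> = 1 / 4" using e M0 by (simp add: power_mult_distrib)
    finally have "measure_pmf.prob alg (- ?G) \<le> 1 / 4" .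
    moreover have "measure_pmf.prob alg (- ?G) = 1 - measure_pmf.prob alg ?G"
      using measure_pmf.prob_compl[of ?G alg] by (simp add: Compl_eq_Diff_UNIV)
    ultimately show ?thesis by simp
  qed
qed

end

end

section \<open>A program logic for distribution, frame and cost\<close>

lemma int_size_le: "\<bar>v\<bar> \<le> 2 ^ p \<Longrightarrow> int_size v \<le> p + 2"
proof -
  assume v: "\<bar>v\<bar> \<le> 2 ^ p"
  have "nat \<bar>v\<bar> \<le> 2 ^ p" using v by (simp add: nat_le_iff)
  also have "\<dots> < 2 ^ (p + 1)" by simp
  finally have "floorlog 2 (nat \<bar>v\<bar>) \<le> p + 1" by (intro floorlog_leI) auto
  then show ?thesis by (simp add: int_size_def)
qed

lemma abs_le_int_size: "\<bar>v\<bar> \<le> 2 ^ int_size v"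
proof -
  have "nat \<bar>v\<bar> < 2 ^ int_size v" by (rule floorlog_leD) (auto simp: int_size_def)
  then show ?thesis by (simp add: nat_less_iff less_imp_le)
qed

definition bounded_cells :: "nat \<Rightarrow> state \<Rightarrow> bool" where
  "bounded_cells L s \<longleftrightarrow> (\<forall>x i. \<bar>s x i\<bar> \<le> 2 ^ L)"

text \<open>With cells bounded by \<open>2 ^ L\<close>, values are bounded by
  \<open>2 ^ (asize a * L)\<close>. Sums are charged like products, which costs only a
  constant.\<close>

primrec asize :: "aexp \<Rightarrow> nat" where
  "asize (Num k) = int_size k"
| "asize (Read x a) = 1"
| "asize (Plus a b) = asize a + asize b"
| "asize (Minus a b) = asize a + asize b"
| "asize (Times a b) = asize a + asize b"
| "asize (Div a b) = asize a + asize b"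
| "asize (Mod a b) = asize a + asize b"

primrec acoef :: "aexp \<Rightarrow> nat" where
  "acoef (Num k) = int_size k"
| "acoef (Read x a) = acoef a + 3"
| "acoef (Plus a b) = acoef a + acoef b + asize a + asize b + 2"
| "acoef (Minus a b) = acoef a + acoef b + asize a + asize b + 2"
| "acoef (Times a b) = acoef a + acoef b + asize a + asize b + 2"
| "acoef (Div a b) = acoef a + acoef b + asize a + asize b + 2"
| "acoef (Mod a b) = acoef a + acoef b + asize a + asize b + 2"

primrec bcoef :: "bexp \<Rightarrow> nat" where
  "bcoef (Less a b) = 1 + acoef a + acoef b"
| "bcoef (Equal a b) = 1 + acoef a + acoef b"
| "bcoef (Neg b) = 1 + bcoef b"
| "bcoef (Conj b c) = 1 + bcoef b + bcoef c"

text \<open>Not a running time: it bounds, in units of \<open>L\<close>, the cost of each single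
  assignment or test inside the command. The number of such steps is counted by
  \<open>spec\<close>.\<close>

primrec ccoef :: "com \<Rightarrow> nat" where
  "ccoef Skip = 1"
| "ccoef (Assign x i a) = 1 + acoef i + acoef a"
| "ccoef (Flip x i) = 1 + acoef i"
| "ccoef (Seq c1 c2) = ccoef c1 + ccoef c2"
| "ccoef (Cond b c1 c2) = 1 + bcoef b + ccoef c1 + ccoef c2"
| "ccoef (While b c) = 1 + bcoef b + ccoef c"

primrec writes :: "com \<Rightarrow> vname set" where
  "writes Skip = {}"
| "writes (Assign x i a) = {x}"
| "writes (Flip x i) = {x}"
| "writes (Seq c1 c2) = writes c1 \<union> writes c2"
| "writes (Cond b c1 c2) = writes c1 \<union> writes c2"
| "writes (While b c) = writes c"

definition agree_except :: "vname set \<Rightarrow> state \<Rightarrow> state \<Rightarrow> bool" where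
  "agree_except M s s' \<longleftrightarrow> (\<forall>y. y \<notin> M \<longrightarrow> s' y = s y)"

lemma agree_except_refl [simp]: "agree_except M s s"
  by (simp add: agree_except_def)

lemma agree_except_trans:
  "agree_except M s s' \<Longrightarrow> agree_except M' s' s'' \<Longrightarrow> M \<subseteq> A \<Longrightarrow> M' \<subseteq> A \<Longrightarrow> agree_except A s s''"
  unfolding agree_except_def by (metis subsetD)

lemma abs_div_le: "\<bar>a div b\<bar> \<le> \<bar>a\<bar>" for a b :: int
proof -
  have pos: "\<bar>a div b\<bar> \<le> \<bar>a\<bar>" if b: "0 < b" for a b :: int
  proof (cases "0 \<le> a")
    case True
    then show ?thesis using zdiv_mono2[of a 1 b] pos_imp_zdiv_nonneg_iff[of b a] b by simp
  next
    case False
    then show ?thesis using zdiv_mono2_neg[of a 1 b] pos_imp_zdiv_neg_iff[of b a] b by simp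
  qed
  consider "0 < b" | "b = 0" | "0 < - b" by linarith
  then show ?thesis
  proof cases
    case 3
    then show ?thesis using pos[of "- b" "- a"] by simp
  qed (simp_all add: pos)
qed

lemma abs_mod_le: "\<bar>a mod b\<bar> \<le> \<bar>a\<bar> + \<bar>b\<bar>" for a b :: int
proof -
  consider "0 < b" | "b = 0" | "b < 0" by linarith
  then show ?thesis
  proof cases
    case 1
    then show ?thesis using pos_mod_bound[of b a] pos_mod_sign[of b a] by linarith
  next
    case 3
    then show ?thesis using neg_mod_bound[of b a] neg_mod_sign[of b a] by linarith
  qed simp
qed

text \<open>\<open>K\<close> absorbs the constants of the program text and \<open>L\<close> the bit
  length of the cells, so one elementary step costs at most \<open>K * L\<close>.\<close>

locale cost_model =
  fixes K L :: nat
  assumes L1: "1 \<le> L"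
begin

lemma asize_pos: "1 \<le> asize a"
  by (induction a) (auto simp: int_size_def)

lemma aval_bound:
  assumes s: "bounded_cells L s"
  shows "\<bar>aval a s\<bar> \<le> 2 ^ (asize a * L)"
proof -
  have add: "2 ^ (asize a * L) + 2 ^ (asize b * L) \<le> (2 :: int) ^ ((asize a + asize b) * L)" for a b
  proof -
    have ge: "(2 :: int) \<le> 2 ^ (asize a * L)" for a
      using power_increasing[of 1 "asize a * L" "2 :: int"] asize_pos[of a] L1 by simp
    have "x + y \<le> x * y" if "2 \<le> x" "2 \<le> y" for x y :: int
    proof -
      have "0 \<le> (x - 1) * (y - 1) - 1" using mult_mono[of 1 "x - 1" 1 "y - 1"] that by simp
      then show ?thesis by (simp add: algebra_simps)
    qed
    from this[OF ge[of a] ge[of b]] show ?thesis by (simp add: add_mult_distrib power_add)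
  qed
  show ?thesis
  proof (induction a)
    case (Num k)
    have "(2 :: int) ^ int_size k \<le> 2 ^ (int_size k * L)" using L1 by (intro power_increasing) auto
    from order_trans[OF abs_le_int_size this] show ?case by (simp only: aval.simps asize.simps)
  next
    case (Read x a)
    then show ?case using s by (simp add: bounded_cells_def)
  next
    case (Plus a b)
    then show ?case using add[of a b] by simp
  next
    case (Minus a b)
    then show ?case using add[of a b] by simp
  next
    case (Times a b)
    then have "\<bar>aval a s\<bar> * \<bar>aval b s\<bar> \<le> 2 ^ (asize a * L) * 2 ^ (asize b * L)" by (intro mult_mono) auto
    then show ?case by (simp add: abs_mult add_mult_distrib power_add)
  next
    case (Div a b)
    then show ?case using add[of a b] abs_div_le[of "aval a s" "aval b s"] by simp
  next
    case (Mod a b)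
    then show ?case using add[of a b] abs_mod_le[of "aval a s" "aval b s"] by simp
  qed
qed

lemma acost_bound:
  assumes s: "bounded_cells L s"
  shows "acost a s \<le> acoef a * L"
proof -
  have size: "int_size (aval a s) \<le> (asize a + 2) * L" for a
  proof -
    have "int_size (aval a s) \<le> asize a * L + 2" by (rule int_size_le[OF aval_bound[OF s]])
    also have "\<dots> \<le> (asize a + 2) * L" using L1 by (simp add: add_mult_distrib)
    finally show ?thesis .
  qed
  show ?thesis
  proof (induction a)
    case (Num k)
    show ?case using L1 by simp
  next
    case (Read x a)
    then show ?case using size[of "Read x a"] by (simp add: add_mult_distrib)
  next
    case (Plus a b)
    then show ?case using size[of "Plus a b"] by (simp add: add_mult_distrib)
  next
    case (Minus a b)
    then show ?case using size[of "Minus a b"] by (simp add: add_mult_distrib)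
  next
    case (Times a b)
    then show ?case using size[of "Times a b"] by (simp add: add_mult_distrib)
  next
    case (Div a b)
    then show ?case using size[of "Div a b"] by (simp add: add_mult_distrib)
  next
    case (Mod a b)
    then show ?case using size[of "Mod a b"] by (simp add: add_mult_distrib)
  qed
qed

lemma bcost_bound:
  assumes s: "bounded_cells L s"
  shows "bcost b s \<le> bcoef b * L"
proof (induction b)
  case (Less a b)
  then show ?case using acost_bound[OF s, of a] acost_bound[OF s, of b] L1 by (simp add: add_mult_distrib)
next
  case (Equal a b)
  then show ?case using acost_bound[OF s, of a] acost_bound[OF s, of b] L1 by (simp add: add_mult_distrib)
qed (use L1 in \<open>auto simp: add_mult_distrib\<close>)

text \<open>\<open>spec c s p Q t\<close>: started in \<open>s\<close>, the program \<open>c\<close> is coupled to the abstract computation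
  \<open>p\<close> through the postcondition \<open>Q\<close>, in at most \<open>t\<close> elementary steps of cost at most \<open>K * L\<close>.\<close>

definition spec :: "com \<Rightarrow> state \<Rightarrow> 'b pmf \<Rightarrow> ('b \<Rightarrow> state \<Rightarrow> bool) \<Rightarrow> nat \<Rightarrow> bool" where
  "spec c s p Q t \<longleftrightarrow> (ccoef c \<le> K \<longrightarrow> bounded_cells L s \<longrightarrow>
     rel_spmf (\<lambda>(s', u) b. Q b s' \<and> bounded_cells L s' \<and> agree_except (writes c) s s' \<and> u \<le> t * (K * L))
       (exec c s) (spmf_of_pmf p))"

lemma spec_weaken:
  assumes "spec c s p Q t" "t \<le> t'"
    and "\<And>b s'. b \<in> set_pmf p \<Longrightarrow> Q b s' \<Longrightarrow> agree_except (writes c) s s' \<Longrightarrow> Q' b s'"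
  shows "spec c s p Q' t'"
  unfolding spec_def
proof (intro impI)
  assume "ccoef c \<le> K" "bounded_cells L s"
  with assms(1) have "rel_spmf (\<lambda>(s', u) b. Q b s' \<and> bounded_cells L s' \<and> agree_except (writes c) s s' \<and> u \<le> t * (K * L))
       (exec c s) (spmf_of_pmf p)" by (simp add: spec_def)
  then show "rel_spmf (\<lambda>(s', u) b. Q' b s' \<and> bounded_cells L s' \<and> agree_except (writes c) s s' \<and> u \<le> t' * (K * L))
       (exec c s) (spmf_of_pmf p)"
    by (rule rel_spmf_mono_strong)
      (use assms(2,3) in \<open>auto elim: order_trans intro!: mult_le_mono1\<close>)
qed

lemma spec_map:
  assumes "spec c s p (\<lambda>b. Q (f b)) t"
  shows "spec c s (map_pmf f p) Q t"
  using assms unfolding spec_def by (simp add: spmf_rel_map split_def flip: map_spmf_of_pmf)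

lemma spec_skip: "Q b s \<Longrightarrow> spec Skip s (return_pmf b) Q 1"
  using L1 by (auto simp: spec_def Suc_le_eq)

lemma store_frame: "agree_except {x} s (store x i v s)"
  by (simp add: agree_except_def store_def)

lemma store_bounded: "bounded_cells L s \<Longrightarrow> \<bar>v\<bar> \<le> 2 ^ L \<Longrightarrow> bounded_cells L (store x i v s)"
  by (simp add: bounded_cells_def store_def)

lemma unit_cost: "n \<le> k * L \<Longrightarrow> k \<le> K \<Longrightarrow> n \<le> 1 * (K * L)"
  by (metis mult_le_mono1 order_trans mult_1)

lemma spec_assign:
  assumes "\<bar>aval a s\<bar> \<le> 2 ^ L" "Q b (store x (aval i s) (aval a s) s)"
  shows "spec (Assign x i a) s (return_pmf b) Q 1"
  unfolding spec_def
proof (intro impI)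
  assume K: "ccoef (Assign x i a) \<le> K" and s: "bounded_cells L s"
  have "1 + acost i s + acost a s \<le> ccoef (Assign x i a) * L"
    using acost_bound[OF s, of i] acost_bound[OF s, of a] L1 by (simp add: add_mult_distrib)
  from unit_cost[OF this K] show "rel_spmf (\<lambda>(s', u) b. Q b s' \<and> bounded_cells L s' \<and>
      agree_except (writes (Assign x i a)) s s' \<and> u \<le> 1 * (K * L))
       (exec (Assign x i a) s) (spmf_of_pmf (return_pmf b))"
    using assms s by (simp add: store_frame store_bounded)
qed

lemma spec_flip:
  assumes "\<And>b. Q b (store x (aval i s) (of_bool b) s)"
  shows "spec (Flip x i) s (pmf_of_set UNIV) Q 1"
  unfolding spec_def
proof (intro impI)
  assume K: "ccoef (Flip x i) \<le> K" and s: "bounded_cells L s"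
  have "1 + acost i s \<le> ccoef (Flip x i) * L"
    using acost_bound[OF s, of i] L1 by (simp add: add_mult_distrib)
  note cost = unit_cost[OF this K]
  have "rel_spmf (\<lambda>(s', u) b. Q b s' \<and> bounded_cells L s' \<and>
      agree_except (writes (Flip x i)) s s' \<and> u \<le> 1 * (K * L))
       (bind_spmf coin_spmf (\<lambda>b. return_spmf (store x (aval i s) (of_bool b) s, 1 + acost i s)))
       (bind_spmf coin_spmf return_spmf)"
    by (rule rel_spmf_bind_reflI) (use assms s cost in \<open>auto simp: store_frame intro!: store_bounded\<close>)
  then show "rel_spmf (\<lambda>(s', u) b. Q b s' \<and> bounded_cells L s' \<and>
      agree_except (writes (Flip x i)) s s' \<and> u \<le> 1 * (K * L))
       (exec (Flip x i) s) (spmf_of_pmf (pmf_of_set UNIV))"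
    by (simp add: spmf_of_pmf_pmf_of_set)
qed

lemma spec_seq:
  assumes 1: "spec c1 s p R t1"
    and 2: "\<And>b s'. b \<in> set_pmf p \<Longrightarrow> R b s' \<Longrightarrow> agree_except (writes c1) s s' \<Longrightarrow> spec c2 s' (f b) Q t2"
  shows "spec (Seq c1 c2) s (bind_pmf p f) Q (t1 + t2)"
  unfolding spec_def
proof (intro impI)
  assume K: "ccoef (Seq c1 c2) \<le> K" and s: "bounded_cells L s"
  let ?Q = "\<lambda>(s', u) b. Q b s' \<and> bounded_cells L s' \<and> agree_except (writes (Seq c1 c2)) s s' \<and> u \<le> (t1 + t2) * (K * L)"
  have r1: "rel_spmf (\<lambda>(s', u) b. b \<in> set_pmf p \<and> R b s' \<and> bounded_cells L s' \<and> agree_except (writes c1) s s' \<and> u \<le> t1 * (K * L))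
     (exec c1 s) (spmf_of_pmf p)"
    by (rule rel_spmf_mono_strong[where A = "\<lambda>(s', u) b. R b s' \<and> bounded_cells L s' \<and> agree_except (writes c1) s s' \<and> u \<le> t1 * (K * L)"])
      (use 1 K s in \<open>auto simp: spec_def\<close>)
  have r2: "rel_spmf ?Q (bind_spmf (exec c2 s1) (\<lambda>(s2, u2). return_spmf (s2, u1 + u2))) (spmf_of_pmf (f b))"
    if "b \<in> set_pmf p" "R b s1" "bounded_cells L s1" "agree_except (writes c1) s s1" "u1 \<le> t1 * (K * L)" for s1 u1 b
  proof -
    have "rel_spmf (\<lambda>(s', u) b. Q b s' \<and> bounded_cells L s' \<and> agree_except (writes c2) s1 s' \<and> u \<le> t2 * (K * L))
      (exec c2 s1) (spmf_of_pmf (f b))"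
      using 2[of b s1] that K by (simp add: spec_def)
    then have "rel_spmf ?Q (bind_spmf (exec c2 s1) (\<lambda>(s2, u2). return_spmf (s2, u1 + u2))) (bind_spmf (spmf_of_pmf (f b)) return_spmf)"
      by (rule rel_spmf_bindI) (use that in \<open>auto simp: add_mult_distrib intro: agree_except_trans\<close>)
    then show ?thesis by (simp only: bind_return_spmf return_bind_spmf)
  qed
  have "rel_spmf ?Q (exec (Seq c1 c2) s) (bind_spmf (spmf_of_pmf p) (\<lambda>b. spmf_of_pmf (f b)))"
    unfolding exec.simps by (rule rel_spmf_bindI[OF r1]) (use r2 in auto)
  then show "rel_spmf ?Q (exec (Seq c1 c2) s) (spmf_of_pmf (bind_pmf p f))"
    by (simp only: spmf_of_pmf_bind bind_spmf_of_pmf)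
qed

lemma spec_seq_det:
  assumes "spec c1 s (return_pmf b) R t1"
    and "\<And>s'. R b s' \<Longrightarrow> agree_except (writes c1) s s' \<Longrightarrow> spec c2 s' p Q t2"
  shows "spec (Seq c1 c2) s p Q (t1 + t2)"
  using spec_seq[OF assms(1), of c2 "\<lambda>_. p" Q t2] assms(2) by (simp add: bind_return_pmf)

lemma spec_assign_seq:
  assumes "\<bar>aval a s\<bar> \<le> 2 ^ L" "spec c (store x (aval i s) (aval a s) s) p Q t"
  shows "spec (Seq (Assign x i a) c) s p Q (1 + t)"
  by (rule spec_seq_det[OF spec_assign[where Q = "\<lambda>_ s'. s' = store x (aval i s) (aval a s) s"]])
    (use assms in auto)

lemma spec_cond:
  assumes "bval b s \<Longrightarrow> spec c1 s p Q t" "\<not> bval b s \<Longrightarrow> spec c2 s p Q t"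
  shows "spec (Cond b c1 c2) s p Q (t + 1)"
  unfolding spec_def
proof (intro impI)
  assume K: "ccoef (Cond b c1 c2) \<le> K" and s: "bounded_cells L s"
  have "1 + bcost b s \<le> (1 + bcoef b) * L" using bcost_bound[OF s, of b] L1 by simp
  also have "\<dots> \<le> K * L" using K by (intro mult_le_mono1) simp
  finally have cost: "1 + bcost b s \<le> K * L" .
  let ?c = "if bval b s then c1 else c2"
  have "rel_spmf (\<lambda>(s', u) a. Q a s' \<and> bounded_cells L s' \<and> agree_except (writes ?c) s s' \<and> u \<le> t * (K * L))
     (if bval b s then exec c1 s else exec c2 s) (spmf_of_pmf p)"
    using assms K s by (auto simp: spec_def)
  then have "rel_spmf (\<lambda>(s', u) a. Q a s' \<and> bounded_cells L s' \<and> agree_except (writes (Cond b c1 c2)) s s' \<and> u \<le> (t + 1) * (K * L))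
     (exec (Cond b c1 c2) s) (bind_spmf (spmf_of_pmf p) return_spmf)"
    unfolding exec.simps by (rule rel_spmf_bindI)
      (use cost in \<open>auto simp: add_mult_distrib agree_except_def split: if_splits\<close>)
  then show "rel_spmf (\<lambda>(s', u) a. Q a s' \<and> bounded_cells L s' \<and> agree_except (writes (Cond b c1 c2)) s s' \<and> u \<le> (t + 1) * (K * L))
     (exec (Cond b c1 c2) s) (spmf_of_pmf p)" by (simp only: bind_return_spmf return_bind_spmf)
qed

text \<open>The invariant makes the test agree with the counter, so the loop runs exactly
  \<open>n\<close> rounds and cannot diverge. Each round pays for its body and one test; the final
  \<open>+ 1\<close> is the failing test.\<close>

lemma spec_while:
  assumes test: "\<And>k b s'. k \<le> n \<Longrightarrow> I k b s' \<Longrightarrow> agree_except (writes c) s s' \<Longrightarrow> bval e s' \<longleftrightarrow> k < n"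
    and body: "\<And>k b s'. k < n \<Longrightarrow> I k b s' \<Longrightarrow> agree_except (writes c) s s' \<Longrightarrow> spec c s' (f k b) (I (Suc k)) t"
    and init: "I 0 b s"
  shows "spec (While e c) s (iter_pmf f 0 n b) (I n) (n * (t + 1) + 1)"
  unfolding spec_def
proof (intro impI)
  assume K: "ccoef (While e c) \<le> K" and s: "bounded_cells L s"
  let ?Q = "\<lambda>r. \<lambda>(s', u) b. I n b s' \<and> bounded_cells L s' \<and> agree_except (writes c) s s' \<and> u \<le> (r * (t + 1) + 1) * (K * L)"
  have cost: "1 + bcost e s' \<le> K * L" if "bounded_cells L s'" for s'
  proof -
    have "1 + bcost e s' \<le> (1 + bcoef e) * L" using bcost_bound[OF that, of e] L1 by simp
    also have "\<dots> \<le> K * L" using K by (intro mult_le_mono1) simp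
    finally show ?thesis .
  qed
  have "rel_spmf (?Q r) (exec (While e c) s1) (spmf_of_pmf (iter_pmf f k r b))"
    if "k + r = n" "I k b s1" "bounded_cells L s1" "agree_except (writes c) s s1" for k r b s1
    using that
  proof (induction r arbitrary: k b s1)
    case 0
    then have "\<not> bval e s1" using test[of k b s1] by simp
    then have "exec (While e c) s1 = return_spmf (s1, 1 + bcost e s1)"
      by (simp add: while_loop.simps)
    then show ?case using 0 cost[of s1] by simp
  next
    case (Suc r)
    then have "bval e s1" using test[of k b s1] by simp
    then have un: "exec (While e c) s1 = bind_spmf (exec c s1) (\<lambda>(s2, t1).
        bind_spmf (exec (While e c) s2) (\<lambda>(s3, t2). return_spmf (s3, 1 + bcost e s1 + t1 + t2)))"
      by (simp add: while_loop.simps[of "bval e" "bcost e" "exec c" s1])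
    have r1: "rel_spmf (\<lambda>(s', u) b. I (Suc k) b s' \<and> bounded_cells L s' \<and> agree_except (writes c) s1 s' \<and> u \<le> t * (K * L))
       (exec c s1) (spmf_of_pmf (f k b))"
      using body[of k b s1] Suc.prems K by (simp add: spec_def)
    have r2: "rel_spmf (?Q (Suc r))
        (bind_spmf (exec (While e c) s2) (\<lambda>(s3, t2). return_spmf (s3, 1 + bcost e s1 + t1 + t2)))
        (spmf_of_pmf (iter_pmf f (Suc k) r b'))"
      if "I (Suc k) b' s2" "bounded_cells L s2" "agree_except (writes c) s1 s2" "t1 \<le> t * (K * L)" for s2 t1 b'
    proof -
      have "rel_spmf (?Q r) (exec (While e c) s2) (spmf_of_pmf (iter_pmf f (Suc k) r b'))"
        using Suc.prems that by (intro Suc.IH) (auto intro: agree_except_trans)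
      then have "rel_spmf (?Q (Suc r))
        (bind_spmf (exec (While e c) s2) (\<lambda>(s3, t2). return_spmf (s3, 1 + bcost e s1 + t1 + t2)))
        (bind_spmf (spmf_of_pmf (iter_pmf f (Suc k) r b')) return_spmf)"
        by (rule rel_spmf_bindI)
          (use that cost[OF Suc.prems(3)] in \<open>auto simp: add_mult_distrib add_mult_distrib2\<close>)
      then show ?thesis by (simp only: bind_return_spmf return_bind_spmf)
    qed
    have "rel_spmf (?Q (Suc r)) (exec (While e c) s1) (bind_spmf (spmf_of_pmf (f k b)) (\<lambda>b'. spmf_of_pmf (iter_pmf f (Suc k) r b')))"
      unfolding un by (rule rel_spmf_bindI[OF r1]) (use r2 in auto)
    then show ?case by (simp only: iter_pmf.simps spmf_of_pmf_bind bind_spmf_of_pmf)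
  qed
  from this[of 0 n b s] show "rel_spmf (\<lambda>(s', u) b. I n b s' \<and> bounded_cells L s' \<and>
      agree_except (writes (While e c)) s s' \<and> u \<le> (n * (t + 1) + 1) * (K * L))
     (exec (While e c) s) (spmf_of_pmf (iter_pmf f 0 n b))"
    using init s by simp
qed

lemma iter_pmf_det: "iter_pmf (\<lambda>_ _. return_pmf ()) k n b = return_pmf ()"
  by (induction n arbitrary: k b) (simp_all add: bind_return_pmf)

lemma spec_while_det:
  assumes "\<And>k s'. k \<le> n \<Longrightarrow> I k s' \<Longrightarrow> agree_except (writes c) s s' \<Longrightarrow> bval e s' \<longleftrightarrow> k < n"
    and "\<And>k s'. k < n \<Longrightarrow> I k s' \<Longrightarrow> agree_except (writes c) s s' \<Longrightarrow> spec c s' (return_pmf ()) (\<lambda>_. I (Suc k)) t"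
    and "I 0 s"
  shows "spec (While e c) s (return_pmf ()) (\<lambda>_. I n) (n * (t + 1) + 1)"
proof -
  have "spec (While e c) s (iter_pmf (\<lambda>_ _. return_pmf ()) 0 n ()) (\<lambda>_. I n) (n * (t + 1) + 1)"
    by (rule spec_while[of n "\<lambda>k _. I k"]) (use assms in blast)+
  then show ?thesis by (simp only: iter_pmf_det)
qed

end

section \<open>The machine program\<close>

abbreviation V :: "vname \<Rightarrow> aexp" where "V x \<equiv> Read x (Num 0)"

abbreviation put :: "vname \<Rightarrow> aexp \<Rightarrow> com" (infix "::=" 61) where "x ::= a \<equiv> Assign x (Num 0) a"

abbreviation seq :: "com \<Rightarrow> com \<Rightarrow> com" (infixr ";;" 60) where "c ;; d \<equiv> Seq c d"

text \<open>The cell \<open>c\<close> doubles until it reaches \<open>Q\<close>, so the number of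
  coins is the least \<open>k\<close> with \<open>Q \<le> 2 ^ k\<close> and need not be
  stored.\<close>

definition draw_cmd :: "vname \<Rightarrow> com" where
  "draw_cmd x =
     ''u'' ::= Num 0 ;;
     ''c'' ::= Num 1 ;;
     While (Less (V ''c'') (V ''Q''))
       (Flip ''d'' (Num 0) ;;
        ''u'' ::= Plus (Times (Num 2) (V ''u'')) (V ''d'') ;;
        ''c'' ::= Times (Num 2) (V ''c'')) ;;
     x ::= V ''u''"

definition toggle :: "vname \<Rightarrow> com" where
  "toggle y = Assign ''x'' (V y) (Minus (Num 1) (Read ''x'' (V y)))"

definition pat_exp :: "aexp \<Rightarrow> aexp" where
  "pat_exp j = Plus (Read ''x'' (Times (Num 2) j)) (Read ''x'' (Plus (Times (Num 2) j) (Num 1)))"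

text \<open>Cells 0 to 3 of the input hold the fraction \<epsilon> and the numbers of vertices and
  edges; then come \<open>n\<close> vertices, and after them the endpoints in the order of the
  half-edges.\<close>

definition end_exp :: "vname \<Rightarrow> aexp" where
  "end_exp y = Read ''in'' (Plus (Plus (Num 4) (V ''n'')) (V y))"

definition pair_test :: bexp where
  "pair_test =
     Conj (Less (V ''h'') (Times (Num 2) (V ''m''))) (Conj (Less (V ''g'') (Times (Num 2) (V ''m'')))
       (Conj (Neg (Equal (V ''h'') (V ''g''))) (Equal (end_exp ''h'') (end_exp ''g''))))"

definition loc_cmd :: com where
  "loc_cmd =
     ''l'' ::= Num 1 ;;
     Cond (Less (Div (V ''h'') (Num 2)) (V ''i''))
       (''l'' ::= Read ''w'' (pat_exp (Div (V ''h'') (Num 2)))) Skip ;;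
     Cond (Conj (Less (Div (V ''g'') (Num 2)) (V ''i''))
         (Neg (Equal (Div (V ''g'') (Num 2)) (Div (V ''h'') (Num 2)))))
       (''l'' ::= Times (V ''l'') (Read ''w'' (pat_exp (Div (V ''g'') (Num 2))))) Skip"

text \<open>Acceptance depends on the new state, so the flip is carried out first and undone on
  rejection.\<close>

definition move_cmd :: com where
  "move_cmd =
     Cond pair_test
       (toggle ''h'' ;; toggle ''g'' ;; loc_cmd ;;
        Cond (Less (V ''r'') (V ''l'')) Skip (toggle ''h'' ;; toggle ''g''))
       Skip"

definition step_cmd :: com where
  "step_cmd = draw_cmd ''h'' ;; draw_cmd ''g'' ;; draw_cmd ''r'' ;; move_cmd"

definition walk_cmd :: com where
  "walk_cmd =
     ''t'' ::= Num 0 ;;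
     While (Less (V ''t'') (V ''T'')) (step_cmd ;; ''t'' ::= Plus (V ''t'') (Num 1))"

text \<open>The weight of edge \<open>i\<close> is \<open>W (Suc i) / W i\<close>, so its mean is a
  ratio of consecutive partition sums. The last stage measures whether no substitute weight is in
  use.\<close>

definition meas_cmd :: com where
  "meas_cmd =
     Cond (Less (V ''i'') (V ''m''))
       (''f'' ::= Read ''w'' (pat_exp (V ''i'')))
       (''f'' ::= Num 1 ;;
        ''j'' ::= Num 0 ;;
        While (Less (V ''j'') (V ''m''))
          (''f'' ::= Times (V ''f'') (Read ''nb'' (pat_exp (V ''j''))) ;;
           ''j'' ::= Plus (V ''j'') (Num 1)))"

definition sample_cmd :: com where
  "sample_cmd = walk_cmd ;; meas_cmd ;; ''S'' ::= Plus (V ''S'') (V ''f'')"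

definition stage_cmd :: com where
  "stage_cmd =
     ''S'' ::= Num 0 ;;
     ''b'' ::= Num 0 ;;
     While (Less (V ''b'') (V ''N'')) (sample_cmd ;; ''b'' ::= Plus (V ''b'') (Num 1)) ;;
     ''p'' ::= Times (V ''p'') (V ''S'') ;;
     ''q'' ::= Times (V ''q'') (V ''N'')"

definition stages_cmd :: com where
  "stages_cmd =
     ''i'' ::= Num 0 ;;
     While (Less (V ''i'') (Plus (V ''m'') (Num 1))) (stage_cmd ;; ''i'' ::= Plus (V ''i'') (Num 1))"

lemma writes_cmds [simp]:
  "writes (draw_cmd x) = {''u'', ''c'', ''d'', x}"
  "writes (toggle y) = {''x''}"
  "writes loc_cmd = {''l''}"
  "writes move_cmd = {''x'', ''l''}"
  "writes step_cmd = {''u'', ''c'', ''d'', ''h'', ''g'', ''r'', ''x'', ''l''}"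
  "writes walk_cmd = {''u'', ''c'', ''d'', ''h'', ''g'', ''r'', ''x'', ''l'', ''t''}"
  "writes meas_cmd = {''f'', ''j''}"
  "writes sample_cmd = {''u'', ''c'', ''d'', ''h'', ''g'', ''r'', ''x'', ''l'', ''t'', ''f'', ''j'', ''S''}"
  "writes stage_cmd = {''u'', ''c'', ''d'', ''h'', ''g'', ''r'', ''x'', ''l'', ''t'', ''f'', ''j'', ''S'', ''b'', ''p'', ''q''}"
  unfolding draw_cmd_def toggle_def loc_cmd_def move_cmd_def step_cmd_def walk_cmd_def meas_cmd_def
    sample_cmd_def stage_cmd_def by auto

lemma agreeD: "agree_except M s s' \<Longrightarrow> y \<notin> M \<Longrightarrow> s' y = s y"
  by (simp add: agree_except_def)

lemma store_same [simp]: "store x i v s x i = v"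
  by (simp add: store_def)

lemma store_other [simp]: "y \<noteq> x \<Longrightarrow> store x i v s y = s y"
  by (simp add: store_def)

context cost_model
begin

lemma spec_seq_after:
  assumes "spec c1 s p R t1"
    and "\<And>b s'. b \<in> set_pmf p \<Longrightarrow> R b s' \<Longrightarrow> agree_except (writes c1) s s' \<Longrightarrow> spec c2 s' (return_pmf b) Q t2"
  shows "spec (Seq c1 c2) s p Q (t1 + t2)"
  using spec_seq[OF assms(1), of c2 return_pmf Q t2] assms(2) by (simp add: bind_return_pmf')

end

text \<open>\<open>Qk\<close> says that the doubling loop of \<open>draw_cmd\<close> takes exactly
  \<open>k\<close> rounds; the bounds by \<open>2 ^ L\<close> cover the counters, the sums and the
  growing numerator and denominator.\<close>

locale machine = sampler m vt w B k T N J meas + cost_model K L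
  for m :: nat and vt :: "nat \<Rightarrow> nat" and w B k T N J meas K L +
  fixes n Q :: nat and nb :: "nat \<Rightarrow> nat" and p0 :: int and q0 :: nat
  assumes Qk: "Q \<le> 2 ^ k" "\<And>j. j < k \<Longrightarrow> 2 ^ j < Q"
    and kL: "k \<le> L" and TL: "T \<le> 2 ^ L" and NL: "N \<le> 2 ^ L" and mL: "m + 1 \<le> 2 ^ L"
    and SL: "N * B \<le> 2 ^ L"
    and pL: "nat \<bar>p0\<bar> * (N * B) ^ (m + 1) \<le> 2 ^ L" and qL: "q0 * N ^ (m + 1) \<le> 2 ^ L"
    and meas_eq: "\<And>i X. meas i X = (if i < m then w (pat X i) else \<Prod>j<m. nb (pat X j))"
    and nb_le: "\<And>p. nb p \<le> 1"
begin

section \<open>Correctness of the sampling commands\<close>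

definition env :: "state \<Rightarrow> bool" where
  "env s \<longleftrightarrow> s ''n'' 0 = int n \<and> s ''m'' 0 = int m \<and> s ''Q'' 0 = int Q \<and> s ''N'' 0 = int N \<and>
     s ''T'' 0 = int T \<and> (\<forall>p\<le>2. s ''w'' (int p) = int (w p)) \<and> (\<forall>p\<le>2. s ''nb'' (int p) = int (nb p)) \<and>
     (\<forall>h<2 * m. s ''in'' (4 + int n + int h) = int (vt h))"

lemma env_frame:
  "env s \<Longrightarrow> agree_except M s s' \<Longrightarrow> M \<inter> {''n'', ''m'', ''Q'', ''N'', ''T'', ''w'', ''nb'', ''in''} = {} \<Longrightarrow> env s'"
  by (auto simp: env_def agree_except_def)

lemma env_store [simp]:
  "x \<notin> {''n'', ''m'', ''Q'', ''N'', ''T'', ''w'', ''nb'', ''in''} \<Longrightarrow> env (store x i v s) = env s"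
  by (auto simp: env_def)

definition xrep :: "nat set \<Rightarrow> state \<Rightarrow> bool" where
  "xrep X s \<longleftrightarrow> (\<forall>h. s ''x'' (int h) = of_bool (h \<in> X))"

lemma xrep_store [simp]: "x \<noteq> ''x'' \<Longrightarrow> xrep X (store x i v s) = xrep X s"
  by (simp add: xrep_def)

lemma xrep_frame: "xrep X s \<Longrightarrow> agree_except M s s' \<Longrightarrow> ''x'' \<notin> M \<Longrightarrow> xrep X s'"
  by (simp add: xrep_def agree_except_def)

lemma nat_bound: "v \<le> (2 :: nat) ^ l \<Longrightarrow> l \<le> L \<Longrightarrow> \<bar>int v\<bar> \<le> 2 ^ L"
proof -
  assume "v \<le> 2 ^ l" "l \<le> L"
  then have "v \<le> 2 ^ L" using power_increasing[of l L "2 :: nat"] by linarith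
  then have "int v \<le> int (2 ^ L)" by (rule of_nat_mono)
  then show ?thesis by simp
qed

lemma draw_spec:
  assumes s: "env s" and x: "x \<notin> {''n'', ''m'', ''Q'', ''N'', ''T'', ''w'', ''nb'', ''in''}"
  shows "spec (draw_cmd x) s (draw k) (\<lambda>v s'. s' x 0 = int v) (4 * k + 4)"
proof -
  let ?s = "store ''c'' 0 1 (store ''u'' 0 0 s)"
  let ?body = "Flip ''d'' (Num 0) ;; ''u'' ::= Plus (Times (Num 2) (V ''u'')) (V ''d'') ;; ''c'' ::= Times (Num 2) (V ''c'')"
  let ?f = "\<lambda>_ u. map_pmf (\<lambda>c. 2 * u + of_bool c) (pmf_of_set (UNIV :: bool set))"
  define I where "I j u s' \<longleftrightarrow> s' ''c'' 0 = 2 ^ j \<and> s' ''u'' 0 = int u \<and> u < 2 ^ j" for j u and s' :: state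
  have loop: "spec (While (Less (V ''c'') (V ''Q'')) ?body) ?s (iter_pmf ?f 0 k 0) (I k) (k * (3 + 1) + 1)"
  proof (rule spec_while)
    show "I 0 0 ?s" by (simp add: I_def)
    fix j u s' assume j: "j \<le> k" and I: "I j u s'" and fr: "agree_except (writes ?body) ?s s'"
    have Q: "s' ''Q'' 0 = int Q" using env_frame[OF _ fr] s by (simp add: env_def)
    have "int Q \<le> 2 ^ k" using Qk(1) by (metis of_nat_le_iff of_nat_numeral of_nat_power)
    moreover have "(2 :: int) ^ j < int Q" if "j < k"
      using Qk(2)[OF that] by (metis of_nat_less_iff of_nat_numeral of_nat_power)
    ultimately show "bval (Less (V ''c'') (V ''Q'')) s' \<longleftrightarrow> j < k"
      using I j Q by (cases "j = k") (auto simp: I_def)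
  next
    fix j u s' assume j: "j < k" and I: "I j u s'"
    have e: "?f j u = bind_pmf (pmf_of_set UNIV) (\<lambda>c. return_pmf (2 * u + of_bool c))" by (simp add: map_pmf_def)
    have b: "\<bar>int (2 * u + of_bool c)\<bar> \<le> 2 ^ L" "\<bar>int (2 * 2 ^ j)\<bar> \<le> 2 ^ L" for c
      using I j kL by (intro nat_bound[of _ "Suc j"]; auto simp: I_def)+
    have "spec ?body s' (bind_pmf (pmf_of_set UNIV) (\<lambda>c. return_pmf (2 * u + of_bool c))) (I (Suc j)) (1 + (1 + 1))"
    proof (rule spec_seq[OF spec_flip[where Q = "\<lambda>c s''. s'' = store ''d'' 0 (of_bool c) s'"]])
      fix c s'' assume s'': "s'' = store ''d'' 0 (of_bool c) s'"
      show "spec (''u'' ::= Plus (Times (Num 2) (V ''u'')) (V ''d'') ;; ''c'' ::= Times (Num 2) (V ''c'')) s''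
          (return_pmf (2 * u + of_bool c)) (I (Suc j)) (1 + 1)"
        by (rule spec_assign_seq, use I b(1)[of c] s'' in \<open>simp add: I_def\<close>, rule spec_assign)
          (use I b s'' in \<open>auto simp: I_def\<close>)
    qed simp
    then show "spec ?body s' (?f j u) (I (Suc j)) 3" unfolding e by (rule spec_weaken) auto
  qed
  have "spec (While (Less (V ''c'') (V ''Q'')) ?body ;; x ::= V ''u'') ?s (iter_pmf ?f 0 k 0)
     (\<lambda>v s'. s' x 0 = int v) (k * (3 + 1) + 1 + 1)"
  proof (rule spec_seq_after[OF loop])
    fix u s' assume "I k u s'"
    then show "spec (x ::= V ''u'') s' (return_pmf u) (\<lambda>v s'. s' x 0 = int v) 1"
      using nat_bound[of u k] kL by (intro spec_assign) (auto simp: I_def)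
  qed
  then have "spec (draw_cmd x) s (iter_pmf ?f 0 k 0) (\<lambda>v s'. s' x 0 = int v) (1 + (1 + (k * (3 + 1) + 1 + 1)))"
    unfolding draw_cmd_def by (intro spec_assign_seq) auto
  then show ?thesis unfolding draw_def by (rule spec_weaken) auto
qed

lemma toggle_spec:
  assumes "xrep X s" "s y 0 = int h" "y \<noteq> ''x''"
  shows "spec (toggle y) s (return_pmf ()) (\<lambda>_. xrep (X \<triangle> {h})) 1"
  unfolding toggle_def
  by (rule spec_assign) (use assms in \<open>auto simp: xrep_def store_def of_bool_def\<close>)

lemma toggle2_spec:
  assumes "xrep X s" "s ''h'' 0 = int h" "s ''g'' 0 = int g" "h \<noteq> g"
  shows "spec (toggle ''h'' ;; toggle ''g'') s (return_pmf ()) (\<lambda>_. xrep (X \<triangle> {h, g})) 2"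
proof -
  have e: "X \<triangle> {h} \<triangle> {g} = X \<triangle> {h, g}" using assms(4) by auto
  have "spec (toggle ''h'' ;; toggle ''g'') s (return_pmf ()) (\<lambda>_. xrep (X \<triangle> {h} \<triangle> {g})) (1 + 1)"
  proof (rule spec_seq_det[OF toggle_spec[OF assms(1,2)]])
    fix s' assume "xrep (X \<triangle> {h}) s'" "agree_except (writes (toggle ''h'')) s s'"
    then show "spec (toggle ''g'') s' (return_pmf ()) (\<lambda>_. xrep (X \<triangle> {h} \<triangle> {g})) 1"
      using assms(3) by (intro toggle_spec) (auto simp: agreeD)
  qed simp
  then show ?thesis unfolding e by (simp add: numeral_2_eq_2)
qed

lemma aval_pat_exp: "xrep X s \<Longrightarrow> aval e s = int j \<Longrightarrow> aval (pat_exp e) s = int (pat X j)"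
proof -
  assume X: "xrep X s" and e: "aval e s = int j"
  have "s ''x'' (int (2 * j)) = of_bool (2 * j \<in> X)" "s ''x'' (int (2 * j + 1)) = of_bool (2 * j + 1 \<in> X)"
    using X by (simp_all only: xrep_def)
  then show ?thesis by (simp add: pat_exp_def e pat_def add.commute)
qed

lemma aval_w: "env s \<Longrightarrow> xrep X s \<Longrightarrow> aval e s = int j \<Longrightarrow> aval (Read ''w'' (pat_exp e)) s = int (w (pat X j))"
  by (simp add: aval_pat_exp env_def pat_le_2)

lemma aval_nb: "env s \<Longrightarrow> xrep X s \<Longrightarrow> aval e s = int j \<Longrightarrow> aval (Read ''nb'' (pat_exp e)) s = int (nb (pat X j))"
  by (simp add: aval_pat_exp env_def pat_le_2)

lemma B2L: "B ^ 2 \<le> 2 ^ k" "B \<le> 2 ^ k"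
proof -
  show 1: "B ^ 2 \<le> 2 ^ k" using bits(1) by linarith
  then show "B \<le> 2 ^ k" by (metis le_square order_trans power2_eq_square)
qed

lemma loc_spec:
  assumes s: "env s" "xrep X s" "s ''h'' 0 = int h" "s ''g'' 0 = int g" "s ''i'' 0 = int i"
  shows "spec loc_cmd s (return_pmf ()) (\<lambda>_ s'. s' ''l'' 0 = int (loc i h g X)) 5"
proof -
  let ?a = "if h div 2 < i then w (pat X (h div 2)) else 1"
  let ?s = "store ''l'' 0 1 s"
  have d: "int h div 2 = int (h div 2)" "int g div 2 = int (g div 2)" by (simp_all add: zdiv_int)
  have wh: "\<bar>int (w (pat X j))\<bar> \<le> 2 ^ L" for j
    using w_le[of "pat X j"] B2L kL by (intro nat_bound[of _ k]) linarith+
  have lb: "\<bar>int (loc i h g X)\<bar> \<le> 2 ^ L"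
    using loc_bounds(2)[of i h g X] B2L kL by (intro nat_bound[of _ k]) linarith+
  have 1: "spec (Cond (Less (Div (V ''h'') (Num 2)) (V ''i'')) (''l'' ::= Read ''w'' (pat_exp (Div (V ''h'') (Num 2)))) Skip)
     ?s (return_pmf ()) (\<lambda>_ s'. s' ''l'' 0 = int ?a) (1 + 1)"
  proof (rule spec_cond)
    have "aval (Read ''w'' (pat_exp (Div (V ''h'') (Num 2)))) ?s = int (w (pat X (h div 2)))"
      by (rule aval_w) (use s d in auto)
    then show "spec (''l'' ::= Read ''w'' (pat_exp (Div (V ''h'') (Num 2)))) ?s (return_pmf ())
        (\<lambda>_ s'. s' ''l'' 0 = int ?a) 1" if "bval (Less (Div (V ''h'') (Num 2)) (V ''i'')) ?s"
      using that s d wh by (intro spec_assign) auto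
    show "spec Skip ?s (return_pmf ()) (\<lambda>_ s'. s' ''l'' 0 = int ?a) 1"
      if "\<not> bval (Less (Div (V ''h'') (Num 2)) (V ''i'')) ?s"
      using that s d by (intro spec_skip) auto
  qed
  have 2: "spec (Cond (Conj (Less (Div (V ''g'') (Num 2)) (V ''i''))
         (Neg (Equal (Div (V ''g'') (Num 2)) (Div (V ''h'') (Num 2)))))
       (''l'' ::= Times (V ''l'') (Read ''w'' (pat_exp (Div (V ''g'') (Num 2))))) Skip) s' (return_pmf ())
     (\<lambda>_ s'. s' ''l'' 0 = int (loc i h g X)) (1 + 1)"
    if l: "s' ''l'' 0 = int ?a" and fr: "agree_except {''l''} ?s s'" for s'
  proof (rule spec_cond)
    have e: "env s'" "xrep X s'" "s' ''h'' 0 = int h" "s' ''g'' 0 = int g" "s' ''i'' 0 = int i"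
      using s fr env_frame[of ?s _ s'] xrep_frame[of X ?s _ s'] agreeD[OF fr] by auto
    have "aval (Read ''w'' (pat_exp (Div (V ''g'') (Num 2)))) s' = int (w (pat X (g div 2)))"
      by (rule aval_w) (use e d in auto)
    then show "spec (''l'' ::= Times (V ''l'') (Read ''w'' (pat_exp (Div (V ''g'') (Num 2))))) s' (return_pmf ())
        (\<lambda>_ s'. s' ''l'' 0 = int (loc i h g X)) 1"
      if "bval (Conj (Less (Div (V ''g'') (Num 2)) (V ''i'')) (Neg (Equal (Div (V ''g'') (Num 2)) (Div (V ''h'') (Num 2))))) s'"
      using that l e d lb by (intro spec_assign) (auto simp: loc_def)
    show "spec Skip s' (return_pmf ()) (\<lambda>_ s'. s' ''l'' 0 = int (loc i h g X)) 1"
      if "\<not> bval (Conj (Less (Div (V ''g'') (Num 2)) (V ''i'')) (Neg (Equal (Div (V ''g'') (Num 2)) (Div (V ''h'') (Num 2))))) s'"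
      using that l e d by (intro spec_skip) (auto simp: loc_def)
  qed
  have "spec loc_cmd s (return_pmf ()) (\<lambda>_ s'. s' ''l'' 0 = int (loc i h g X)) (1 + (1 + 1 + (1 + 1)))"
    unfolding loc_cmd_def
    by (rule spec_assign_seq, simp, rule spec_seq_det[where b = "()" and R = "\<lambda>_ s'. s' ''l'' 0 = int ?a"])
      (use 1 2 in auto)
  then show ?thesis by (rule spec_weaken) auto
qed

lemma move_spec:
  assumes s: "env s" "xrep X s" "s ''h'' 0 = int h" "s ''g'' 0 = int g" "s ''r'' 0 = int r" "s ''i'' 0 = int i"
  shows "spec move_cmd s (return_pmf (move i X h g r)) xrep 11"
proof -
  have test: "bval pair_test s \<longleftrightarrow> (h, g) \<in> pairs"
    using s by (auto simp: pair_test_def end_exp_def env_def pairs_def)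
  have "spec move_cmd s (return_pmf (move i X h g r)) xrep (2 + (5 + (2 + 1)) + 1)"
    unfolding move_cmd_def
  proof (rule spec_cond)
    assume "bval pair_test s"
    then have P: "(h, g) \<in> pairs" by (simp add: test)
    then have hg: "h \<noteq> g" by (simp add: pairs_def)
    let ?Z = "X \<triangle> {h, g}"
    let ?end = "Cond (Less (V ''r'') (V ''l'')) Skip (toggle ''h'' ;; toggle ''g'')"
    have fin: "spec ?end s' (return_pmf (move i X h g r)) xrep (2 + 1)"
      if "xrep ?Z s'" "s' ''l'' 0 = int (loc i h g ?Z)" "s' ''h'' 0 = int h" "s' ''g'' 0 = int g" "s' ''r'' 0 = int r" for s'
    proof (rule spec_cond)
      show "spec Skip s' (return_pmf (move i X h g r)) xrep 2" if "bval (Less (V ''r'') (V ''l'')) s'"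
        by (rule spec_weaken[OF spec_skip[where Q = xrep]]) (use that \<open>xrep ?Z s'\<close> \<open>s' ''l'' 0 = _\<close> \<open>s' ''r'' 0 = _\<close> P in \<open>auto simp: move_def\<close>)
      \<comment> \<open>Toggling twice restores \<open>X\<close>; \<open>spec_map\<close> then
        relabels the unit outcome of \<open>toggle2_spec\<close> as the outcome of the move.\<close>
      have "?Z \<triangle> {h, g} = X" by simp
      then show "spec (toggle ''h'' ;; toggle ''g'') s' (return_pmf (move i X h g r)) xrep 2" if "\<not> bval (Less (V ''r'') (V ''l'')) s'"
        using spec_map[OF spec_weaken[OF toggle2_spec[OF \<open>xrep ?Z s'\<close> \<open>s' ''h'' 0 = _\<close> \<open>s' ''g'' 0 = _\<close> hg] order_refl], of xrep "\<lambda>_. move i X h g r"]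
          that \<open>s' ''l'' 0 = _\<close> \<open>s' ''r'' 0 = _\<close> by (simp add: move_def)
    qed
    have tl: "spec (loc_cmd ;; ?end) s' (return_pmf (move i X h g r)) xrep (5 + (2 + 1))"
      if x: "xrep ?Z s'" and fr: "agree_except {''x''} s s'" for s'
    proof (rule spec_seq_det[OF loc_spec])
      show e: "env s'" "xrep ?Z s'" "s' ''h'' 0 = int h" "s' ''g'' 0 = int g" "s' ''i'' 0 = int i"
        using s x env_frame[OF _ fr] agreeD[OF fr] by auto
      fix s'' assume l: "s'' ''l'' 0 = int (loc i h g ?Z)" and fr': "agree_except (writes loc_cmd) s' s''"
      have r: "s' ''r'' 0 = int r" using s agreeD[OF fr] by auto
      show "spec ?end s'' (return_pmf (move i X h g r)) xrep (2 + 1)"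
        by (rule fin) (use e l r xrep_frame[OF e(2) fr'] agreeD[OF fr'] in auto)
    qed
    \<comment> \<open>Sequencing nests to the right; regrouping lets \<open>toggle2_spec\<close>
      treat both toggles as one command.\<close>
    have assoc: "spec (c1 ;; c2 ;; c3) s p R t" if "spec ((c1 ;; c2) ;; c3) s p R t" for c1 c2 c3 and p :: "nat set pmf" and R t
      using that unfolding spec_def by (simp add: split_def add.assoc Un_assoc bind_spmf_assoc)
    show "spec (toggle ''h'' ;; toggle ''g'' ;; loc_cmd ;; ?end) s (return_pmf (move i X h g r)) xrep (2 + (5 + (2 + 1)))"
      by (rule assoc, rule spec_seq_det[OF toggle2_spec[OF s(2-4) hg]]) (use tl in simp)
  next
    assume "\<not> bval pair_test s"
    then have "move i X h g r = X" by (simp add: test move_def)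
    then show "spec Skip s (return_pmf (move i X h g r)) xrep (2 + (5 + (2 + 1)))"
      using spec_weaken[OF spec_skip[where Q = xrep and b = X]] s(2) by simp
  qed
  then show ?thesis by simp
qed

abbreviation tstep :: nat where "tstep \<equiv> 12 * k + 23"

lemma step_spec:
  assumes s: "env s" "xrep X s" "s ''i'' 0 = int i"
  shows "spec step_cmd s (step i X) xrep tstep"
proof -
  have "spec step_cmd s (step i X) xrep (4 * k + 4 + (4 * k + 4 + (4 * k + 4 + 11)))"
    unfolding step_cmd_def step_def
  proof (rule spec_seq[OF draw_spec[OF s(1)]])
    fix h s1 assume h: "s1 ''h'' 0 = int h" and f1: "agree_except (writes (draw_cmd ''h'')) s s1"
    have e1: "env s1" "xrep X s1" "s1 ''i'' 0 = int i"
      using s env_frame[OF s(1) f1] xrep_frame[OF s(2) f1] agreeD[OF f1] by auto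
    show "spec (draw_cmd ''g'' ;; draw_cmd ''r'' ;; move_cmd) s1
       (bind_pmf (draw k) (\<lambda>g. bind_pmf (draw k) (\<lambda>r. return_pmf (move i X h g r)))) xrep (4 * k + 4 + (4 * k + 4 + 11))"
    proof (rule spec_seq[OF draw_spec[OF e1(1)]])
      fix g s2 assume g: "s2 ''g'' 0 = int g" and f2: "agree_except (writes (draw_cmd ''g'')) s1 s2"
      have e2: "env s2" "xrep X s2" "s2 ''i'' 0 = int i" "s2 ''h'' 0 = int h"
        using h e1 env_frame[OF e1(1) f2] xrep_frame[OF e1(2) f2] agreeD[OF f2] by auto
      show "spec (draw_cmd ''r'' ;; move_cmd) s2 (bind_pmf (draw k) (\<lambda>r. return_pmf (move i X h g r))) xrep (4 * k + 4 + 11)"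
      proof (rule spec_seq[OF draw_spec[OF e2(1)]])
        fix r s3 assume r: "s3 ''r'' 0 = int r" and f3: "agree_except (writes (draw_cmd ''r'')) s2 s3"
        show "spec move_cmd s3 (return_pmf (move i X h g r)) xrep 11"
          by (rule move_spec) (use g r e2 env_frame[OF e2(1) f3] xrep_frame[OF e2(2) f3] agreeD[OF f3] in auto)
      qed simp
    qed simp
  qed simp
  then show ?thesis by (rule spec_weaken) auto
qed

abbreviation twalk :: nat where "twalk \<equiv> T * (tstep + 2) + 2"

lemma walk_spec:
  assumes s: "env s" "xrep X s" "s ''i'' 0 = int i"
  shows "spec walk_cmd s (walk i X) xrep twalk"
proof -
  let ?s = "store ''t'' 0 0 s"
  let ?body = "step_cmd ;; ''t'' ::= Plus (V ''t'') (Num 1)"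
  have "spec (While (Less (V ''t'') (V ''T'')) ?body) ?s (iter_pmf (\<lambda>_. step i) 0 T X)
      (\<lambda>Y s'. s' ''t'' 0 = int T \<and> xrep Y s') (T * (tstep + 1 + 1) + 1)"
  proof (rule spec_while[where I = "\<lambda>j Y s'. s' ''t'' 0 = int j \<and> xrep Y s'"])
    fix j Y s' assume I: "s' ''t'' 0 = int j \<and> xrep Y s'" and fr: "agree_except (writes ?body) ?s s'"
    have e: "env s'" "s' ''i'' 0 = int i" using s env_frame[OF _ fr] agreeD[OF fr] by auto
    show "bval (Less (V ''t'') (V ''T'')) s' \<longleftrightarrow> j < T" using e I by (simp add: env_def)
    show "spec ?body s' (step i Y) (\<lambda>Y s'. s' ''t'' 0 = int (Suc j) \<and> xrep Y s') (tstep + 1)" if j: "j < T"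
    proof (rule spec_seq_after[OF step_spec])
      fix Y' s'' assume Y': "xrep Y' s''" and f: "agree_except (writes step_cmd) s' s''"
      have t: "s'' ''t'' 0 = int j" using I agreeD[OF f] by auto
      have "\<bar>int (Suc j)\<bar> \<le> 2 ^ L" using j TL by (intro nat_bound[of _ L]) auto
      then show "spec (''t'' ::= Plus (V ''t'') (Num 1)) s'' (return_pmf Y') (\<lambda>Y s'. s' ''t'' 0 = int (Suc j) \<and> xrep Y s') 1"
        using t Y' by (intro spec_assign) (auto simp: add.commute)
    qed (use e I in auto)
  qed (use s in auto)
  then have "spec walk_cmd s (iter_pmf (\<lambda>_. step i) 0 T X) (\<lambda>Y s'. s' ''t'' 0 = int T \<and> xrep Y s') (1 + (T * (tstep + 1 + 1) + 1))"
    unfolding walk_cmd_def by (intro spec_assign_seq) auto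
  then show ?thesis unfolding walk_def by (rule spec_weaken) auto
qed

lemma meas_spec:
  assumes s: "env s" "xrep X s" "s ''i'' 0 = int i"
  shows "spec meas_cmd s (return_pmf ()) (\<lambda>_ s'. s' ''f'' 0 = int (meas i X)) (3 * m + 4)"
proof -
  have "spec meas_cmd s (return_pmf ()) (\<lambda>_ s'. s' ''f'' 0 = int (meas i X)) (1 + (1 + (m * (2 + 1) + 1)) + 1)"
    unfolding meas_cmd_def
  proof (rule spec_cond)
    assume t: "bval (Less (V ''i'') (V ''m'')) s"
    have "aval (Read ''w'' (pat_exp (V ''i''))) s = int (w (pat X i))" by (rule aval_w) (use s in auto)
    moreover have "\<bar>int (w (pat X i))\<bar> \<le> 2 ^ L"
      using w_le[of "pat X i"] B2L kL by (intro nat_bound[of _ k]) linarith+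
    ultimately have "spec (''f'' ::= Read ''w'' (pat_exp (V ''i''))) s (return_pmf ()) (\<lambda>_ s'. s' ''f'' 0 = int (meas i X)) 1"
      using t s by (intro spec_assign) (auto simp: meas_eq env_def)
    then show "spec (''f'' ::= Read ''w'' (pat_exp (V ''i''))) s (return_pmf ()) (\<lambda>_ s'. s' ''f'' 0 = int (meas i X)) (1 + (1 + (m * (2 + 1) + 1)))"
      by (rule spec_weaken) auto
  next
    assume t: "\<not> bval (Less (V ''i'') (V ''m'')) s"
    let ?s = "store ''j'' 0 0 (store ''f'' 0 1 s)"
    let ?body = "''f'' ::= Times (V ''f'') (Read ''nb'' (pat_exp (V ''j''))) ;; ''j'' ::= Plus (V ''j'') (Num 1)"
    have pr: "(\<Prod>l<j. nb (pat X l)) \<le> 1" for j by (rule prod_le_1) (use nb_le in auto)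
    have "spec (While (Less (V ''j'') (V ''m'')) ?body) ?s (return_pmf ())
       (\<lambda>_ s'. s' ''j'' 0 = int m \<and> s' ''f'' 0 = int (\<Prod>l<m. nb (pat X l))) (m * (2 + 1) + 1)"
    proof (rule spec_while_det[where I = "\<lambda>j s'. s' ''j'' 0 = int j \<and> s' ''f'' 0 = int (\<Prod>l<j. nb (pat X l))"])
      fix j s' assume I: "s' ''j'' 0 = int j \<and> s' ''f'' 0 = int (\<Prod>l<j. nb (pat X l))" and fr: "agree_except (writes ?body) ?s s'"
      have e: "env s'" "xrep X s'" using s env_frame[OF _ fr] xrep_frame[OF _ fr] by auto
      show "bval (Less (V ''j'') (V ''m'')) s' \<longleftrightarrow> j < m" using I e by (simp add: env_def)
      show "spec ?body s' (return_pmf ()) (\<lambda>_ s'. s' ''j'' 0 = int (Suc j) \<and> s' ''f'' 0 = int (\<Prod>l<Suc j. nb (pat X l))) 2" if j: "j < m"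
      proof -
        have n: "aval (Read ''nb'' (pat_exp (V ''j''))) s' = int (nb (pat X j))" by (rule aval_nb) (use e I in auto)
        have v: "aval (Times (V ''f'') (Read ''nb'' (pat_exp (V ''j'')))) s' = int (\<Prod>l<Suc j. nb (pat X l))"
          using n I by simp
        have b1: "\<bar>int (\<Prod>l<Suc j. nb (pat X l))\<bar> \<le> 2 ^ L" using pr[of "Suc j"] by (intro nat_bound[of _ 0]) auto
        have b2: "\<bar>int (Suc j)\<bar> \<le> 2 ^ L" using j mL by (intro nat_bound[of _ L]) auto
        have "spec ?body s' (return_pmf ()) (\<lambda>_ s'. s' ''j'' 0 = int (Suc j) \<and> s' ''f'' 0 = int (\<Prod>l<Suc j. nb (pat X l))) (1 + 1)"
          by (rule spec_assign_seq, unfold v, rule b1, rule spec_assign) (use I b2 in \<open>auto simp: add.commute\<close>)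
        then show ?thesis by (simp add: numeral_2_eq_2)
      qed
    qed simp
    then have "spec (While (Less (V ''j'') (V ''m'')) ?body) ?s (return_pmf ())
       (\<lambda>_ s'. s' ''f'' 0 = int (meas i X)) (m * (2 + 1) + 1)"
      by (rule spec_weaken) (use t s in \<open>auto simp: meas_eq env_def\<close>)
    then show "spec (''f'' ::= Num 1 ;; ''j'' ::= Num 0 ;; While (Less (V ''j'') (V ''m'')) ?body) s (return_pmf ())
        (\<lambda>_ s'. s' ''f'' 0 = int (meas i X)) (1 + (1 + (m * (2 + 1) + 1)))"
      by (intro spec_assign_seq) auto
  qed
  then show ?thesis by (rule spec_weaken) auto
qed

abbreviation tsample :: nat where "tsample \<equiv> twalk + 3 * m + 5"

lemma sample_spec:
  assumes s: "env s" "xrep X s" "s ''i'' 0 = int i" "s ''S'' 0 = int S" and S: "S + B \<le> 2 ^ L"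
  shows "spec sample_cmd s (sample i (X, S)) (\<lambda>(Y, S') s'. xrep Y s' \<and> s' ''S'' 0 = int S' \<and> S' \<le> S + B) tsample"
proof -
  have "spec sample_cmd s (bind_pmf (walk i X) (\<lambda>Y. return_pmf (Y, S + meas i Y)))
     (\<lambda>(Y, S') s'. xrep Y s' \<and> s' ''S'' 0 = int S' \<and> S' \<le> S + B) (twalk + (3 * m + 4 + 1))"
    unfolding sample_cmd_def
  proof (rule spec_seq[OF walk_spec[OF s(1-3)]])
    fix Y s1 assume Y: "xrep Y s1" and f1: "agree_except (writes walk_cmd) s s1"
    have e1: "env s1" "s1 ''i'' 0 = int i" "s1 ''S'' 0 = int S" using s env_frame[OF s(1) f1] agreeD[OF f1] by auto
    show "spec (meas_cmd ;; ''S'' ::= Plus (V ''S'') (V ''f'')) s1 (return_pmf (Y, S + meas i Y))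
      (\<lambda>(Y, S') s'. xrep Y s' \<and> s' ''S'' 0 = int S' \<and> S' \<le> S + B) (3 * m + 4 + 1)"
    proof (rule spec_seq_det[OF meas_spec[OF e1(1) Y e1(2)]])
      fix s2 assume f: "s2 ''f'' 0 = int (meas i Y)" and f2: "agree_except (writes meas_cmd) s1 s2"
      have "\<bar>int (S + meas i Y)\<bar> \<le> 2 ^ L" using meas_le[of i Y] S by (intro nat_bound[of _ L]) auto
      then show "spec (''S'' ::= Plus (V ''S'') (V ''f'')) s2 (return_pmf (Y, S + meas i Y))
         (\<lambda>(Y, S') s'. xrep Y s' \<and> s' ''S'' 0 = int S' \<and> S' \<le> S + B) 1"
        using e1 f xrep_frame[OF Y f2] agreeD[OF f2] meas_le[of i Y] by (intro spec_assign) auto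
    qed
  qed
  then show ?thesis unfolding sample_def by (auto elim: spec_weaken)
qed

abbreviation tstage :: nat where "tstage \<equiv> N * (tsample + 2) + 5"

lemma stage_spec:
  assumes s: "env s" "xrep X s" "s ''i'' 0 = int i" "s ''p'' 0 = p0 * int P" "s ''q'' 0 = int (q0 * N ^ i)"
    and P: "P \<le> (N * B) ^ i" and i: "i \<le> m"
  shows "spec stage_cmd s (stage i (X, P)) (\<lambda>(Y, P') s'. xrep Y s' \<and> s' ''p'' 0 = p0 * int P' \<and>
     P' \<le> (N * B) ^ Suc i \<and> s' ''q'' 0 = int (q0 * N ^ Suc i)) tstage"
proof -
  let ?s = "store ''b'' 0 0 (store ''S'' 0 0 s)"
  let ?body = "sample_cmd ;; ''b'' ::= Plus (V ''b'') (Num 1)"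
  let ?R = "\<lambda>(Y, P') s'. xrep Y s' \<and> s' ''p'' 0 = p0 * int P' \<and>
     P' \<le> (N * B) ^ Suc i \<and> s' ''q'' 0 = int (q0 * N ^ Suc i)"
  have loop: "spec (While (Less (V ''b'') (V ''N'')) ?body) ?s (iter_pmf (\<lambda>_. sample i) 0 N (X, 0))
      (\<lambda>(Y, S) s'. s' ''b'' 0 = int N \<and> xrep Y s' \<and> s' ''S'' 0 = int S \<and> S \<le> N * B) (N * (tsample + 1 + 1) + 1)"
  proof (rule spec_while[where I = "\<lambda>j (Y, S) s'. s' ''b'' 0 = int j \<and> xrep Y s' \<and> s' ''S'' 0 = int S \<and> S \<le> j * B"])
    fix j z s' assume I: "(\<lambda>(Y, S) s'. s' ''b'' 0 = int j \<and> xrep Y s' \<and> s' ''S'' 0 = int S \<and> S \<le> j * B) z s'"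
      and fr: "agree_except (writes ?body) ?s s'"
    obtain Y S where z: "z = (Y, S)" by force
    have I': "s' ''b'' 0 = int j" "xrep Y s'" "s' ''S'' 0 = int S" "S \<le> j * B" using I by (auto simp: z)
    have e: "env s'" "s' ''i'' 0 = int i" using s env_frame[OF _ fr] agreeD[OF fr] by auto
    show "bval (Less (V ''b'') (V ''N'')) s' \<longleftrightarrow> j < N" using I' e by (simp add: env_def)
    show "spec ?body s' (sample i z)
        (\<lambda>(Y, S) s'. s' ''b'' 0 = int (Suc j) \<and> xrep Y s' \<and> s' ''S'' 0 = int S \<and> S \<le> Suc j * B) (tsample + 1)" if j: "j < N"
      unfolding z
    proof (rule spec_seq_after[OF sample_spec])
      have "S + B \<le> Suc j * B" using I' by simp
      also have "\<dots> \<le> N * B" using j by (intro mult_le_mono1) auto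
      finally show "S + B \<le> 2 ^ L" using SL by linarith
      fix z' s'' assume "(\<lambda>(Y, S') s'. xrep Y s' \<and> s' ''S'' 0 = int S' \<and> S' \<le> S + B) z' s''"
        and f: "agree_except (writes sample_cmd) s' s''"
      moreover have "s'' ''b'' 0 = int j" using I' agreeD[OF f] by auto
      moreover have "\<bar>int (Suc j)\<bar> \<le> 2 ^ L" using j NL by (intro nat_bound[of _ L]) auto
      ultimately show "spec (''b'' ::= Plus (V ''b'') (Num 1)) s'' (return_pmf z')
         (\<lambda>(Y, S) s'. s' ''b'' 0 = int (Suc j) \<and> xrep Y s' \<and> s' ''S'' 0 = int S \<and> S \<le> Suc j * B) 1"
        using I' by (intro spec_assign) (auto simp: add.commute)
    qed (use e I' in auto)
  qed (use s in auto)
  have up: "a * (N * B) ^ Suc i \<le> a * (N * B) ^ (m + 1)" "q0 * N ^ Suc i \<le> q0 * N ^ (m + 1)" for a :: nat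
  proof -
    have "0 < N" using N_eq J1 B1 by simp
    then show "a * (N * B) ^ Suc i \<le> a * (N * B) ^ (m + 1)" "q0 * N ^ Suc i \<le> q0 * N ^ (m + 1)"
      using i B1 by (intro mult_left_mono power_increasing; simp)+
  qed
  have fin: "spec (''p'' ::= Times (V ''p'') (V ''S'') ;; ''q'' ::= Times (V ''q'') (V ''N'')) s'
      (case z of (Y, S) \<Rightarrow> return_pmf (Y, P * S)) ?R (1 + 1)"
    if z: "(\<lambda>(Y, S) s'. s' ''b'' 0 = int N \<and> xrep Y s' \<and> s' ''S'' 0 = int S \<and> S \<le> N * B) z s'"
      and fr: "agree_except (writes (While (Less (V ''b'') (V ''N'')) ?body)) ?s s'" for z s'
  proof -
    obtain Y S where zz: "z = (Y, S)" by force
    have Y: "xrep Y s'" "s' ''S'' 0 = int S" "S \<le> N * B" using z by (auto simp: zz)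
    have e: "s' ''N'' 0 = int N" "s' ''p'' 0 = p0 * int P" "s' ''q'' 0 = int (q0 * N ^ i)"
      using s env_frame[OF _ fr] agreeD[OF fr] by (auto simp: env_def)
    have PS: "P * S \<le> (N * B) ^ Suc i" using mult_mono[OF P Y(3)] by (simp add: mult.commute)
    have "nat \<bar>p0\<bar> * (P * S) \<le> nat \<bar>p0\<bar> * (N * B) ^ Suc i" using PS by (rule mult_left_mono) simp
    also have "\<dots> \<le> 2 ^ L" using up(1)[of "nat \<bar>p0\<bar>"] pL by linarith
    finally have "int (nat \<bar>p0\<bar> * (P * S)) \<le> int (2 ^ L)" by (rule of_nat_mono)
    then have b1: "\<bar>p0 * int P * int S\<bar> \<le> 2 ^ L" by (simp add: abs_mult mult.assoc)
    have b2: "\<bar>int (q0 * N ^ Suc i)\<bar> \<le> 2 ^ L" using up(2) qL by (intro nat_bound[of _ L]) linarith+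
    have vq: "int (q0 * N ^ i) * int N = int (q0 * N ^ Suc i)" by simp
    show ?thesis unfolding zz prod.case
      by (rule spec_assign_seq, use e Y b1 in simp, rule spec_assign) (use e Y b2 vq PS in \<open>simp_all add: mult_ac\<close>)
  qed
  have "spec (While (Less (V ''b'') (V ''N'')) ?body ;; ''p'' ::= Times (V ''p'') (V ''S'') ;; ''q'' ::= Times (V ''q'') (V ''N'')) ?s
     (bind_pmf (iter_pmf (\<lambda>_. sample i) 0 N (X, 0)) (\<lambda>z. case z of (Y, S) \<Rightarrow> return_pmf (Y, P * S)))
     ?R (N * (tsample + 1 + 1) + 1 + (1 + 1))"
    by (rule spec_seq[OF loop]) (rule fin)
  then have "spec stage_cmd s (bind_pmf (iter_pmf (\<lambda>_. sample i) 0 N (X, 0)) (\<lambda>z. case z of (Y, S) \<Rightarrow> return_pmf (Y, P * S)))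
     ?R (1 + (1 + (N * (tsample + 1 + 1) + 1 + (1 + 1))))"
    unfolding stage_cmd_def by (intro spec_assign_seq) auto
  then show ?thesis unfolding stage_def prod.case by (rule spec_weaken) auto
qed

abbreviation tstages :: nat where "tstages \<equiv> (m + 1) * (tstage + 2) + 2"

theorem stages_spec:
  assumes s: "env s" "xrep {} s" "s ''p'' 0 = p0" "s ''q'' 0 = int q0"
  shows "spec stages_cmd s alg (\<lambda>(Y, P) s'. s' ''p'' 0 = p0 * int P \<and> s' ''q'' 0 = int (q0 * N ^ (m + 1))) tstages"
proof -
  let ?s = "store ''i'' 0 0 s"
  let ?body = "stage_cmd ;; ''i'' ::= Plus (V ''i'') (Num 1)"
  let ?I = "\<lambda>i (Y, P) s'. s' ''i'' 0 = int i \<and> xrep Y s' \<and> s' ''p'' 0 = p0 * int P \<and> P \<le> (N * B) ^ i \<and> s' ''q'' 0 = int (q0 * N ^ i)"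
  have "spec (While (Less (V ''i'') (Plus (V ''m'') (Num 1))) ?body) ?s (iter_pmf stage 0 (m + 1) ({}, 1))
      (?I (m + 1)) ((m + 1) * (tstage + 1 + 1) + 1)"
  proof (rule spec_while)
    fix i z s' assume I: "?I i z s'" and fr: "agree_except (writes ?body) ?s s'"
    obtain Y P where z: "z = (Y, P)" by force
    have I': "s' ''i'' 0 = int i" "xrep Y s'" "s' ''p'' 0 = p0 * int P" "P \<le> (N * B) ^ i" "s' ''q'' 0 = int (q0 * N ^ i)"
      using I by (auto simp: z)
    have e: "env s'" using s env_frame[OF _ fr] by auto
    show "bval (Less (V ''i'') (Plus (V ''m'') (Num 1))) s' \<longleftrightarrow> i < m + 1" using I' e by (auto simp: env_def)
    show "spec ?body s' (stage i z) (?I (Suc i)) (tstage + 1)" if i: "i < m + 1"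
      unfolding z
    proof (rule spec_seq_after[OF stage_spec[OF e I'(2,1,3,5,4)]])
      fix z' s'' assume z': "(\<lambda>(Y, P') s'. xrep Y s' \<and> s' ''p'' 0 = p0 * int P' \<and>
           P' \<le> (N * B) ^ Suc i \<and> s' ''q'' 0 = int (q0 * N ^ Suc i)) z' s''"
        and f: "agree_except (writes stage_cmd) s' s''"
      have "s'' ''i'' 0 = int i" using I' agreeD[OF f] by auto
      moreover have "\<bar>int (Suc i)\<bar> \<le> 2 ^ L" using i mL by (intro nat_bound[of _ L]) auto
      ultimately show "spec (''i'' ::= Plus (V ''i'') (Num 1)) s'' (return_pmf z') (?I (Suc i)) 1"
        using z' by (intro spec_assign) (auto simp: add.commute)
    qed (use i in simp)
  qed (use s in auto)
  then have "spec stages_cmd s (iter_pmf stage 0 (m + 1) ({}, 1)) (?I (m + 1)) (1 + ((m + 1) * (tstage + 1 + 1) + 1))"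
    unfolding stages_cmd_def by (intro spec_assign_seq) auto
  then show ?thesis unfolding alg_def by (rule spec_weaken) auto
qed

end

section \<open>Exact prefactors, parameters and the complete program\<close>

primrec apow :: "aexp \<Rightarrow> nat \<Rightarrow> aexp" where
  "apow e 0 = Num 1"
| "apow e (Suc j) = Times e (apow e j)"

lemma aval_apow [simp]: "aval (apow e j) s = aval e s ^ j"
  by (induction j) auto

definition double_cmd :: com where
  "double_cmd =
     ''v'' ::= Num 0 ;;
     While (Less (V ''v'') (V ''n''))
       (''p'' ::= Times (V ''p'') (Num 2) ;; ''v'' ::= Plus (V ''v'') (Num 1))"

text \<open>Produces the factor of half-edge \<open>h\<close> in
  \<open>card_even_sets\<close>.\<close>

definition repeat_cmd :: com where
  "repeat_cmd =
     ''f'' ::= Num 1 ;;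
     ''g'' ::= Num 0 ;;
     While (Less (V ''g'') (V ''h''))
       (Cond (Equal (end_exp ''g'') (end_exp ''h'')) (''f'' ::= Num 2) Skip ;;
        ''g'' ::= Plus (V ''g'') (Num 1))"

definition count_cmd :: com where
  "count_cmd =
     ''h'' ::= Num 0 ;;
     While (Less (V ''h'') (Times (Num 2) (V ''m'')))
       (repeat_cmd ;;
        ''p'' ::= Times (V ''p'') (V ''f'') ;;
        ''h'' ::= Plus (V ''h'') (Num 1))"

lemma writes_count [simp]:
  "writes double_cmd = {''v'', ''p''}"
  "writes repeat_cmd = {''f'', ''g''}"
  "writes count_cmd = {''h'', ''f'', ''g'', ''p''}"
  unfolding double_cmd_def repeat_cmd_def count_cmd_def by auto

text \<open>The parameters \<open>A0\<close>, \<open>A1\<close>, \<open>A2\<close> are the absolute values of the edge weights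
  \<open>(\<beta> + \<gamma> + 2) / 4\<close>, \<open>(\<beta> - \<gamma>) / 4\<close> and \<open>(\<beta> + \<gamma> - 2) / 4\<close> over the common denominator \<open>dd\<close>,
  and \<open>sg\<close> is the sign of the first and the last one.\<close>

locale spin_program =
  fixes A0 A1 A2 dd :: nat and sg :: int
  assumes A1_pos: "0 < A1" and dd_pos: "0 < dd" and sg: "\<bar>sg\<bar> = 1" and A02: "0 < A0 \<or> 0 < A2"
begin

definition Wm :: nat where "Wm = A0 + A1 + A2"

text \<open>Chosen for \<open>forbidden_mass\<close> with \<open>C = Wm\<close> and
  \<open>R = scale m\<close>: the factor 2 leaves at most half of the total weight to sets with a
  forbidden edge.\<close>

definition scale :: "nat \<Rightarrow> nat" where "scale m = 2 * Wm * (2 * m + 1) ^ 3"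

definition wmax :: "nat \<Rightarrow> nat" where "wmax m = Wm * scale m"

text \<open>A vanishing coefficient gets the substitute weight 1, which is negligible against the
  scaled ones.\<close>

definition weight :: "nat \<Rightarrow> nat \<Rightarrow> nat" where
  "weight m p = (if p = 0 then A0 * scale m + of_bool (A0 = 0)
     else if p = 1 then A1 * scale m else A2 * scale m + of_bool (A2 = 0))"

text \<open>Undoes the substitution: \<open>weight * nonzero\<close> is the scaled true
  coefficient.\<close>

definition nonzero :: "nat \<Rightarrow> nat" where
  "nonzero p = (if p = 0 then of_bool (0 < A0) else if p = 1 then 1 else of_bool (0 < A2))"

definition rng :: "nat \<Rightarrow> nat" where "rng m = 2 * wmax m ^ 2 + 2 * m"

text \<open>Since \<open>1 \<le> e * E\<close>, this meets the requirement
  \<open>40 * (m + 1) \<le> J * e ^ 2\<close> of \<open>alg_accurate\<close>.\<close>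

definition prec :: "nat \<Rightarrow> nat \<Rightarrow> nat" where "prec m E = 40 * (m + 1) * E ^ 2"

definition samples :: "nat \<Rightarrow> nat \<Rightarrow> nat" where "samples m E = 4 * wmax m * prec m E"

text \<open>The lower bound for \<open>T\<close> with \<open>2 ^ k\<close> replaced by its bound
  \<open>2 * rng m\<close>, which can be evaluated without knowing \<open>k\<close>.\<close>

definition steps :: "nat \<Rightarrow> nat \<Rightarrow> nat" where
  "steps m E = (m + 1) ^ 2 * wmax m ^ 4 * (2 * rng m) ^ 3 * (4 * wmax m * (m + 2) + 2 * prec m E + 2)"

definition nbits :: "nat \<Rightarrow> nat" where "nbits m = (LEAST k. rng m \<le> 2 ^ k)"

text \<open>Each edge contributes the sign \<open>sg\<close> and the denominator
  \<open>dd * scale m\<close>; the latter also undoes the scaling of the weights.\<close>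

definition sign_cmd :: com where
  "sign_cmd =
     ''j'' ::= Num 0 ;;
     While (Less (V ''j'') (V ''m''))
       (''p'' ::= Times (V ''p'') (Num sg) ;;
        ''q'' ::= Times (V ''q'') (Times (Num (int dd)) (V ''R'')) ;;
        ''j'' ::= Plus (V ''j'') (Num 1))"

text \<open>The cell \<open>E\<close> holds the integer part of 1/\<epsilon> plus one, so that
  \<open>\<epsilon> * E\<close> exceeds 1.\<close>

definition setup_cmd :: com where
  "setup_cmd =
     ''n'' ::= Read ''in'' (Num 2) ;;
     ''m'' ::= Read ''in'' (Num 3) ;;
     ''E'' ::= Plus (Div (Read ''in'' (Num 1)) (Read ''in'' (Num 0))) (Num 1) ;;
     ''R'' ::= Times (Num (int (2 * Wm))) (apow (Plus (Times (Num 2) (V ''m'')) (Num 1)) 3) ;;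
     ''B'' ::= Times (Num (int Wm)) (V ''R'') ;;
     ''Q'' ::= Plus (Times (Num 2) (apow (V ''B'') 2)) (Times (Num 2) (V ''m'')) ;;
     ''J'' ::= Times (Times (Num 40) (Plus (V ''m'') (Num 1))) (apow (V ''E'') 2) ;;
     ''N'' ::= Times (Times (Num 4) (V ''B'')) (V ''J'') ;;
     ''T'' ::= Times (Times (Times (apow (Plus (V ''m'') (Num 1)) 2) (apow (V ''B'') 4)) (apow (Times (Num 2) (V ''Q'')) 3))
       (Plus (Plus (Times (Times (Num 4) (V ''B'')) (Plus (V ''m'') (Num 2))) (Times (Num 2) (V ''J''))) (Num 2)) ;;
     Assign ''w'' (Num 0) (Plus (Times (Num (int A0)) (V ''R'')) (Num (of_bool (A0 = 0)))) ;;
     Assign ''w'' (Num 1) (Times (Num (int A1)) (V ''R'')) ;;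
     Assign ''w'' (Num 2) (Plus (Times (Num (int A2)) (V ''R'')) (Num (of_bool (A2 = 0)))) ;;
     Assign ''nb'' (Num 0) (Num (of_bool (0 < A0))) ;;
     Assign ''nb'' (Num 1) (Num 1) ;;
     Assign ''nb'' (Num 2) (Num (of_bool (0 < A2))) ;;
     ''p'' ::= Num 1 ;;
     ''q'' ::= Num 1"

definition program :: com where
  "program = setup_cmd ;; double_cmd ;; count_cmd ;; sign_cmd ;; stages_cmd ;;
     Assign ''out'' (Num 0) (V ''p'') ;; Assign ''out'' (Num 1) (V ''q'')"

text \<open>A sum of exponents covering every stored value. Parameters enter with their value
  instead of their bit length, which is wasteful but still polynomial.\<close>

definition cellbits :: "nat \<Rightarrow> nat \<Rightarrow> nat \<Rightarrow> nat \<Rightarrow> nat" where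
  "cellbits n m E z = z + n + 2 * m + samples m E * wmax m * (m + 1) + dd * scale m * m + samples m E * (m + 1) +
     steps m E + rng m + prec m E + samples m E + E + wmax m + scale m + 1"

lemma writes_sign [simp]: "writes sign_cmd = {''j'', ''p'', ''q''}"
  unfolding sign_cmd_def by auto

lemma Wm1: "1 \<le> Wm" using A1_pos by (simp add: Wm_def)

lemma scale1: "1 \<le> scale m" using Wm1 by (simp add: scale_def)

lemma weight_bounds: "1 \<le> weight m p" "weight m p \<le> wmax m"
proof -
  have 1: "1 \<le> a * scale m" if "0 < a" for a using that scale1[of m] by (simp add: Suc_le_eq)
  show "1 \<le> weight m p" using 1[of A0] 1[of A1] 1[of A2] A1_pos by (auto simp: weight_def)
  have 2: "a * scale m \<le> wmax m" if "a \<le> Wm" for a using that by (simp add: wmax_def)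
  have 3: "1 \<le> wmax m" using 2[of 1] Wm1 scale1[of m] by simp
  show "weight m p \<le> wmax m" using 2[of A0] 2[of A1] 2[of A2] 3 by (auto simp: weight_def Wm_def)
qed

lemma nbits_props: "rng m \<le> 2 ^ nbits m" "j < nbits m \<Longrightarrow> 2 ^ j < rng m" "2 ^ nbits m \<le> 2 * rng m" "nbits m \<le> rng m"
proof -
  have ex: "rng m \<le> 2 ^ rng m" by (rule less_imp_le[OF less_exp])
  show "rng m \<le> 2 ^ nbits m" unfolding nbits_def by (rule LeastI[of _ "rng m"]) (rule ex)
  show lt: "2 ^ j < rng m" if "j < nbits m" for j
    using not_less_Least[of j "\<lambda>k. rng m \<le> 2 ^ k"] that unfolding nbits_def by simp
  show "nbits m \<le> rng m" unfolding nbits_def by (rule Least_le) (rule ex)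
  have "1 \<le> wmax m" using weight_bounds[of m 0] by linarith
  then have "1 \<le> wmax m ^ 2" by (rule one_le_power)
  then have r1: "1 \<le> rng m" unfolding rng_def by linarith
  show "2 ^ nbits m \<le> 2 * rng m"
  proof (cases "nbits m")
    case (Suc j)
    then show ?thesis using lt[of j] by simp
  qed (use r1 in simp)
qed

end

locale spin_instance = spin_program A0 A1 A2 dd sg + half_edge_graph m vt + cost_model K "cellbits n m E z"
  for A0 A1 A2 dd sg and m :: nat and vt :: "nat \<Rightarrow> nat" and K n E z :: nat +
  assumes E1: "1 \<le> E"
begin

abbreviation L :: nat where "L \<equiv> cellbits n m E z"

definition measure_fn :: "nat \<Rightarrow> nat set \<Rightarrow> nat" where
  "measure_fn i X = (if i < m then weight m (pat X i) else \<Prod>j<m. nonzero (pat X j))"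

text \<open>The exactly known part of the numerator: the vertex factor, the start of the telescope
  and the sign.\<close>

definition numer :: int where "numer = 2 ^ n * int (card even_sets) * sg ^ m"

definition denom :: nat where "denom = (dd * scale m) ^ m"

lemma le_pow_L: "v \<le> L \<Longrightarrow> v \<le> 2 ^ L" for v :: nat
  using less_exp[of L] by linarith

lemma card_even_le: "card even_sets \<le> 4 ^ m"
proof -
  have "card even_sets \<le> card (Pow {..<2 * m})" by (intro card_mono) (auto simp: even_sets_def)
  then show ?thesis by (simp add: card_Pow power_mult)
qed

lemma pow_le_pow2: "a ^ j \<le> 2 ^ (a * j)" for a :: nat
  using power_mono[OF less_imp_le[OF less_exp[of a]], of j] by (simp add: power_mult)

lemma abs_numer: "nat \<bar>numer\<bar> = 2 ^ n * card even_sets"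
  using sg by (simp add: numer_def abs_mult power_abs nat_mult_distrib nat_power_eq)

sublocale machine m vt "weight m" "wmax m" "nbits m" "steps m E" "samples m E" "prec m E" measure_fn K L n "rng m" nonzero numer denom
proof
  show "1 \<le> weight m p" "weight m p \<le> wmax m" for p by (rule weight_bounds)+
  show "2 * wmax m ^ 2 \<le> 2 ^ nbits m" "2 * m \<le> 2 ^ nbits m"
    using nbits_props(1)[of m] by (simp_all add: rng_def)
  show "1 \<le> prec m E" using E1 by (simp add: prec_def)
  show "samples m E = 4 * wmax m * prec m E" by (simp add: samples_def)
  show "(m + 1) ^ 2 * wmax m ^ 4 * (2 ^ nbits m) ^ 3 * (4 * wmax m * (m + 2) + 2 * prec m E + 2) \<le> steps m E"
    unfolding steps_def by (intro mult_le_mono1 mult_le_mono2 power_mono nbits_props) auto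
  have w1: "1 \<le> wmax m" using weight_bounds[of m 0] by linarith
  have nz: "nonzero p \<le> 1" for p by (simp add: nonzero_def)
  show "nonzero p \<le> 1" for p by (rule nz)
  show "measure_fn i X \<le> wmax m" for i X
  proof -
    have "(\<Prod>j<m. nonzero (pat X j)) \<le> 1" by (rule prod_le_1) (use nz in auto)
    then show ?thesis using w1 weight_bounds(2)[of m] by (auto simp: measure_fn_def)
  qed
  show "rng m \<le> 2 ^ nbits m" by (rule nbits_props)
  show "2 ^ j < rng m" if "j < nbits m" for j using that by (rule nbits_props)
  show "nbits m \<le> L" using nbits_props(4)[of m] by (simp add: cellbits_def)
  show "steps m E \<le> 2 ^ L" "samples m E \<le> 2 ^ L" "m + 1 \<le> 2 ^ L"
    by (rule le_pow_L; simp add: cellbits_def)+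
  have s1: "samples m E * wmax m \<le> samples m E * wmax m * (m + 1)" by simp
  show "samples m E * wmax m \<le> 2 ^ L"
    by (rule le_pow_L, rule order_trans[OF s1]) (simp add: cellbits_def)
  show "nat \<bar>numer\<bar> * (samples m E * wmax m) ^ (m + 1) \<le> 2 ^ L"
  proof -
    have "nat \<bar>numer\<bar> * (samples m E * wmax m) ^ (m + 1) \<le> 2 ^ n * 2 ^ (2 * m) * 2 ^ (samples m E * wmax m * (m + 1))"
      unfolding abs_numer using card_even_le by (intro mult_mono pow_le_pow2) (auto simp: power_mult)
    also have "\<dots> = 2 ^ (n + 2 * m + samples m E * wmax m * (m + 1))" by (simp add: power_add)
    also have "\<dots> \<le> 2 ^ L" by (rule power_increasing) (auto simp: cellbits_def)
    finally show ?thesis .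
  qed
  show "denom * samples m E ^ (m + 1) \<le> 2 ^ L"
  proof -
    have "denom * samples m E ^ (m + 1) \<le> 2 ^ (dd * scale m * m) * 2 ^ (samples m E * (m + 1))"
      unfolding denom_def by (intro mult_mono pow_le_pow2) auto
    also have "\<dots> = 2 ^ (dd * scale m * m + samples m E * (m + 1))" by (simp add: power_add)
    also have "\<dots> \<le> 2 ^ L" by (rule power_increasing) (auto simp: cellbits_def)
    finally show ?thesis .
  qed
  show "measure_fn i X = (if i < m then weight m (pat X i) else \<Prod>j<m. nonzero (pat X j))" for i X
    by (simp add: measure_fn_def)
qed

section \<open>Correctness of the setup, the exact factors and the whole program\<close>

lemma spec_put_seq:
  assumes "aval a s = v" "\<bar>v\<bar> \<le> 2 ^ L" "spec c (store x j v s) p Q t"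
  shows "spec (Seq (Assign x (Num j) a) c) s p Q (1 + t)"
  using assms by (intro spec_assign_seq) auto

lemma spec_put:
  assumes "aval a s = v" "\<bar>v\<bar> \<le> 2 ^ L" "Q b (store x j v s)"
  shows "spec (Assign x (Num j) a) s (return_pmf b) Q 1"
  using assms by (intro spec_assign) auto

definition ready :: "state \<Rightarrow> bool" where
  "ready s \<longleftrightarrow> env s \<and> xrep {} s \<and> s ''R'' 0 = int (scale m)"

lemma ready_frame:
  "ready s \<Longrightarrow> agree_except M s s' \<Longrightarrow> M \<inter> {''n'', ''m'', ''Q'', ''N'', ''T'', ''w'', ''nb'', ''in'', ''x'', ''R''} = {} \<Longrightarrow> ready s'"
  using env_frame[of s M s'] xrep_frame[of "{}" s M s'] agreeD[of M s s' "''R''"] by (auto simp: ready_def)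

lemma setup_spec:
  assumes s: "s ''in'' 2 = int n" "s ''in'' 3 = int m" "s ''in'' 1 div s ''in'' 0 + 1 = int E"
    "\<And>h. h < 2 * m \<Longrightarrow> s ''in'' (4 + int n + int h) = int (vt h)" "xrep {} s"
  shows "spec setup_cmd s (return_pmf ()) (\<lambda>_ s'. ready s' \<and> s' ''p'' 0 = 1 \<and> s' ''q'' 0 = 1) 17"
proof -
  let ?s1 = "store ''n'' 0 (int n) s"
  let ?s2 = "store ''m'' 0 (int m) ?s1"
  let ?s3 = "store ''E'' 0 (int E) ?s2"
  let ?s4 = "store ''R'' 0 (int (scale m)) ?s3"
  let ?s5 = "store ''B'' 0 (int (wmax m)) ?s4"
  let ?s6 = "store ''Q'' 0 (int (rng m)) ?s5"
  let ?s7 = "store ''J'' 0 (int (prec m E)) ?s6"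
  let ?s8 = "store ''N'' 0 (int (samples m E)) ?s7"
  let ?s9 = "store ''T'' 0 (int (steps m E)) ?s8"
  let ?w0 = "store ''w'' 0 (int (weight m 0)) ?s9"
  let ?w1 = "store ''w'' 1 (int (weight m 1)) ?w0"
  let ?w2 = "store ''w'' 2 (int (weight m 2)) ?w1"
  let ?n0 = "store ''nb'' 0 (int (nonzero 0)) ?w2"
  let ?n1 = "store ''nb'' 1 (int (nonzero 1)) ?n0"
  let ?n2 = "store ''nb'' 2 (int (nonzero 2)) ?n1"
  have b: "\<bar>int v\<bar> \<le> 2 ^ L" if "v \<le> L" for v
    using nat_bound[of v L] le_pow_L[OF that] by simp
  have bw: "\<bar>int (weight m p)\<bar> \<le> 2 ^ L" for p
    by (rule b, rule order_trans[OF weight_bounds(2)]) (simp add: cellbits_def)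
  have T: "int (steps m E) = (int m + 1) ^ 2 * int (wmax m) ^ 4 * (2 * int (rng m)) ^ 3 *
      (4 * int (wmax m) * (int m + 2) + 2 * int (prec m E) + 2)"
    by (simp only: steps_def of_nat_mult of_nat_add of_nat_power of_nat_numeral of_nat_1)
  have bn: "\<bar>int (nonzero p)\<bar> \<le> 2 ^ L" for p
    by (simp add: nonzero_def)
  have fin: "ready (store ''q'' 0 1 (store ''p'' 0 1 ?n2))"
  proof -
    have le2: "p \<le> 2 \<Longrightarrow> p = 0 \<or> p = 1 \<or> p = 2" for p :: nat by linarith
    have ws: "?n2 ''w'' (int p) = int (weight m p)" "?n2 ''nb'' (int p) = int (nonzero p)" if "p \<le> 2" for p
      using le2[OF that] by (auto simp: store_def)
    have "env ?n2" unfolding env_def using s ws by simp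
    moreover have "xrep {} ?n2" using s by simp
    ultimately show ?thesis by (simp add: ready_def)
  qed
  have "spec setup_cmd s (return_pmf ()) (\<lambda>_ s'. ready s' \<and> s' ''p'' 0 = 1 \<and> s' ''q'' 0 = 1)
     (1 + (1 + (1 + (1 + (1 + (1 + (1 + (1 + (1 + (1 + (1 + (1 + (1 + (1 + (1 + (1 + 1))))))))))))))))"
    unfolding setup_cmd_def
    apply (rule spec_put_seq[where v = "int n"], use s in simp, rule b, simp add: cellbits_def)
    apply (rule spec_put_seq[where v = "int m"], use s in simp, rule b, simp add: cellbits_def)
    apply (rule spec_put_seq[where v = "int E"], use s in simp, rule b, simp add: cellbits_def)
    apply (rule spec_put_seq[where v = "int (scale m)"], simp add: scale_def add.commute, rule b, simp add: cellbits_def)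
    apply (rule spec_put_seq[where v = "int (wmax m)"], simp add: wmax_def, rule b, simp add: cellbits_def)
    apply (rule spec_put_seq[where v = "int (rng m)"], simp add: rng_def, rule b, simp add: cellbits_def)
    apply (rule spec_put_seq[where v = "int (prec m E)"], simp add: prec_def add.commute, rule b, simp add: cellbits_def)
    apply (rule spec_put_seq[where v = "int (samples m E)"], simp add: samples_def, rule b, simp add: cellbits_def)
    apply (rule spec_put_seq[where v = "int (steps m E)"], subst T, simp, rule b, simp add: cellbits_def)
    apply (rule spec_put_seq[where v = "int (weight m 0)"], simp add: weight_def, rule bw)
    apply (rule spec_put_seq[where v = "int (weight m 1)"], simp add: weight_def, rule bw)
    apply (rule spec_put_seq[where v = "int (weight m 2)"], simp add: weight_def, rule bw)
    apply (rule spec_put_seq[where v = "int (nonzero 0)"], simp add: nonzero_def, rule bn)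
    apply (rule spec_put_seq[where v = "int (nonzero 1)"], simp add: nonzero_def, rule bn)
    apply (rule spec_put_seq[where v = "int (nonzero 2)"], simp add: nonzero_def, rule bn)
    apply (rule spec_put_seq[where v = 1], simp, simp)
    apply (rule spec_put[where v = 1], simp, simp)
    using fin apply simp
    done
  then show ?thesis by (rule spec_weaken) auto
qed

lemma double_spec:
  assumes s: "ready s" "s ''p'' 0 = 1"
  shows "spec double_cmd s (return_pmf ()) (\<lambda>_ s'. s' ''p'' 0 = 2 ^ n) (3 * n + 2)"
proof -
  let ?s = "store ''v'' 0 0 s"
  let ?body = "''p'' ::= Times (V ''p'') (Num 2) ;; ''v'' ::= Plus (V ''v'') (Num 1)"
  have nL: "n \<le> L" by (simp add: cellbits_def)
  have "spec (While (Less (V ''v'') (V ''n'')) ?body) ?s (return_pmf ())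
     (\<lambda>_ s'. s' ''v'' 0 = int n \<and> s' ''p'' 0 = 2 ^ n) (n * (2 + 1) + 1)"
  proof (rule spec_while_det[where I = "\<lambda>j s'. s' ''v'' 0 = int j \<and> s' ''p'' 0 = 2 ^ j"])
    fix j s' assume I: "s' ''v'' 0 = int j \<and> s' ''p'' 0 = 2 ^ j" and fr: "agree_except (writes ?body) ?s s'"
    have "s' ''n'' 0 = int n" using s agreeD[OF fr] by (simp add: ready_def env_def)
    then show "bval (Less (V ''v'') (V ''n'')) s' \<longleftrightarrow> j < n" using I by simp
    show "spec ?body s' (return_pmf ()) (\<lambda>_ s'. s' ''v'' 0 = int (Suc j) \<and> s' ''p'' 0 = 2 ^ Suc j) 2" if j: "j < n"
    proof -
      have b1: "\<bar>2 ^ Suc j :: int\<bar> \<le> 2 ^ L" using power_increasing[of "Suc j" L "2 :: int"] j nL by simp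
      have b2: "\<bar>int (Suc j)\<bar> \<le> 2 ^ L" using j nL le_pow_L[of "Suc j"] by (intro nat_bound[of _ L]) auto
      have "spec ?body s' (return_pmf ()) (\<lambda>_ s'. s' ''v'' 0 = int (Suc j) \<and> s' ''p'' 0 = 2 ^ Suc j) (1 + 1)"
        by (rule spec_put_seq[where v = "2 ^ Suc j"], use I in simp, rule b1,
            rule spec_put[where v = "int (Suc j)"], use I in simp, rule b2, simp)
      then show ?thesis by (rule spec_weaken) auto
    qed
  qed (use s in simp)
  then have "spec double_cmd s (return_pmf ()) (\<lambda>_ s'. s' ''v'' 0 = int n \<and> s' ''p'' 0 = 2 ^ n) (1 + (n * (2 + 1) + 1))"
    unfolding double_cmd_def by (intro spec_assign_seq) auto
  then show ?thesis by (rule spec_weaken) auto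
qed

lemma repeat_spec:
  assumes s: "ready s" "s ''h'' 0 = int h" and h: "h < 2 * m"
  shows "spec repeat_cmd s (return_pmf ()) (\<lambda>_ s'. s' ''f'' 0 = (if \<exists>g<h. vt g = vt h then 2 else 1)) (8 * m + 3)"
proof -
  let ?s = "store ''g'' 0 0 (store ''f'' 0 1 s)"
  let ?c = "Cond (Equal (end_exp ''g'') (end_exp ''h'')) (''f'' ::= Num 2) Skip"
  let ?body = "?c ;; ''g'' ::= Plus (V ''g'') (Num 1)"
  let ?f = "\<lambda>g. if \<exists>j<g. vt j = vt h then 2 else (1 :: int)"
  have mL: "2 * m \<le> L" by (simp add: cellbits_def)
  have "spec (While (Less (V ''g'') (V ''h'')) ?body) ?s (return_pmf ())
     (\<lambda>_ s'. s' ''g'' 0 = int h \<and> s' ''f'' 0 = ?f h) (h * (3 + 1) + 1)"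
  proof (rule spec_while_det[where I = "\<lambda>g s'. s' ''g'' 0 = int g \<and> s' ''f'' 0 = ?f g"])
    fix g s' assume I: "s' ''g'' 0 = int g \<and> s' ''f'' 0 = ?f g" and fr: "agree_except (writes ?body) ?s s'"
    have e: "env s'" "s' ''h'' 0 = int h" using s env_frame[OF _ fr] agreeD[OF fr] by (auto simp: ready_def)
    show "bval (Less (V ''g'') (V ''h'')) s' \<longleftrightarrow> g < h" using I e by simp
    show "spec ?body s' (return_pmf ()) (\<lambda>_ s'. s' ''g'' 0 = int (Suc g) \<and> s' ''f'' 0 = ?f (Suc g)) 3" if g: "g < h"
    proof -
      have t: "bval (Equal (end_exp ''g'') (end_exp ''h'')) s' \<longleftrightarrow> vt g = vt h"
        using e I g h by (simp add: end_exp_def env_def)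
      have "\<bar>2 :: int\<bar> \<le> 2 ^ L" using power_increasing[of 1 L "2 :: int"] by (simp add: cellbits_def)
      then have 1: "spec ?c s' (return_pmf ()) (\<lambda>_ s''. s'' ''f'' 0 = ?f (Suc g)) (1 + 1)"
        using I t by (intro spec_cond spec_put[where v = 2] spec_skip) (auto simp: less_Suc_eq)
      have b2: "\<bar>int (Suc g)\<bar> \<le> 2 ^ L" using g h mL le_pow_L[of "Suc g"] by (intro nat_bound[of _ L]) auto
      have "spec ?body s' (return_pmf ()) (\<lambda>_ s'. s' ''g'' 0 = int (Suc g) \<and> s' ''f'' 0 = ?f (Suc g)) (1 + 1 + 1)"
      proof (rule spec_seq_det[OF 1])
        fix s'' assume f: "s'' ''f'' 0 = ?f (Suc g)" and fr': "agree_except (writes ?c) s' s''"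
        have "s'' ''g'' 0 = int g" using I agreeD[OF fr'] by simp
        then show "spec (''g'' ::= Plus (V ''g'') (Num 1)) s'' (return_pmf ()) (\<lambda>_ s'. s' ''g'' 0 = int (Suc g) \<and> s' ''f'' 0 = ?f (Suc g)) 1"
          using f b2 by (intro spec_put[where v = "int (Suc g)"]) auto
      qed
      then show ?thesis by (rule spec_weaken) auto
    qed
  qed (use s in simp)
  then have "spec repeat_cmd s (return_pmf ()) (\<lambda>_ s'. s' ''g'' 0 = int h \<and> s' ''f'' 0 = ?f h) (1 + (1 + (h * (3 + 1) + 1)))"
    unfolding repeat_cmd_def by (intro spec_assign_seq) auto
  then show ?thesis by (rule spec_weaken) (use h in auto)
qed

lemma count_spec:
  assumes s: "ready s" "s ''p'' 0 = 2 ^ n"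
  shows "spec count_cmd s (return_pmf ()) (\<lambda>_ s'. s' ''p'' 0 = 2 ^ n * int (card even_sets)) (2 * m * (8 * m + 6) + 2)"
proof -
  let ?s = "store ''h'' 0 0 s"
  let ?body = "repeat_cmd ;; ''p'' ::= Times (V ''p'') (V ''f'') ;; ''h'' ::= Plus (V ''h'') (Num 1)"
  let ?c = "\<lambda>h. if \<exists>g<h. vt g = vt h then 2 else (1 :: int)"
  let ?p = "\<lambda>h. 2 ^ n * (\<Prod>j<h. ?c j)"
  have mL: "2 * m \<le> L" by (simp add: cellbits_def)
  have "spec (While (Less (V ''h'') (Times (Num 2) (V ''m''))) ?body) ?s (return_pmf ())
     (\<lambda>_ s'. s' ''h'' 0 = int (2 * m) \<and> s' ''p'' 0 = ?p (2 * m)) (2 * m * (8 * m + 5 + 1) + 1)"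
  proof (rule spec_while_det[where I = "\<lambda>h s'. s' ''h'' 0 = int h \<and> s' ''p'' 0 = ?p h"])
    fix h s' assume I: "s' ''h'' 0 = int h \<and> s' ''p'' 0 = ?p h" and fr: "agree_except (writes ?body) ?s s'"
    have "ready ?s" using s by (simp add: ready_def)
    then have e: "ready s'" by (rule ready_frame[OF _ fr]) simp
    show "bval (Less (V ''h'') (Times (Num 2) (V ''m''))) s' \<longleftrightarrow> h < 2 * m" using I e by (auto simp: ready_def env_def)
    show "spec ?body s' (return_pmf ()) (\<lambda>_ s'. s' ''h'' 0 = int (Suc h) \<and> s' ''p'' 0 = ?p (Suc h)) (8 * m + 5)" if h: "h < 2 * m"
    proof -
      have hh: "s' ''h'' 0 = int h" using I by simp
      \<comment> \<open>An opaque name for the new value; it keeps the conditional product folded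
        while the assignment rules are applied.\<close>
      obtain pp where pp: "pp = ?p (Suc h)" by blast
      have b1: "\<bar>?p (Suc h)\<bar> \<le> 2 ^ L"
      proof -
        have pos: "0 \<le> ?p (Suc h)" by (intro mult_nonneg_nonneg prod_nonneg) auto
        have "(\<Prod>j<Suc h. ?c j) \<le> (\<Prod>j<Suc h. 2)" by (intro prod_mono) auto
        then have "?p (Suc h) \<le> 2 ^ n * 2 ^ Suc h" by (intro mult_left_mono) auto
        also have "\<dots> = 2 ^ (n + Suc h)" by (simp add: power_add)
        also have "\<dots> \<le> 2 ^ L" using h by (intro power_increasing) (auto simp: cellbits_def)
        finally show ?thesis using pos by simp
      qed
      have b2: "\<bar>int (Suc h)\<bar> \<le> 2 ^ L" using h mL le_pow_L[of "Suc h"] by (intro nat_bound[of _ L]) auto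
      have "spec ?body s' (return_pmf ()) (\<lambda>_ s'. s' ''h'' 0 = int (Suc h) \<and> s' ''p'' 0 = ?p (Suc h)) (8 * m + 3 + (1 + 1))"
      proof (rule spec_seq_det[OF repeat_spec[OF e hh h]])
        fix s'' assume f: "s'' ''f'' 0 = ?c h" and fr': "agree_except (writes repeat_cmd) s' s''"
        have q: "s'' ''h'' 0 = int h" "s'' ''p'' 0 = ?p h" using I agreeD[OF fr'] by auto
        have v: "aval (Times (V ''p'') (V ''f'')) s'' = ?p (Suc h)"
          using q f by (simp only: aval.simps prod.lessThan_Suc mult.assoc)
        show "spec (''p'' ::= Times (V ''p'') (V ''f'') ;; ''h'' ::= Plus (V ''h'') (Num 1)) s'' (return_pmf ())
           (\<lambda>_ s'. s' ''h'' 0 = int (Suc h) \<and> s' ''p'' 0 = ?p (Suc h)) (1 + 1)"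
          unfolding pp[symmetric]
          by (rule spec_put_seq[OF v[folded pp] b1[folded pp]], rule spec_put[where v = "int (Suc h)"], use q in simp, rule b2, simp)
      qed
      then show ?thesis by (rule spec_weaken) auto
    qed
  qed (use s in simp)
  then have "spec count_cmd s (return_pmf ()) (\<lambda>_ s'. s' ''h'' 0 = int (2 * m) \<and> s' ''p'' 0 = ?p (2 * m)) (1 + (2 * m * (8 * m + 5 + 1) + 1))"
    unfolding count_cmd_def by (intro spec_assign_seq) auto
  moreover have "int (card even_sets) = (\<Prod>j<2 * m. ?c j)"
    unfolding card_even_sets of_nat_prod by (intro prod.cong) auto
  ultimately show ?thesis by (auto elim: spec_weaken)
qed

lemma sign_spec:
  assumes s: "ready s" "s ''p'' 0 = a" "s ''q'' 0 = 1" and a: "\<bar>a\<bar> \<le> 2 ^ L"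
  shows "spec sign_cmd s (return_pmf ()) (\<lambda>_ s'. s' ''p'' 0 = a * sg ^ m \<and> s' ''q'' 0 = int denom) (4 * m + 2)"
proof -
  let ?s = "store ''j'' 0 0 s"
  let ?body = "''p'' ::= Times (V ''p'') (Num sg) ;; ''q'' ::= Times (V ''q'') (Times (Num (int dd)) (V ''R'')) ;;
    ''j'' ::= Plus (V ''j'') (Num 1)"
  have "spec (While (Less (V ''j'') (V ''m'')) ?body) ?s (return_pmf ())
     (\<lambda>_ s'. s' ''j'' 0 = int m \<and> s' ''p'' 0 = a * sg ^ m \<and> s' ''q'' 0 = int ((dd * scale m) ^ m)) (m * (3 + 1) + 1)"
  proof (rule spec_while_det[where I = "\<lambda>j s'. s' ''j'' 0 = int j \<and> s' ''p'' 0 = a * sg ^ j \<and> s' ''q'' 0 = int ((dd * scale m) ^ j)"])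
    fix j s' assume I: "s' ''j'' 0 = int j \<and> s' ''p'' 0 = a * sg ^ j \<and> s' ''q'' 0 = int ((dd * scale m) ^ j)"
      and fr: "agree_except (writes ?body) ?s s'"
    have "ready ?s" using s by (simp add: ready_def)
    then have e: "ready s'" by (rule ready_frame[OF _ fr]) simp
    show "bval (Less (V ''j'') (V ''m'')) s' \<longleftrightarrow> j < m" using I e by (auto simp: ready_def env_def)
    show "spec ?body s' (return_pmf ()) (\<lambda>_ s'. s' ''j'' 0 = int (Suc j) \<and> s' ''p'' 0 = a * sg ^ Suc j \<and>
        s' ''q'' 0 = int ((dd * scale m) ^ Suc j)) 3" if j: "j < m"
    proof -
      have b1: "\<bar>a * sg ^ Suc j\<bar> \<le> 2 ^ L" using a sg by (simp add: abs_mult power_abs)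
      have "(dd * scale m) ^ Suc j \<le> 2 ^ (dd * scale m * Suc j)" by (rule pow_le_pow2)
      moreover have "dd * scale m * Suc j \<le> dd * scale m * m" using j by (intro mult_le_mono2) simp
      ultimately have b2: "\<bar>int ((dd * scale m) ^ Suc j)\<bar> \<le> 2 ^ L"
        by (intro nat_bound[of _ "dd * scale m * Suc j"]) (auto simp: cellbits_def)
      have b3: "\<bar>int (Suc j)\<bar> \<le> 2 ^ L" using j le_pow_L[of "Suc j"] by (intro nat_bound[of _ L]) (auto simp: cellbits_def)
      have "spec ?body s' (return_pmf ()) (\<lambda>_ s'. s' ''j'' 0 = int (Suc j) \<and> s' ''p'' 0 = a * sg ^ Suc j \<and>
        s' ''q'' 0 = int ((dd * scale m) ^ Suc j)) (1 + (1 + 1))"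
        apply (rule spec_put_seq[where v = "a * sg ^ Suc j"], use I in simp, rule b1)
        apply (rule spec_put_seq[where v = "int ((dd * scale m) ^ Suc j)"], use I e in \<open>simp add: ready_def\<close>, rule b2)
        apply (rule spec_put[where v = "int (Suc j)"], use I in simp, rule b3, simp)
        done
      then show ?thesis by (rule spec_weaken) auto
    qed
  qed (use s in simp)
  then have "spec sign_cmd s (return_pmf ())
     (\<lambda>_ s'. s' ''j'' 0 = int m \<and> s' ''p'' 0 = a * sg ^ m \<and> s' ''q'' 0 = int ((dd * scale m) ^ m)) (1 + (m * (3 + 1) + 1))"
    unfolding sign_cmd_def by (intro spec_assign_seq) auto
  then show ?thesis by (rule spec_weaken) (auto simp: denom_def)
qed

definition total :: nat where
  "total = 17 + (3 * n + 2 + (2 * m * (8 * m + 6) + 2 + (4 * m + 2 + (tstages + 2))))"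

theorem program_spec:
  assumes s: "s ''in'' 2 = int n" "s ''in'' 3 = int m" "s ''in'' 1 div s ''in'' 0 + 1 = int E"
    "\<And>h. h < 2 * m \<Longrightarrow> s ''in'' (4 + int n + int h) = int (vt h)" "xrep {} s"
  shows "spec program s alg (\<lambda>(Y, P) s'. s' ''out'' 0 = numer * int P \<and> s' ''out'' 1 = int (denom * samples m E ^ (m + 1))) total"
proof -
  let ?out = "Assign ''out'' (Num 0) (V ''p'') ;; Assign ''out'' (Num 1) (V ''q'')"
  let ?R = "\<lambda>(Y, P) s'. s' ''out'' 0 = numer * int P \<and> s' ''out'' 1 = int (denom * samples m E ^ (m + 1))"
  have a: "\<bar>2 ^ n * int (card even_sets)\<bar> \<le> 2 ^ L"
  proof -
    have "2 ^ n * card even_sets \<le> 2 ^ n * 2 ^ (2 * m)" using card_even_le by (intro mult_left_mono) (auto simp: power_mult)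
    then have "2 ^ n * card even_sets \<le> 2 ^ (n + 2 * m)" by (simp add: power_add)
    from nat_bound[OF this] show ?thesis by (simp add: cellbits_def)
  qed
  have b: "\<bar>s x i\<bar> \<le> 2 ^ L" if "bounded_cells L s" for s x i using that by (simp add: bounded_cells_def)
  have copy: "spec (c ;; ?out) s alg ?R (tstages + 2)"
    if c: "spec c s alg (\<lambda>(Y, P) s'. s' ''p'' 0 = numer * int P \<and> s' ''q'' 0 = int (denom * samples m E ^ (m + 1))) tstages" for c s
  proof (rule spec_weaken[where t = "tstages + (1 + 1)"], rule spec_seq_after[OF c])
    fix z :: "nat set \<times> nat" and s' :: state
    assume z: "(\<lambda>(Y, P) s'. s' ''p'' 0 = numer * int P \<and> s' ''q'' 0 = int (denom * samples m E ^ (m + 1))) z s'"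
    \<comment> \<open>A specification claims something only for bounded states, so boundedness may
      be assumed; the copied cells then need no separate size estimate.\<close>
    have bound: "spec c s p Q t" if "bounded_cells L s \<Longrightarrow> spec c s p Q t" for c s t and p :: "(nat set \<times> nat) pmf" and Q
      using that by (auto simp: spec_def)
    show "spec ?out s' (return_pmf z) ?R (1 + 1)"
    proof (rule bound)
      assume bd: "bounded_cells L s'"
      show "spec ?out s' (return_pmf z) ?R (1 + 1)"
        by (rule spec_put_seq[OF refl], use b[OF bd] in simp, rule spec_put[OF refl], use b[OF bd] in simp)
          (use z in \<open>auto simp: store_def split: prod.splits\<close>)
    qed
  qed auto
  have "spec program s alg ?R (17 + (3 * n + 2 + (2 * m * (8 * m + 6) + 2 + (4 * m + 2 + (tstages + 2)))))"
    unfolding program_def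
  proof (rule spec_seq_det[OF setup_spec[OF s]])
    fix s1 assume s1: "ready s1 \<and> s1 ''p'' 0 = 1 \<and> s1 ''q'' 0 = 1"
    show "spec (double_cmd ;; count_cmd ;; sign_cmd ;; stages_cmd ;; ?out) s1 alg ?R
      (3 * n + 2 + (2 * m * (8 * m + 6) + 2 + (4 * m + 2 + (tstages + 2))))"
    proof (rule spec_seq_det[OF double_spec])
      fix s2 assume p2: "s2 ''p'' 0 = 2 ^ n" and f2: "agree_except (writes double_cmd) s1 s2"
      have s2: "ready s2" "s2 ''q'' 0 = 1" using s1 ready_frame[OF _ f2] agreeD[OF f2] by auto
      show "spec (count_cmd ;; sign_cmd ;; stages_cmd ;; ?out) s2 alg ?R (2 * m * (8 * m + 6) + 2 + (4 * m + 2 + (tstages + 2)))"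
      proof (rule spec_seq_det[OF count_spec[OF s2(1) p2]])
        fix s3 assume p3: "s3 ''p'' 0 = 2 ^ n * int (card even_sets)" and f3: "agree_except (writes count_cmd) s2 s3"
        have s3: "ready s3" "s3 ''q'' 0 = 1" using s2 ready_frame[OF _ f3] agreeD[OF f3] by auto
        show "spec (sign_cmd ;; stages_cmd ;; ?out) s3 alg ?R (4 * m + 2 + (tstages + 2))"
        proof (rule spec_seq_det[OF sign_spec[OF s3(1) p3 s3(2) a]])
          fix s4 assume p4: "s4 ''p'' 0 = 2 ^ n * int (card even_sets) * sg ^ m \<and> s4 ''q'' 0 = int denom"
            and f4: "agree_except (writes sign_cmd) s3 s4"
          have s4: "ready s4" using s3 ready_frame[OF _ f4] by auto
          show "spec (stages_cmd ;; ?out) s4 alg ?R (tstages + 2)"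
            by (rule copy, rule stages_spec) (use s4 p4 in \<open>auto simp: ready_def numer_def\<close>)
        qed
      qed
    qed (use s1 in auto)
  qed
  then show ?thesis by (simp only: total_def)
qed

end

section \<open>Accuracy of the estimate\<close>

context sampler
begin

text \<open>All samples of the last stage are 0, and so is the product. This settles the case of a
  vanishing partition function, where no positive error is allowed.\<close>

lemma alg_zero:
  assumes "\<And>X. X \<in> even_sets \<Longrightarrow> meas m X = 0" and z: "z \<in> set_pmf alg"
  shows "snd z = 0"
proof -
  have last: "snd y = 0" if X: "X \<in> even_sets" and y: "y \<in> set_pmf (stage m (X, P))" for X P y
  proof -
    have inv: "set_pmf (iter_pmf (\<lambda>_. sample m) 0 N (X, 0)) \<subseteq> even_sets \<times> {0}"
    proof (rule iter_pmf_invariant)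
      fix l :: nat and y assume "y \<in> even_sets \<times> {0 :: nat}"
      then obtain Y where y: "y = (Y, 0)" "Y \<in> even_sets" by auto
      show "set_pmf (sample m y) \<subseteq> even_sets \<times> {0}"
      proof
        fix u assume "u \<in> set_pmf (sample m y)"
        then obtain Y' where Y': "Y' \<in> set_pmf (walk m Y)" "u = (Y', meas m Y')" by (auto simp: sample_def y)
        then have "Y' \<in> even_sets" using walk_even[OF y(2), of m] by blast
        then show "u \<in> even_sets \<times> {0}" using Y' assms(1) by simp
      qed
    qed (use X in simp)
    obtain Y S where YS: "(Y, S) \<in> set_pmf (iter_pmf (\<lambda>_. sample m) 0 N (X, 0))" "y = (Y, P * S)"
      using y by (auto simp: stage_def)
    then have "S = 0" using inv by blast
    then show ?thesis using YS by simp
  qed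
  have "snd z = 0" if "l + n = m" "X \<in> even_sets" "z \<in> set_pmf (iter_pmf stage l (Suc n) (X, P))" for l n X P z
    using that
  proof (induction n arbitrary: l X P)
    case 0
    then show ?case using last[of X z P] by (simp add: bind_return_pmf')
  next
    case (Suc n)
    then obtain y where y: "y \<in> set_pmf (stage l (X, P))" "z \<in> set_pmf (iter_pmf stage (Suc l) (Suc n) y)"
      by auto
    have "fst y \<in> even_sets" using stage_even[of "(X, P)" l] y(1) Suc.prems(2) by auto
    from Suc.IH[OF _ this, of "Suc l" "snd y"] Suc.prems(1) y(2) show ?case by simp
  qed
  from this[of 0 m "{}" z 1] z show ?thesis by (simp add: alg_def)
qed

end

context spin_instance
begin

definition coefficient :: "nat \<Rightarrow> nat" where
  "coefficient p = (if p = 0 then A0 else if p = 1 then A1 else A2)"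

definition even_sum :: real where
  "even_sum = (\<Sum>X\<in>even_sets. \<Prod>j<m. real (coefficient (pat X j)))"

text \<open>The partition function after the change of basis, with the common sign and denominator
  taken out.\<close>

definition target :: real where
  "target = 2 ^ n * real_of_int sg ^ m * even_sum / real dd ^ m"

lemma W_pos: "0 < W i X"
  using W_ge[of i X] by linarith

lemma zsum_pos: "0 < (\<Sum>X\<in>even_sets. W i X)"
  by (rule sum_pos) (simp, use empty_even in blast, simp add: W_pos)

lemma mean_telescope: "i < m \<Longrightarrow> mean i = (\<Sum>X\<in>even_sets. W (Suc i) X) / (\<Sum>X\<in>even_sets. W i X)"
  unfolding mean_def by (simp add: measure_fn_def W_def)

text \<open>Each mean before the last is a ratio of consecutive sums, and at \<open>j = 0\<close>
  all weights are 1.\<close>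

lemma mean_product: "card even_sets * (\<Prod>i<j. mean i) = (\<Sum>X\<in>even_sets. W j X)" if "j \<le> m"
  using that
proof (induction j)
  case (Suc j)
  have "card even_sets * (\<Prod>i<Suc j. mean i) = (\<Sum>X\<in>even_sets. W j X) * mean j"
    using Suc by simp
  also have "\<dots> = (\<Sum>X\<in>even_sets. W (Suc j) X)"
    using zsum_pos[of j] Suc.prems by (simp add: mean_telescope)
  finally show ?case .
qed (simp add: W_def)

lemma weight_nonzero: "real (weight m p) * real (nonzero p) = real (scale m) * real (coefficient p)"
  by (auto simp: weight_def nonzero_def coefficient_def)

lemma mean_last: "(\<Sum>X\<in>even_sets. W m X * measure_fn m X) = real (scale m) ^ m * even_sum"
proof -
  have "W m X * measure_fn m X = real (scale m) ^ m * (\<Prod>j<m. real (coefficient (pat X j)))" for X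
    by (simp add: W_def measure_fn_def prod.distrib[symmetric] weight_nonzero) (simp add: prod.distrib)
  then show ?thesis by (simp add: even_sum_def sum_distrib_left)
qed

lemma mean_total: "card even_sets * (\<Prod>i<m + 1. mean i) = real (scale m) ^ m * even_sum"
proof -
  have "card even_sets * (\<Prod>i<m + 1. mean i) = (\<Sum>X\<in>even_sets. W m X) * mean m"
    using mean_product[of m] by simp
  also have "\<dots> = (\<Sum>X\<in>even_sets. W m X * measure_fn m X)"
    using zsum_pos[of m] by (simp add: mean_def)
  finally show ?thesis by (simp add: mean_last)
qed

text \<open>The error of the output is a fixed multiple of the deviation of the random product from
  its ideal value, so relative accuracy carries over.\<close>

lemma estimate_eq:
  fixes P :: real
  shows "numer * P / real (denom * samples m E ^ (m + 1)) - target =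
    numer / real (denom * samples m E ^ (m + 1)) * (P - (\<Prod>i<m + 1. samples m E * mean i))"
proof -
  have N0: "0 < samples m E" using N_eq J1 B1 by simp
  have d0: "0 < dd * scale m" using dd_pos scale1[of m] by simp
  have "numer * (\<Prod>i<m + 1. samples m E * mean i) =
      2 ^ n * real_of_int sg ^ m * real (samples m E) ^ (m + 1) * (card even_sets * (\<Prod>i<m + 1. mean i))"
    by (simp add: numer_def prod.distrib mult_ac)
  also have "\<dots> = target * real (denom * samples m E ^ (m + 1))"
    unfolding mean_total target_def denom_def using dd_pos
    by (simp add: power_mult_distrib field_simps)
  finally have t: "numer * (\<Prod>i<m + 1. samples m E * mean i) = target * real (denom * samples m E ^ (m + 1))" .
  have "real (denom * samples m E ^ (m + 1)) \<noteq> 0" using N0 d0 by (simp add: denom_def)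
  then have "target = numer * (\<Prod>i<m + 1. samples m E * mean i) / real (denom * samples m E ^ (m + 1))"
    by (metis t nonzero_mult_div_cancel_right)
  then show ?thesis by (simp only: right_diff_distrib diff_divide_distrib times_divide_eq_left)
qed

text \<open>Before the last stage the measured weights are at least 1. In the last stage the mean is
  the share of sets without a substitute weight, and \<open>forbidden_mass\<close> applies because
  the feasible set \<open>X\<close> serves as its witness.\<close>

lemma mean_ge_half:
  assumes feasible: "X \<in> even_sets" "measure_fn m X \<noteq> 0" and i: "i \<le> m"
  shows "1 / 2 \<le> mean i"
proof -
  have big: "1 / 2 \<le> mean i" if "(\<Sum>X\<in>even_sets. W i X) \<le> 2 * (\<Sum>X\<in>even_sets. W i X * measure_fn i X)"
    unfolding mean_def using that zsum_pos[of i] by (simp add: divide_simps)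
  have ge1: "1 / 2 \<le> mean i" if "\<And>X. X \<in> even_sets \<Longrightarrow> 1 \<le> measure_fn i X"
  proof (rule big)
    have "(\<Sum>X\<in>even_sets. W i X * 1) \<le> (\<Sum>X\<in>even_sets. W i X * measure_fn i X)"
      using that by (intro sum_mono mult_left_mono) (auto intro: less_imp_le[OF W_pos])
    moreover have "0 \<le> (\<Sum>X\<in>even_sets. W i X * measure_fn i X)"
      by (intro sum_nonneg mult_nonneg_nonneg) (auto intro: less_imp_le[OF W_pos])
    ultimately show "(\<Sum>X\<in>even_sets. W i X) \<le> 2 * (\<Sum>X\<in>even_sets. W i X * measure_fn i X)" by simp
  qed
  \<comment> \<open>Pattern 1 always has a positive coefficient, and at most one of
    \<open>A0\<close> and \<open>A2\<close> vanishes, so there is a single forbidden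
    pattern.\<close>
  consider "i < m" | "i = m" "0 < A0" "0 < A2" | b :: nat where "i = m" "b = 0 \<and> A0 = 0 \<or> b = 2 \<and> A2 = 0"
    using i by force
  then show ?thesis
  proof cases
    case 1
    then show ?thesis using weight_bounds(1)[of m] by (intro ge1) (simp add: measure_fn_def)
  next
    case 2
    then have "nonzero p = 1" for p by (simp add: nonzero_def)
    then show ?thesis using 2 by (intro ge1) (simp add: measure_fn_def)
  next
    case (3 b)
    have nz: "nonzero p = of_bool (p \<noteq> b)" if "p \<le> 2" for p
      using 3(2) A02 that by (auto simp: nonzero_def)
    interpret forbidden_pattern m vt "\<lambda>p. real (weight m p)" b "real (scale m)" "real Wm"
    proof
      show "b = 0 \<or> b = 2" "real (weight m b) = 1" using 3(2) by (auto simp: weight_def)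
      show "1 \<le> real (scale m)" "1 \<le> real Wm" using scale1[of m] Wm1 by simp_all
      show "real (scale m) \<le> real (weight m p)" if "p \<le> 2" "p \<noteq> b" for p
      proof -
        have one: "nonzero p = 1" using nz that by simp
        have "real (weight m p) = real (scale m) * real (coefficient p)" using weight_nonzero[of p] one by simp
        moreover have "nonzero p = of_bool (0 < coefficient p)" by (simp add: nonzero_def coefficient_def A1_pos)
        then have "0 < coefficient p" using one by (metis of_bool_eq_1_iff)
        ultimately show ?thesis by (simp add: mult_le_cancel_left1)
      qed
      show "real (weight m p) \<le> real Wm * real (scale m)" for p
        using weight_bounds(2)[of m p] by (simp add: wmax_def flip: of_nat_mult)
    qed
    have me: "measure_fn m Y = of_bool (\<forall>j<m. pat Y j \<noteq> b)" for Y
      by (auto simp: measure_fn_def nz pat_le_2)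
    have fX: "\<And>j. j < m \<Longrightarrow> pat X j \<noteq> b" using feasible(2) unfolding me by (simp split: if_splits)
    let ?bad = "{X. X \<in> even_sets \<and> (\<exists>j<m. pat X j = b)}"
    \<comment> \<open>The loss \<open>Wm * (2 * m + 1) ^ 3\<close> is half of
      \<open>scale m\<close>, so the factor \<open>scale m\<close> cancels.\<close>
    have "real (scale m) * (2 * (\<Sum>X\<in>?bad. W m X)) \<le> real (scale m) * (\<Sum>X\<in>even_sets. W m X)"
      using forbidden_mass[OF feasible(1) fX] by (simp add: scale_def W_def mult_ac)
    then have "2 * (\<Sum>X\<in>?bad. W m X) \<le> (\<Sum>X\<in>even_sets. W m X)" using scale1[of m] by simp
    moreover have "(\<Sum>X\<in>even_sets. W m X * measure_fn m X) + (\<Sum>X\<in>?bad. W m X) = (\<Sum>X\<in>even_sets. W m X)"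
    proof -
      have "(\<Sum>X\<in>?bad. W m X) = (\<Sum>X\<in>even_sets. if \<exists>j<m. pat X j = b then W m X else 0)"
        by (rule sum.inter_filter) simp
      then show ?thesis unfolding sum.distrib[symmetric]
        by (simp only: sum.distrib[symmetric]) (auto simp: me intro!: sum.cong)
    qed
    ultimately show ?thesis using 3(1) by (intro big) simp
  qed
qed

theorem estimate_accurate:
  fixes e :: real
  assumes e: "0 < e" "1 \<le> e * E"
  shows "3 / 4 \<le> measure_pmf.prob alg
    {z. \<bar>numer * real (snd z) / real (denom * samples m E ^ (m + 1)) - target\<bar> \<le> e * \<bar>target\<bar>}"
proof (cases "\<exists>X\<in>even_sets. measure_fn m X \<noteq> 0")
  case False
  then have z: "\<And>X. X \<in> even_sets \<Longrightarrow> measure_fn m X = 0" by blast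
  have "real (scale m) ^ m * even_sum = 0" unfolding mean_last[symmetric] using z by simp
  then have "target = 0" using scale1[of m] by (simp add: target_def)
  then have "z \<in> {z. \<bar>numer * real (snd z) / real (denom * samples m E ^ (m + 1)) - target\<bar> \<le> e * \<bar>target\<bar>}"
    if "z \<in> set_pmf alg" for z
    using alg_zero[OF z that] by simp
  then have "AE z in measure_pmf alg. z \<in> {z. \<bar>numer * real (snd z) / real (denom * samples m E ^ (m + 1)) - target\<bar> \<le> e * \<bar>target\<bar>}"
    by (auto simp: AE_measure_pmf_iff)
  then show ?thesis by (subst measure_pmf.prob_eq_1[THEN iffD2]) auto
next
  case True
  then obtain X where X: "X \<in> even_sets" "measure_fn m X \<noteq> 0" by blast
  let ?M = "\<Prod>i<m + 1. samples m E * mean i"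
  let ?c = "numer / real (denom * samples m E ^ (m + 1))"
  have half: "\<And>i. i \<le> m \<Longrightarrow> 1 / 2 \<le> mean i" by (rule mean_ge_half[OF X])
  have "0 \<le> mean i" if "i \<le> m" for i using half[OF that] by linarith
  then have M0: "0 \<le> ?M" by (intro prod_nonneg) auto
  have t: "target = ?c * ?M"
    using estimate_eq[of ?M] by (simp add: algebra_simps)
  have "40 * real (m + 1) * 1 \<le> 40 * real (m + 1) * (e * E)\<^sup>2"
    using e by (intro mult_left_mono) (auto simp: one_le_power)
  then have J: "40 * real (m + 1) \<le> real (prec m E) * e\<^sup>2" by (simp add: prec_def power_mult_distrib mult_ac)
  have "40 * (m + 1) * 1 \<le> prec m E" unfolding prec_def using E1 by (intro mult_left_mono) auto
  then have J40: "40 * (m + 1) \<le> prec m E" by simp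
  have "3 / 4 \<le> measure_pmf.prob alg {z. \<bar>real (snd z) - ?M\<bar> \<le> e * ?M}"
    using alg_accurate[OF half e(1) _ J40] J by simp
  also have "\<dots> \<le> measure_pmf.prob alg {z. \<bar>numer * real (snd z) / real (denom * samples m E ^ (m + 1)) - target\<bar> \<le> e * \<bar>target\<bar>}"
  proof (rule measure_pmf.finite_measure_mono)
    show "{z. \<bar>real (snd z) - ?M\<bar> \<le> e * ?M} \<subseteq>
      {z. \<bar>numer * real (snd z) / real (denom * samples m E ^ (m + 1)) - target\<bar> \<le> e * \<bar>target\<bar>}"
    proof (intro subsetI CollectI)
      fix z assume "z \<in> {z. \<bar>real (snd z) - ?M\<bar> \<le> e * ?M}"
      then have "\<bar>real (snd z) - ?M\<bar> \<le> e * ?M" by (rule CollectD)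
      then have "\<bar>?c\<bar> * \<bar>real (snd z) - ?M\<bar> \<le> \<bar>?c\<bar> * (e * ?M)" by (intro mult_left_mono) auto
      also have "\<dots> = e * \<bar>target\<bar>" unfolding t abs_mult using M0 by simp
      finally show "\<bar>numer * real (snd z) / real (denom * samples m E ^ (m + 1)) - target\<bar> \<le> e * \<bar>target\<bar>"
        unfolding estimate_eq by (simp only: abs_mult)
    qed
  qed simp
  finally show ?thesis .
qed

end

section \<open>Polynomial running time\<close>

text \<open>Closed under sums, products and powers, so that the bound for the whole running time
  follows from its syntactic shape.\<close>

definition poly_bounded :: "(nat \<Rightarrow> nat \<Rightarrow> nat \<Rightarrow> nat \<Rightarrow> nat) \<Rightarrow> bool" where
  "poly_bounded f \<longleftrightarrow> (\<exists>C d. \<forall>n m E z. f n m E z \<le> C * (n + m + E + z + 1) ^ d)"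

lemma poly_bounded_mono: "poly_bounded g \<Longrightarrow> (\<And>n m E z. f n m E z \<le> g n m E z) \<Longrightarrow> poly_bounded f"
  unfolding poly_bounded_def by (meson order_trans)

lemma poly_bounded_const: "poly_bounded (\<lambda>_ _ _ _. c)"
  unfolding poly_bounded_def by (intro exI[of _ c] exI[of _ 0]) simp

lemma poly_bounded_var:
  "poly_bounded (\<lambda>n m E z. n)" "poly_bounded (\<lambda>n m E z. m)" "poly_bounded (\<lambda>n m E z. E)" "poly_bounded (\<lambda>n m E z. z)"
  unfolding poly_bounded_def by (intro exI[of _ 1] exI[of _ 1]; simp)+

lemma poly_bounded_add:
  assumes "poly_bounded f" "poly_bounded g"
  shows "poly_bounded (\<lambda>n m E z. f n m E z + g n m E z)"
proof -
  obtain C d C' d' where f: "\<And>n m E z. f n m E z \<le> C * (n + m + E + z + 1) ^ d"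
    and g: "\<And>n m E z. g n m E z \<le> C' * (n + m + E + z + 1) ^ d'"
    using assms unfolding poly_bounded_def by metis
  have "f n m E z + g n m E z \<le> (C + C') * (n + m + E + z + 1) ^ (d + d')" for n m E z
  proof -
    let ?y = "n + m + E + z + 1"
    have "C * ?y ^ d \<le> C * ?y ^ (d + d')" "C' * ?y ^ d' \<le> C' * ?y ^ (d + d')"
      by (intro mult_left_mono power_increasing; simp)+
    then show ?thesis using f[of n m E z] g[of n m E z] unfolding add_mult_distrib by linarith
  qed
  then show ?thesis unfolding poly_bounded_def by blast
qed

lemma poly_bounded_mult:
  assumes "poly_bounded f" "poly_bounded g"
  shows "poly_bounded (\<lambda>n m E z. f n m E z * g n m E z)"
proof -
  obtain C d C' d' where f: "\<And>n m E z. f n m E z \<le> C * (n + m + E + z + 1) ^ d"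
    and g: "\<And>n m E z. g n m E z \<le> C' * (n + m + E + z + 1) ^ d'"
    using assms unfolding poly_bounded_def by metis
  have "f n m E z * g n m E z \<le> (C * C') * (n + m + E + z + 1) ^ (d + d')" for n m E z
    using mult_mono[OF f[of n m E z] g[of n m E z]] by (simp add: power_add mult_ac)
  then show ?thesis unfolding poly_bounded_def by blast
qed

lemma poly_bounded_power: "poly_bounded f \<Longrightarrow> poly_bounded (\<lambda>n m E z. f n m E z ^ j)"
proof (induction j)
  case 0
  then show ?case using poly_bounded_const[of 1] by simp
next
  case (Suc j)
  then show ?case using poly_bounded_mult[of f "\<lambda>n m E z. f n m E z ^ j"] by simp
qed

lemmas poly_bounded_intros =
  poly_bounded_const poly_bounded_var poly_bounded_add poly_bounded_mult poly_bounded_power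

context spin_program
begin

text \<open>The same number as \<open>total\<close>, restated where \<open>n\<close>,
  \<open>m\<close> and \<open>E\<close> are not fixed, because the polynomial must be chosen before
  the instance.\<close>

definition run_steps :: "nat \<Rightarrow> nat \<Rightarrow> nat \<Rightarrow> nat" where
  "run_steps n m E = 17 + (3 * n + 2 + (2 * m * (8 * m + 6) + 2 + (4 * m + 2 +
     ((m + 1) * (samples m E * (steps m E * (12 * nbits m + 23 + 2) + 2 + 3 * m + 5 + 2) + 5 + 2) + 2 + 2))))"

lemma poly_bounded_run: "poly_bounded (\<lambda>n m E z. run_steps n m E * (K * cellbits n m E z))"
proof -
  \<comment> \<open>\<open>nbits\<close> is a minimum and not a polynomial expression, so its bound
    \<open>rng m\<close> takes its place.\<close>
  have k: "poly_bounded (\<lambda>n m E z. nbits m)"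
    by (rule poly_bounded_mono[where g = "\<lambda>n m E z. rng m"])
      (simp_all only: nbits_props, unfold rng_def wmax_def scale_def, intro poly_bounded_intros)
  show ?thesis
    unfolding run_steps_def cellbits_def samples_def steps_def prec_def rng_def wmax_def scale_def
    by (intro poly_bounded_intros k)
qed

end

section \<open>The approximation scheme\<close>

definition ends :: "(nat \<times> nat) list \<Rightarrow> nat list" where
  "ends es = concat (map (\<lambda>(u, v). [u, v]) es)"

lemma length_ends: "length (ends es) = 2 * length es"
  by (induction es) (auto simp: ends_def)

lemma nth_ends: "j < length es \<Longrightarrow> ends es ! (2 * j) = fst (es ! j) \<and> ends es ! (2 * j + 1) = snd (es ! j)"
proof (induction es arbitrary: j)
  case (Cons e es)
  then show ?case by (cases j) (auto simp: ends_def split: prod.splits)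
qed simp

lemma prod_mset_list: "(\<Prod>e\<in>#mset (map f xs). g e) = (\<Prod>j<length xs. g (f (xs ! j)))"
proof (induction xs rule: rev_induct)
  case (snoc x xs)
  have "(\<Prod>j<length xs. g (f ((xs @ [x]) ! j))) = (\<Prod>j<length xs. g (f (xs ! j)))"
    by (intro prod.cong refl) (simp add: nth_append)
  then show ?case using snoc by (simp add: mult.commute)
qed simp

lemma partition_function_even_sets:
  fixes \<beta> \<gamma> :: rat
  assumes es: "mset (map (\<lambda>(u, v). Upair u v) es) = edges G" and G: "multigraph G"
  defines "w \<equiv> \<lambda>p. if p = 0 then (\<beta> + \<gamma> + 2) / 4 else if p = 1 then (\<beta> - \<gamma>) / 4 else (\<beta> + \<gamma> - 2) / (4 :: rat)"
  shows "partition_function \<beta> \<gamma> G = 2 ^ card (verts G) *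
    (\<Sum>X\<in>half_edge_graph.even_sets (length es) ((!) (ends es)). \<Prod>j<length es. w (pat X j))"
proof -
  define A where "A i j = (if i = 0 \<and> j = 0 then \<beta> else if i = 1 \<and> j = 1 then \<gamma> else 1)" for i j :: nat
  have edge: "case_uprod (interaction \<beta> \<gamma>) (map_uprod \<sigma> (Upair u v)) = A (\<sigma> u) (\<sigma> v)" for \<sigma> u v
    by (simp add: interaction.rep_eq A_def)
  have in_verts: "ends es ! h \<in> verts G" if h: "h < 2 * length es" for h
  proof -
    have "h div 2 < length es" using h by simp
    then have "es ! (h div 2) \<in> set es" by simp
    then have "(\<lambda>(u, v). Upair u v) (es ! (h div 2)) \<in># edges G" unfolding es[symmetric] by auto
    then have "set_uprod ((\<lambda>(u, v). Upair u v) (es ! (h div 2))) \<subseteq> verts G" using G by (auto simp: multigraph_def)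
    then have "fst (es ! (h div 2)) \<in> verts G" "snd (es ! (h div 2)) \<in> verts G" by (auto split: prod.splits)
    then show ?thesis using nth_ends[OF \<open>h div 2 < length es\<close>]
      by (cases "even h") (auto elim!: evenE oddE)
  qed
  have "partition_function \<beta> \<gamma> G = (\<Sum>\<sigma>\<in>verts G \<rightarrow>\<^sub>E {0, 1}. \<Prod>j<length es.
      A (\<sigma> (ends es ! (2 * j))) (\<sigma> (ends es ! (2 * j + 1))))"
    unfolding partition_function_def es[symmetric] prod_mset_list
  proof (intro sum.cong prod.cong refl)
    fix \<sigma> j assume "j \<in> {..<length es}"
    then show "case_uprod (interaction \<beta> \<gamma>) (map_uprod \<sigma> (case es ! j of (u, v) \<Rightarrow> Upair u v)) =
        A (\<sigma> (ends es ! (2 * j))) (\<sigma> (ends es ! (2 * j + 1)))"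
      using nth_ends[of j es] edge by (auto split: prod.splits)
  qed
  also have "\<dots> = 2 ^ card (verts G) *
    (\<Sum>X\<in>half_edge_graph.even_sets (length es) ((!) (ends es)). \<Prod>j<length es. w (pat X j))"
  proof (rule half_edge_graph.spin_sum_even_sets)
    show "finite (verts G)" using G by (simp add: multigraph_def)
    show "(!) (ends es) ` {..<2 * length es} \<subseteq> verts G" using in_verts by auto
    \<comment> \<open>The three values of \<open>w\<close> solve
      \<open>w 0 + 2 * w 1 + w 2 = \<beta>\<close>, \<open>w 0 - w 2 = 1\<close> and
      \<open>w 0 - 2 * w 1 + w 2 = \<gamma>\<close>.\<close>
    show "A s t = w 0 + w 1 * ((- 1) ^ s + (- 1) ^ t) + w 2 * ((- 1) ^ s * (- 1) ^ t)"
      if "s \<in> {0, 1}" "t \<in> {0, 1}" for s t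
      using that by (auto simp: A_def w_def field_simps)
  qed
  finally show ?thesis .
qed

text \<open>Over the common denominator \<open>D\<close> the hypothesis reads
  \<open>2 * D \<le> \<bar>x + y\<bar>\<close>, so \<open>x + y + 2 * D\<close> and
  \<open>x + y - 2 * D\<close> have the sign of \<open>x + y\<close> or vanish. The sign of
  \<open>x - y\<close> relative to it is \<open>t\<close>.\<close>

lemma integer_weights:
  fixes \<beta> \<gamma> :: rat
  assumes "\<beta> \<noteq> \<gamma>" "\<bar>\<beta> + \<gamma>\<bar> \<ge> 2"
  obtains A0 A1 A2 dd :: nat and sg t :: int where "spin_program A0 A1 A2 dd sg" "t * t = 1"
    "(\<beta> + \<gamma> + 2) / 4 = of_int sg * of_nat A0 / of_nat dd"
    "(\<beta> - \<gamma>) / 4 = of_int sg * of_int t * of_nat A1 / of_nat dd"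
    "(\<beta> + \<gamma> - 2) / 4 = of_int sg * of_nat A2 / of_nat dd"
proof -
  obtain x1 d1 where q1: "quotient_of \<beta> = (x1, d1)" by force
  obtain x2 d2 where q2: "quotient_of \<gamma> = (x2, d2)" by force
  have d: "0 < d1" "0 < d2" using quotient_of_denom_pos[OF q1] quotient_of_denom_pos[OF q2] by auto
  define D x y where "D = d1 * d2" and "x = x1 * d2" and "y = x2 * d1"
  have D: "0 < D" using d by (simp add: D_def)
  have \<beta>: "\<beta> = of_int x / of_int D" and \<gamma>: "\<gamma> = of_int y / of_int D"
    using quotient_of_div[OF q1] quotient_of_div[OF q2] d by (simp_all add: D_def x_def y_def)
  have xy: "x \<noteq> y" using assms(1) \<beta> \<gamma> by auto
  have s: "\<beta> + \<gamma> = of_int (x + y) / of_int D" by (simp add: \<beta> \<gamma> add_divide_distrib)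
  have "(of_int (2 * D) :: rat) \<le> of_int \<bar>x + y\<bar>"
    using assms(2) D unfolding s by (simp add: abs_divide field_simps)
  then have big: "2 * D \<le> \<bar>x + y\<bar>" by (simp only: of_int_le_iff)
  define sg t where "sg = (if 0 < x + y then 1 else - 1 :: int)" and "t = (if 0 < x + y \<longleftrightarrow> 0 < x - y then 1 else - 1 :: int)"
  have a0: "x + y + 2 * D = sg * int (nat \<bar>x + y + 2 * D\<bar>)" and a2: "x + y - 2 * D = sg * int (nat \<bar>x + y - 2 * D\<bar>)"
    using big D by (auto simp: sg_def)
  have a1: "x - y = sg * t * int (nat \<bar>x - y\<bar>)" using xy by (auto simp: sg_def t_def)
  have dd: "(of_nat (nat (4 * D)) :: rat) = 4 * of_int D" using D by simp
  have r: "(of_int a :: rat) = of_int sg * of_nat (nat \<bar>a\<bar>)" if "a = sg * int (nat \<bar>a\<bar>)" for a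
    by (subst that) simp
  have r1: "(of_int (x - y) :: rat) = of_int sg * of_int t * of_nat (nat \<bar>x - y\<bar>)"
    by (subst a1) simp
  have D0: "(of_int D :: rat) \<noteq> 0" using D by simp
  show ?thesis
  proof (rule that)
    show "spin_program (nat \<bar>x + y + 2 * D\<bar>) (nat \<bar>x - y\<bar>) (nat \<bar>x + y - 2 * D\<bar>) (nat (4 * D)) sg"
      using xy D by unfold_locales (auto simp: sg_def)
    show "t * t = 1" by (simp add: t_def)
    show "(\<beta> + \<gamma> + 2) / 4 = of_int sg * of_nat (nat \<bar>x + y + 2 * D\<bar>) / of_nat (nat (4 * D))"
      unfolding dd r[OF a0, symmetric] s using D0 by (simp add: field_simps)
    show "(\<beta> - \<gamma>) / 4 = of_int sg * of_int t * of_nat (nat \<bar>x - y\<bar>) / of_nat (nat (4 * D))"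
      unfolding dd r1[symmetric] \<beta> \<gamma> using D0 by (simp add: field_simps)
    show "(\<beta> + \<gamma> - 2) / 4 = of_int sg * of_nat (nat \<bar>x + y - 2 * D\<bar>) / of_nat (nat (4 * D))"
      unfolding dd r[OF a2, symmetric] s using D0 by (simp add: field_simps)
  qed
qed

lemma (in spin_instance) target_partition_function:
  fixes \<beta> \<gamma> :: rat
  assumes es: "mset (map (\<lambda>(u, v). Upair u v) es) = edges G" and G: "multigraph G"
    and m: "m = length es" and n: "n = card (verts G)" and vt: "vt = (!) (ends es)"
    and t: "t * t = (1 :: int)"
    and w: "(\<beta> + \<gamma> + 2) / 4 = of_int sg * of_nat A0 / of_nat dd"
      "(\<beta> - \<gamma>) / 4 = of_int sg * of_int t * of_nat A1 / of_nat dd"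
      "(\<beta> + \<gamma> - 2) / 4 = of_int sg * of_nat A2 / of_nat dd"
  shows "real_of_rat (partition_function \<beta> \<gamma> G) = target"
proof -
  let ?w = "\<lambda>p. if p = 0 then (\<beta> + \<gamma> + 2) / 4 else if p = 1 then (\<beta> - \<gamma>) / 4 else (\<beta> + \<gamma> - 2) / (4 :: rat)"
  have tt: "(of_int t :: rat) * of_int t = 1" using t by (metis of_int_1 of_int_mult)
  have pw: "?w p = of_int sg * of_int t ^ p * (of_nat (coefficient p) / of_nat dd)" if "p \<le> 2" for p
  proof -
    consider "p = 0" | "p = 1" | "p = 2" using \<open>p \<le> 2\<close> by linarith
    then show ?thesis using w tt by cases (auto simp: coefficient_def power2_eq_square)
  qed
  have "partition_function \<beta> \<gamma> G = 2 ^ n * (\<Sum>X\<in>even_sets. \<Prod>j<m. ?w (pat X j))"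
    unfolding partition_function_even_sets[OF es G] m n vt ..
  also have "\<dots> = 2 ^ n * (\<Sum>X\<in>even_sets. of_int sg ^ m * (\<Prod>j<m. of_nat (coefficient (pat X j)) / of_nat dd))"
    by (intro arg_cong[where f = "(*) (2 ^ n)"] sum.cong refl even_sets_sign[OF _ tt pw])
  also have "\<dots> = 2 ^ n * of_int sg ^ m * (\<Sum>X\<in>even_sets. \<Prod>j<m. of_nat (coefficient (pat X j))) / of_nat dd ^ m"
    by (simp add: prod_dividef sum_distrib_left sum_divide_distrib mult.assoc)
  finally show ?thesis
    by (simp add: target_def even_sum_def of_rat_mult of_rat_divide of_rat_power of_rat_sum of_rat_prod)
qed

lemma int_size_le_input_size: "k \<in> set w \<Longrightarrow> int_size k \<le> input_size w"
  unfolding input_size_def by (rule member_le_sum_list) auto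

lemma length_le_input_size: "length w \<le> input_size w"
  unfolding input_size_def by (induction w) (auto simp: int_size_def)

text \<open>A coupling with a genuine probability distribution yields termination, a property of
  every run, and a lower bound for the probability of success.\<close>

lemma rel_spmf_of_pmfD:
  assumes R: "rel_spmf R p (spmf_of_pmf q)"
  shows "lossless_spmf p"
    and "x \<in> set_spmf p \<Longrightarrow> \<exists>y. R x y"
    and "measure_pmf.prob q A \<le> measure (measure_spmf p) {x. \<exists>y\<in>A. R x y}"
proof -
  show "lossless_spmf p" using rel_spmf_weightD[OF R] by (simp add: lossless_spmf_def)
  show "\<exists>y. R x y" if "x \<in> set_spmf p"
    using rel_setD1[OF rel_funD[OF set_spmf_parametric R] that] by blast
  \<comment> \<open>\<open>rel_spmf_measureD\<close> bounds events on the left by events on the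
    right, so the relation is turned round.\<close>
  have "rel_spmf R\<inverse>\<inverse> (spmf_of_pmf q) p" unfolding spmf_rel_conversep using R by simp
  from rel_spmf_measureD[OF this, of A] show "measure_pmf.prob q A \<le> measure (measure_spmf p) {x. \<exists>y\<in>A. R x y}"
    by simp
qed

theorem theorem3:
  fixes \<beta> \<gamma> :: rat
  assumes "\<beta> \<noteq> \<gamma>"
    and "\<bar>\<beta> + \<gamma>\<bar> \<ge> 2"
  shows "\<exists>P. is_fpras P encodes_mgraph (partition_function \<beta> \<gamma>)"
proof -
  obtain A0 A1 A2 dd :: nat and sg t :: int where sp: "spin_program A0 A1 A2 dd sg" and t: "t * t = 1"
    and w: "(\<beta> + \<gamma> + 2) / 4 = of_int sg * of_nat A0 / of_nat dd"
      "(\<beta> - \<gamma>) / 4 = of_int sg * of_int t * of_nat A1 / of_nat dd"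
      "(\<beta> + \<gamma> - 2) / 4 = of_int sg * of_nat A2 / of_nat dd"
    using integer_weights[OF assms] by blast
  interpret spin_program A0 A1 A2 dd sg by (rule sp)
  \<comment> \<open>The program depends on \<beta> and \<gamma> alone, so \<open>K\<close> is a
    constant of the scheme.\<close>
  define K where "K = ccoef program"
  obtain C d where Cd: "\<And>n m E z. run_steps n m E * (K * cellbits n m E z) \<le> C * (n + m + E + z + 1) ^ d"
    using poly_bounded_run[of K] unfolding poly_bounded_def by blast
  \<comment> \<open>\<open>n\<close> and \<open>m\<close> are at most \<open>z\<close>, and
    \<open>E\<close> is at most 1/\<epsilon> + 1, so the argument \<open>n + m + E + z + 1\<close>
    is at most \<open>2 + 3 * (z + 1 / \<epsilon>)\<close>.\<close>
  define p :: "real poly" where "p = smult C ([:2, 3:] ^ d)"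
  have main: "lossless_spmf (exec program (initial_state (a # b # ws)))"
    "\<forall>(s, u)\<in>set_spmf (exec program (initial_state (a # b # ws))).
       real u \<le> poly p (real (input_size (a # b # ws)) + 1 / of_rat \<epsilon>)"
    "3 / 4 \<le> measure (measure_spmf (exec program (initial_state (a # b # ws)))) {(s, u). approximates \<epsilon> (partition_function \<beta> \<gamma> G) s}"
    if enc: "encodes_mgraph G ws" and \<epsilon>: "0 < \<epsilon>" and q: "quotient_of \<epsilon> = (a, b)" for G ws \<epsilon> a b
  proof -
    obtain vs es where G: "multigraph G" and vs: "distinct vs" "set vs = verts G"
      and es: "mset (map (\<lambda>(u, v). Upair u v) es) = edges G"
      and ws: "ws = map int (length vs # length es # vs @ ends es)"
      using enc unfolding encodes_mgraph_def ends_def by blast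
    define n m z E where "n = length vs" and "m = length es" and "z = input_size (a # b # ws)" and "E = nat (b div a) + 1"
    let ?s = "initial_state (a # b # ws)"
    let ?vt = "(!) (ends es)"
    interpret spin_instance A0 A1 A2 dd sg m ?vt K n E z
      by unfold_locales (auto simp: cellbits_def E_def)
    have b: "0 < b" by (rule quotient_of_denom_pos[OF q])
    have eq: "\<epsilon> = of_int a / of_int b" by (rule quotient_of_div[OF q])
    have a: "0 < a" using \<epsilon> b by (simp add: eq zero_less_divide_iff)
    have re: "real_of_rat \<epsilon> = a / b" by (simp add: eq of_rat_divide)
    have E_int: "int E = b div a + 1" using a b by (simp add: E_def pos_imp_zdiv_nonneg_iff)
    have "b < a * int E" unfolding E_int using a by (simp add: distrib_left) (metis mult.commute pos_mod_bound add.commute mult_div_mod_eq add_less_cancel_left)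
    then have "real_of_int b \<le> real_of_int (a * int E)" by linarith
    then have eE: "1 \<le> real_of_rat \<epsilon> * E" using b by (simp add: re field_simps)
    have "a * (b div a) \<le> b" using a by (metis mult.commute mult_div_mod_eq pos_mod_sign le_add_same_cancel1)
    then have "real_of_int (a * (b div a)) \<le> real_of_int b" by linarith
    then have "real_of_int (b div a) \<le> b / a" using a by (simp add: field_simps)
    then have E_le: "real E \<le> 1 / real_of_rat \<epsilon> + 1" using E_int by (simp add: re)
    have inp: "?s ''in'' i = (a # b # ws) ! nat i" if "0 \<le> i" "i < int (length (a # b # ws))" for i
      using that by (simp add: initial_state_def)
    have len: "length ws = n + 2 * m + 2" by (simp add: ws n_def m_def length_ends)
    have s_in: "?s ''in'' 2 = int n" "?s ''in'' 3 = int m" "?s ''in'' 1 div ?s ''in'' 0 + 1 = int E"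
      using E_int by (simp_all add: inp len) (simp_all add: ws n_def m_def numeral_2_eq_2 numeral_3_eq_3)
    have s_vt: "?s ''in'' (4 + int n + int h) = int (?vt h)" if h: "h < 2 * m" for h
    proof -
      have "nat (4 + int n + int h) = Suc (Suc (Suc (Suc (n + h))))" by simp
      then have "?s ''in'' (4 + int n + int h) = (a # b # ws) ! Suc (Suc (Suc (Suc (n + h))))"
        using h by (subst inp) (auto simp: len)
      also have "\<dots> = int ((vs @ ends es) ! (n + h))"
        using h by (simp add: ws n_def m_def length_ends nth_append)
      finally show ?thesis by (simp add: n_def nth_append)
    qed
    \<comment> \<open>The summand \<open>z\<close> of \<open>cellbits\<close> serves this purpose:
      no input integer is longer than the whole input.\<close>
    have bd: "bounded_cells L ?s"
      unfolding bounded_cells_def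
    proof (intro allI)
      fix x i
      show "\<bar>?s x i\<bar> \<le> 2 ^ L"
      proof (cases "x = ''in'' \<and> 0 \<le> i \<and> i < int (length (a # b # ws))")
        case True
        then have x: "x = ''in''" and i: "0 \<le> i" "i < int (length (a # b # ws))" by blast+
        have v: "?s x i = (a # b # ws) ! nat i" unfolding x by (rule inp[OF i])
        have "nat i < length (a # b # ws)" using i by (simp only: nat_less_iff)
        then have "int_size (?s x i) \<le> z" unfolding v z_def by (intro int_size_le_input_size nth_mem)
        moreover have "z \<le> L" by (simp add: cellbits_def)
        moreover have "\<bar>?s x i\<bar> \<le> 2 ^ int_size (?s x i)" by (rule abs_le_int_size)
        ultimately show ?thesis by (meson order_trans power_increasing one_le_numeral)
      qed (auto simp: initial_state_def)
    qed
    have xr: "xrep {} ?s" by (simp add: xrep_def initial_state_def)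
    let ?R = "\<lambda>(s' :: state, u :: nat) (y :: nat set \<times> nat). s' ''out'' 0 = numer * int (snd y) \<and> s' ''out'' 1 = int (denom * samples m E ^ (m + 1)) \<and>
        u \<le> total * (K * L)"
    have "spec program ?s alg (\<lambda>(Y, P) s'. s' ''out'' 0 = numer * int P \<and>
        s' ''out'' 1 = int (denom * samples m E ^ (m + 1))) total"
      by (rule program_spec[OF s_in _ xr]) (rule s_vt)
    from this[unfolded spec_def, rule_format, OF _ bd]
    have rel: "rel_spmf ?R (exec program ?s) (spmf_of_pmf alg)"
      by (rule rel_spmf_mono) (auto simp: K_def)
    show "lossless_spmf (exec program ?s)" by (rule rel_spmf_of_pmfD[OF rel])
    have tot: "total = run_steps n m E" by (simp only: total_def run_steps_def)
    show "\<forall>(s, u)\<in>set_spmf (exec program ?s). real u \<le> poly p (real (input_size (a # b # ws)) + 1 / of_rat \<epsilon>)"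
    proof (clarify)
      fix s u assume "(s, u) \<in> set_spmf (exec program ?s)"
      from rel_spmf_of_pmfD(2)[OF rel this] have "u \<le> run_steps n m E * (K * L)" by (auto simp: tot)
      also have "\<dots> \<le> C * (n + m + E + z + 1) ^ d" by (rule Cd)
      finally have "real u \<le> real (C * (n + m + E + z + 1) ^ d)" by (rule of_nat_mono)
      also have "\<dots> = C * real (n + m + E + z + 1) ^ d" by simp
      also have "\<dots> \<le> C * (2 + 3 * (z + 1 / of_rat \<epsilon>)) ^ d"
      proof (intro mult_left_mono power_mono)
        have "n \<le> z" "m \<le> z" using length_le_input_size[of "a # b # ws"] len by (simp_all add: z_def)
        then have "real n \<le> real z" "real m \<le> real z" by simp_all
        moreover have "0 \<le> 1 / real_of_rat \<epsilon>" using \<epsilon> by simp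
        ultimately show "real (n + m + E + z + 1) \<le> 2 + 3 * (z + 1 / of_rat \<epsilon>)"
          using E_le unfolding of_nat_add of_nat_1 distrib_left by (smt (verit))
      qed auto
      also have "\<dots> = poly p (real (input_size (a # b # ws)) + 1 / of_rat \<epsilon>)" by (simp add: p_def z_def mult.commute)
      finally show "real u \<le> poly p (real (input_size (a # b # ws)) + 1 / of_rat \<epsilon>)" .
    qed
    have Z: "real_of_rat (partition_function \<beta> \<gamma> G) = target"
      by (rule target_partition_function[OF es G m_def _ refl t w]) (metis n_def vs distinct_card)
    let ?A = "{z :: nat set \<times> nat.\<bar>numer * real (snd z) / real (denom * samples m E ^ (m + 1)) - target\<bar> \<le> of_rat \<epsilon> * \<bar>target\<bar>}"
    have "3 / 4 \<le> measure_pmf.prob alg ?A" by (rule estimate_accurate) (use \<epsilon> eE in auto)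
    also note rel_spmf_of_pmfD(3)[OF rel, of ?A]
    also have "measure (measure_spmf (exec program ?s)) {x. \<exists>y\<in>?A. ?R x y} \<le>
      measure (measure_spmf (exec program ?s)) {(s, u). approximates \<epsilon> (partition_function \<beta> \<gamma> G) s}"
    proof (rule measure_spmf.finite_measure_mono, intro subsetI)
      fix x assume "x \<in> {x. \<exists>y\<in>?A. ?R x y}"
      then have "\<exists>y\<in>?A. ?R x y" by (rule CollectD)
      then obtain y where y: "y \<in> ?A" "?R x y" by (rule bexE)
      obtain s u where x: "x = (s, u)" by force
      have acc: "\<bar>numer * real (snd y) / real (denom * samples m E ^ (m + 1)) - target\<bar> \<le> of_rat \<epsilon> * \<bar>target\<bar>"
        using y(1) by (rule CollectD)
      have out: "s ''out'' 0 = numer * int (snd y)" "s ''out'' 1 = int (denom * samples m E ^ (m + 1))"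
        using y(2) by (auto simp: x)
      have "0 < samples m E" using N_eq J1 B1 by simp
      moreover have "0 < denom" using dd_pos scale1[of m] by (simp add: denom_def)
      ultimately have pos: "0 < s ''out'' 1" unfolding out by simp
      have "real_of_rat \<bar>of_int (s ''out'' 0) / of_int (s ''out'' 1) - partition_function \<beta> \<gamma> G\<bar> =
          \<bar>numer * real (snd y) / real (denom * samples m E ^ (m + 1)) - target\<bar>"
        unfolding out abs_of_rat[symmetric] of_rat_diff of_rat_divide of_int_of_nat_eq of_int_mult of_rat_mult
          of_rat_of_int_eq of_rat_of_nat_eq Z ..
      also have "\<dots> \<le> real_of_rat (\<epsilon> * \<bar>partition_function \<beta> \<gamma> G\<bar>)"
        using acc by (simp only: of_rat_mult abs_of_rat[symmetric] Z)
      finally show "x \<in> {(s, u). approximates \<epsilon> (partition_function \<beta> \<gamma> G) s}"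
        using pos by (simp add: x approximates_def of_rat_less_eq)
    qed simp
    finally show "3 / 4 \<le> measure (measure_spmf (exec program ?s)) {(s, u). approximates \<epsilon> (partition_function \<beta> \<gamma> G) s}" .
  qed
  have "is_fpras program encodes_mgraph (partition_function \<beta> \<gamma>)"
    unfolding is_fpras_def Let_def using main by (intro exI[of _ p]) blast
  then show ?thesis by blast
qed

end
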